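(* Let $K$ be a field (of arbitrary characteristic) and $S=K[X_1,\dots,X_n]$ the standard graded polynomial ring. For $n\geq 3$ and $c\geq 3$ one has $\operatorname{index}(S^{(c)})\leq 3c-3$, and equality holds for $n=3$.
   Context: The Veronese subring $S^{(c)}=\bigoplus_{i\in\mathbb N}S_{ic}$ is regarded as a standard graded $K$-algebra with $S_{ic}$ in degree $i$. The Green-Lazarsfeld index of a standard graded $K$-algebra $A$, written as a graded quotient of a standard graded polynomial ring $P$, is $\operatorname{index}(A)=\sup\{p\in\mathbb N: t_i^P(A)\le i+1\text{ for every } i\le p\}\in\mathbb N\cup\{\infty\}$, where $t_i^P(A)=\max\{j:\operatorname{Tor}_i^P(A,K)_j\neq0\}$ (and $-\infty$ if $\operatorname{Tor}_i^P(A,K)=0$); it does not depend on the choice of $P$. *)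

theory Defs
  imports
    Complex_Main
    "HOL-Library.Poly_Mapping"
    "HOL-Library.Extended_Real"
begin

text \<open>
  Polynomials in the variables \<open>X\<^sub>0, X\<^sub>1, \<dots>\<close> are finitely supported functions from exponent
  vectors to coefficients, with the convolution product of \<^theory>\<open>HOL-Library.Poly_Mapping\<close>.
  Degrees are integers, so that free modules can be shifted; \<open>homog m d = {0}\<close> for \<open>d < 0\<close>.
\<close>

type_synonym 'k mpoly = "(nat \<Rightarrow>\<^sub>0 nat) \<Rightarrow>\<^sub>0 'k"

definition mon_degree :: "(nat \<Rightarrow>\<^sub>0 nat) \<Rightarrow> nat"
  where "mon_degree t = (\<Sum>v\<in>Poly_Mapping.keys t. Poly_Mapping.lookup t v)"

definition polys :: "nat \<Rightarrow> ('k::field) mpoly set"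
  where "polys m = {p. \<forall>t\<in>Poly_Mapping.keys p. Poly_Mapping.keys t \<subseteq> {..<m}}"

definition homog :: "nat \<Rightarrow> int \<Rightarrow> ('k::field) mpoly set"
  where "homog m d = {p \<in> polys m. \<forall>t\<in>Poly_Mapping.keys p. int (mon_degree t) = d}"

definition Const :: "'k::field \<Rightarrow> 'k mpoly"
  where "Const a = Poly_Mapping.single 0 a"

text \<open>
  A graded \<open>K\<close>-algebra is given by its structure map \<open>\<eta>\<close> and the family \<open>A\<close> of its homogeneous
  components, inside some ambient commutative ring in which their sum is direct.
  The Veronese subring of \<open>K[X\<^sub>0, \<dots>, X\<^sub>n\<^sub>-\<^sub>1]\<close> has structure map \<^const>\<open>Const\<close>.
\<close>

definition veronese :: "nat \<Rightarrow> nat \<Rightarrow> int \<Rightarrow> ('k::field) mpoly set"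
  where "veronese n c i = homog n (i * int c)"

text \<open>
  \<open>\<phi>\<close> presents \<open>A\<close> as a graded quotient of the standard graded polynomial ring in \<open>m\<close> variables
  (the values of \<open>\<phi>\<close> outside \<open>polys m\<close> play no role).
\<close>

definition graded_quotient ::
    "('k::field \<Rightarrow> 'r::comm_ring_1) \<Rightarrow> (int \<Rightarrow> 'r set) \<Rightarrow> nat \<Rightarrow> ('k mpoly \<Rightarrow> 'r) \<Rightarrow> bool"
  where "graded_quotient \<eta> A m \<phi> \<longleftrightarrow>
    (\<forall>a. \<phi> (Const a) = \<eta> a) \<and>
    (\<forall>p\<in>polys m. \<forall>q\<in>polys m. \<phi> (p + q) = \<phi> p + \<phi> q \<and> \<phi> (p * q) = \<phi> p * \<phi> q) \<and>
    (\<forall>i. \<phi> ` homog m i = A i)"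

text \<open>
  The free module with basis \<open>B \<subseteq> \<nat>\<close> over the polynomial ring \<open>P\<close> in \<open>m\<close> variables consists of the
  finitely supported coefficient vectors; the basis element \<open>b\<close> has degree \<open>s b\<close>.  Countable bases
  suffice, since \<open>P\<close> has countable \<open>K\<close>-dimension.
\<close>

definition free_module :: "nat \<Rightarrow> nat set \<Rightarrow> (nat \<Rightarrow>\<^sub>0 ('k::field) mpoly) set"
  where "free_module m B =
    {x. Poly_Mapping.keys x \<subseteq> B \<and> (\<forall>b. Poly_Mapping.lookup x b \<in> polys m)}"

definition free_part ::
    "nat \<Rightarrow> nat set \<Rightarrow> (nat \<Rightarrow> int) \<Rightarrow> int \<Rightarrow> (nat \<Rightarrow>\<^sub>0 ('k::field) mpoly) set"
  where "free_part m B s j =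
    {x. Poly_Mapping.keys x \<subseteq> B \<and> (\<forall>b. Poly_Mapping.lookup x b \<in> homog m (j - s b))}"

definition smult :: "('k::field) mpoly \<Rightarrow> (nat \<Rightarrow>\<^sub>0 'k mpoly) \<Rightarrow> (nat \<Rightarrow>\<^sub>0 'k mpoly)"
  where "smult p x = Poly_Mapping.map ((*) p) x"

text \<open>\<open>diff F i\<close> is the differential from position \<open>i + 1\<close> to position \<open>i\<close>.\<close>

record (overloaded) 'k free_complex =
  basis :: "nat \<Rightarrow> nat set"
  shift :: "nat \<Rightarrow> nat \<Rightarrow> int"
  diff :: "nat \<Rightarrow> (nat \<Rightarrow>\<^sub>0 'k mpoly) \<Rightarrow> (nat \<Rightarrow>\<^sub>0 'k mpoly)"

definition graded_free_resolution ::
    "(int \<Rightarrow> 'r::comm_ring_1 set) \<Rightarrow> nat \<Rightarrow> (('k::field) mpoly \<Rightarrow> 'r) \<Rightarrow> 'k free_complex \<Rightarrow> bool"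
  where "graded_free_resolution A m \<phi> F \<longleftrightarrow>
    (let M = (\<lambda>i. free_module m (basis F i));
         D = (\<lambda>i. free_part m (basis F i) (shift F i))
     in
       (\<forall>i. \<forall>x\<in>M (Suc i). \<forall>y\<in>M (Suc i). diff F i (x + y) = diff F i x + diff F i y) \<and>
       (\<forall>i. \<forall>p\<in>polys m. \<forall>x\<in>M (Suc i). diff F i (smult p x) = smult p (diff F i x)) \<and>
       (\<forall>i j. diff F i ` D (Suc i) j \<subseteq> D i j) \<and>
       (\<forall>i. {x \<in> M (Suc i). diff F i x = 0} = diff F (Suc i) ` M (Suc (Suc i))) \<and>
       (\<exists>\<epsilon>. (\<forall>x\<in>M 0. \<forall>y\<in>M 0. \<epsilon> (x + y) = \<epsilon> x + \<epsilon> y) \<and>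
            (\<forall>p\<in>polys m. \<forall>x\<in>M 0. \<epsilon> (smult p x) = \<phi> p * \<epsilon> x) \<and>
            (\<forall>j. \<epsilon> ` D 0 j = A j) \<and>
            {x \<in> M 0. \<epsilon> x = 0} = diff F 0 ` M 1))"

text \<open>
  Here \<open>K\<close> is the residue field of \<open>P\<close> at the ideal generated by the variables, so tensoring the
  free module with basis \<open>B\<close> with \<open>K\<close> yields the vector space of finitely supported functions from
  \<open>B\<close> to \<open>K\<close>, and the entries of the differentials are replaced by their constant terms.
\<close>

definition tensor_diff :: "('k::field) free_complex \<Rightarrow> nat \<Rightarrow> (nat \<Rightarrow>\<^sub>0 'k) \<Rightarrow> (nat \<Rightarrow>\<^sub>0 'k)"
  where "tensor_diff F i v =
    Poly_Mapping.map (\<lambda>p. Poly_Mapping.lookup p 0) (diff F i (Poly_Mapping.map Const v))"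

definition tensor_part :: "('k::field) free_complex \<Rightarrow> nat \<Rightarrow> int \<Rightarrow> (nat \<Rightarrow>\<^sub>0 'k) set"
  where "tensor_part F i j = {v. Poly_Mapping.keys v \<subseteq> {b \<in> basis F i. shift F i b = j}}"

definition tensor_cycles :: "('k::field) free_complex \<Rightarrow> nat \<Rightarrow> int \<Rightarrow> (nat \<Rightarrow>\<^sub>0 'k) set"
  where "tensor_cycles F i j =
    {v \<in> tensor_part F i j. case i of 0 \<Rightarrow> True | Suc i' \<Rightarrow> tensor_diff F i' v = 0}"

definition tensor_boundaries :: "('k::field) free_complex \<Rightarrow> nat \<Rightarrow> int \<Rightarrow> (nat \<Rightarrow>\<^sub>0 'k) set"
  where "tensor_boundaries F i j = tensor_diff F i ` tensor_part F (Suc i) j"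

definition tensor_homology :: "('k::field) free_complex \<Rightarrow> nat \<Rightarrow> int \<Rightarrow> (nat \<Rightarrow>\<^sub>0 'k) set set"
  where "tensor_homology F i j =
    tensor_cycles F i j //
      {(v, w) \<in> tensor_cycles F i j \<times> tensor_cycles F i j. v - w \<in> tensor_boundaries F i j}"

text \<open>The graded pieces of \<open>Tor\<^sub>i\<^sup>P(A, K)\<close>, computed from a chosen graded free resolution of \<open>A\<close>.\<close>

definition Tor ::
    "(int \<Rightarrow> 'r::comm_ring_1 set) \<Rightarrow> nat \<Rightarrow> (('k::field) mpoly \<Rightarrow> 'r) \<Rightarrow>
     nat \<Rightarrow> int \<Rightarrow> (nat \<Rightarrow>\<^sub>0 'k) set set"
  where "Tor A m \<phi> = tensor_homology (SOME F. graded_free_resolution A m \<phi> F)"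

text \<open>
  The residue classes not containing 0 are the nonzero elements of \<open>Tor\<close>.
  The supremum is taken in the extended reals, so it is \<open>-\<infinity>\<close> for \<open>Tor\<^sub>i = 0\<close>; otherwise it is a
  maximum, as \<open>Tor\<^sub>i\<close> is finite-dimensional over \<open>K\<close>.
\<close>

definition top_degree ::
    "(int \<Rightarrow> 'r::comm_ring_1 set) \<Rightarrow> nat \<Rightarrow> (('k::field) mpoly \<Rightarrow> 'r) \<Rightarrow> nat \<Rightarrow> ereal"
  where "top_degree A m \<phi> i = Sup {ereal (real_of_int j) | j. \<exists>h\<in>Tor A m \<phi> i j. 0 \<notin> h}"

definition index_over ::
    "(int \<Rightarrow> 'r::comm_ring_1 set) \<Rightarrow> nat \<Rightarrow> (('k::field) mpoly \<Rightarrow> 'r) \<Rightarrow> enat"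
  where "index_over A m \<phi> = Sup {enat p | p. \<forall>i\<le>p. top_degree A m \<phi> i \<le> ereal (real i + 1)}"

text \<open>The index does not depend on the presentation of \<open>A\<close>, so an arbitrary one is chosen.\<close>

definition green_lazarsfeld_index ::
    "('k::field \<Rightarrow> 'r::comm_ring_1) \<Rightarrow> (int \<Rightarrow> 'r set) \<Rightarrow> enat"
  where "green_lazarsfeld_index \<eta> A =
    (case SOME (m, \<phi>). graded_quotient \<eta> A m \<phi> of (m, \<phi>) \<Rightarrow> index_over A m \<phi>)"

end

theory Submission
  imports Defs "HOL-Library.Countable_Set" "HOL-Library.Function_Algebras"
begin

text \<open>
  \<open>Tor\<close> is compared with Koszul homology by dimension shifting along a free resolution, and the
  Koszul homology of \<open>S\<^sup>(\<^sup>c\<^sup>)\<close> with respect to an arbitrary presentation is compared with the one with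
  respect to the monomials of degree \<open>c\<close> by adjoining dependent generators.

  For \<open>n = 3\<close> the elements \<open>X\<^sub>l\<^sup>c\<close> form a regular sequence on \<open>S\<^sup>(\<^sup>c\<^sup>)\<close> and on the module \<open>\<Oplus>\<^sub>i S\<^bsub>ic-3\<^esub>\<close>.
  Modulo this sequence the Veronese ring lives in degrees 0, 1, 2, and its degree 2 part is dual to
  \<open>W = S\<^bsub>c-3\<^esub>\<close>.  So Koszul homology in the second strand at position \<open>i\<close> is dual to the cycles in
  \<open>\<And>\<^sup>k V' \<otimes> W\<close>, where \<open>V'\<close> is spanned by the \<open>dim W + 3c - 3\<close> monomials of degree \<open>c\<close> other than
  \<open>X\<^sub>l\<^sup>c\<close>, and \<open>k = dim V' - i\<close>.  For \<open>i \<le> 3c - 3\<close> these lift to cycles over \<open>S\<^sup>(\<^sup>c\<^sup>)\<close> and vanish by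
  Green's theorem, as \<open>k \<ge> dim W\<close>.  For \<open>i = 3c - 2\<close> the Koszul cycle on the elements
  \<open>X\<^sub>0X\<^sub>1X\<^sub>2w\<close> for the monomials \<open>w \<in> W\<close> is nonzero; its class survives for \<open>n \<ge> 3\<close>, since
  \<open>K[X\<^sub>0, X\<^sub>1, X\<^sub>2]\<^sup>(\<^sup>c\<^sup>)\<close> is an algebra retract of \<open>S\<^sup>(\<^sup>c\<^sup>)\<close>.
\<close>

section \<open>Koszul complexes\<close>

text \<open>Duality enters because K[X_0, X_1, X_2] / (X_0^c, X_1^c, X_2^c) has a one-dimensional
  socle, in degree 3c - 3, and multiplication into it pairs degree 2c perfectly with degree c - 3.
  Sets of generators are paired with their complements. Green's theorem compares leading monomials
  only, so it holds in every characteristic.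

  The constant: X_0X_1X_2W accounts for dim W of the monomials spanning V'. The others involve
  exactly two variables, c - 1 for each of the three pairs, so dim V' - i \<ge> dim W means i \<le>
  3c - 3.

  The obstruction: write q = X_0X_1X_2. The signed sum over w of w times the exterior product of all
  qw' with w' \<noteq> w is a cycle with values in W, as each pair {w, w'} contributes qww' twice to
  its boundary, with opposite signs. Its exterior degree is dim W - 1, which belongs to i = 3c - 2.

  \<open>green_lazarsfeld_index\<close> rests on an arbitrary presentation and \<open>Tor\<close> on
  an arbitrary resolution. Neither choice can be inspected, so both are traded for Koszul homology
  of the algebra itself.\<close>

definition sg :: "'i::linorder \<Rightarrow> 'i set \<Rightarrow> 'm::ab_group_add \<Rightarrow> 'm"
  where "sg v T x = (if even (card {u \<in> T. u < v}) then x else - x)"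

lemma sg_zero [simp]: "sg v T 0 = 0"
  and sg_sg [simp]: "sg v T (sg v T x) = x"
  and sg_uminus: "sg v T (- x) = - sg v T x"
  and sg_add: "sg v T (x + y) = sg v T x + sg v T y"
  and sg_commute: "sg v T (sg w U x) = sg w U (sg v T x)"
  and sg_eq_0_iff [simp]: "sg v T x = 0 \<longleftrightarrow> x = 0"
  by (auto simp: sg_def)

lemma sg_sum: "sg v T (\<Sum>x\<in>S. f x) = (\<Sum>x\<in>S. sg v T (f x))"
  by (simp add: sg_def sum_negf)

lemma sg_insert:
  assumes "finite T" and "w \<notin> T"
  shows "sg v (insert w T) x = (if w < v then - sg v T x else sg v T x)"
proof (cases "w < v")
  case True
  then have "{u \<in> insert w T. u < v} = insert w {u \<in> T. u < v}"
    by auto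
  then have "card {u \<in> insert w T. u < v} = Suc (card {u \<in> T. u < v})"
    using assms by simp
  then show ?thesis
    using True by (simp add: sg_def)
next
  case False
  then have "{u \<in> insert w T. u < v} = {u \<in> T. u < v}"
    by auto
  then show ?thesis
    using False by (simp add: sg_def)
qed

text \<open>The sign rule e_v \<and> e_w = - e_w \<and> e_v: one of v and w lies below the other, so
  inserting both changes exactly one of the two counts.\<close>

lemma sg_swap:
  assumes "finite T" and "v \<notin> T" and "w \<notin> T" and "v \<noteq> w"
  shows "sg v (insert w T) (sg w (insert v T) x) = - sg v T (sg w T x)"
  using assms by (auto simp: sg_insert sg_uminus)

text \<open>The terms cancel in pairs. Leaving out the diagonal makes this valid in characteristic
  2, where antisymmetry says nothing about \<open>f x x\<close>.\<close>

lemma sum_antisym_eq_0: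
  fixes f :: "'b \<Rightarrow> 'b \<Rightarrow> 'm::ab_group_add"
  assumes "finite S" and "\<And>x y. x \<in> S \<Longrightarrow> y \<in> S \<Longrightarrow> x \<noteq> y \<Longrightarrow> f x y = - f y x"
  shows "(\<Sum>x\<in>S. \<Sum>y\<in>S - {x}. f x y) = 0"
  using assms
proof (induction S rule: finite_induct)
  case (insert a S)
  have "(\<Sum>y\<in>insert a S - {x}. f x y) = f x a + (\<Sum>y\<in>S - {x}. f x y)" if "x \<in> S" for x
  proof -
    have "insert a S - {x} = insert a (S - {x})"
      using insert.hyps that by auto
    then show ?thesis
      using insert.hyps by simp
  qed
  then have "(\<Sum>x\<in>insert a S. \<Sum>y\<in>insert a S - {x}. f x y) =
      (\<Sum>y\<in>S. f a y) + ((\<Sum>x\<in>S. f x a) + (\<Sum>x\<in>S. \<Sum>y\<in>S - {x}. f x y))"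
    using insert.hyps by (simp add: sum.distrib)
  also have "(\<Sum>x\<in>S. f x a) = - (\<Sum>y\<in>S. f a y)"
    unfolding sum_negf [symmetric] using insert.hyps insert.prems by (intro sum.cong) auto
  also have "(\<Sum>x\<in>S. \<Sum>y\<in>S - {x}. f x y) = 0"
    by (rule insert.IH, rule insert.prems) auto
  finally show ?case
    by simp
qed simp

text \<open>
  The exterior power \<open>\<And>\<^sup>k V \<otimes> X\<close>, where \<open>V\<close> has basis \<open>I\<close>, consists of functions on the
  \<open>k\<close>-element subsets of \<open>I\<close>.  Integer \<open>k\<close> saves a case distinction in degree 0.
\<close>

definition chain :: "'i set \<Rightarrow> int \<Rightarrow> 'm::zero set \<Rightarrow> ('i set \<Rightarrow> 'm) set"
  where "chain I k X = {f. \<forall>T. if T \<subseteq> I \<and> int (card T) = k then f T \<in> X else f T = 0}"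

definition kd :: "'i::linorder set \<Rightarrow> ('i \<Rightarrow> 'm \<Rightarrow> 'm::ab_group_add) \<Rightarrow> ('i set \<Rightarrow> 'm) \<Rightarrow> ('i set \<Rightarrow> 'm)"
  where "kd I a f T = (if T \<subseteq> I then \<Sum>v\<in>I - T. sg v T (a v (f (insert v T))) else 0)"

text \<open>Vanishing of the Koszul homology of \<open>\<Oplus>\<^sub>j X j\<close> at \<open>\<And>\<^sup>k V \<otimes> X j\<close>.\<close>

definition kexact :: "'i::linorder set \<Rightarrow> ('i \<Rightarrow> 'm \<Rightarrow> 'm::ab_group_add) \<Rightarrow> (int \<Rightarrow> 'm set) \<Rightarrow> int \<Rightarrow> int \<Rightarrow> bool"
  where "kexact I a X k j \<longleftrightarrow>
    (\<forall>f\<in>chain I k (X j). kd I a f = (\<lambda>_. 0) \<longrightarrow> (\<exists>g\<in>chain I (k + 1) (X (j - 1)). kd I a g = f))"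

text \<open>
  The Koszul complex on \<open>insert w I\<close> is the mapping cone of \<open>a w\<close> on the Koszul complex on \<open>I\<close>;
  \<open>kjoin w z y\<close> stands for \<open>z + e\<^sub>w \<and> y\<close>.
\<close>

definition kjoin :: "'i::linorder \<Rightarrow> ('i set \<Rightarrow> 'm::ab_group_add) \<Rightarrow> ('i set \<Rightarrow> 'm) \<Rightarrow> ('i set \<Rightarrow> 'm)"
  where "kjoin w z y T = (if w \<in> T then sg w (T - {w}) (y (T - {w})) else z T)"

definition kbot :: "'i \<Rightarrow> ('i set \<Rightarrow> 'm::ab_group_add) \<Rightarrow> ('i set \<Rightarrow> 'm)"
  where "kbot w f T = (if w \<in> T then 0 else f T)"

definition ktop :: "'i::linorder \<Rightarrow> ('i set \<Rightarrow> 'm::ab_group_add) \<Rightarrow> ('i set \<Rightarrow> 'm)"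
  where "ktop w f T = (if w \<in> T then 0 else sg w T (f (insert w T)))"

lemma kjoin_kbot_ktop: "kjoin w (kbot w f) (ktop w f) = f"
  by (auto simp: kjoin_def kbot_def ktop_def fun_eq_iff insert_absorb)

lemma chain_outside: "f \<in> chain I k X \<Longrightarrow> \<not> T \<subseteq> I \<Longrightarrow> f T = 0"
  by (auto simp: chain_def)

lemma kbot_kjoin: "w \<notin> I \<Longrightarrow> z \<in> chain I k X \<Longrightarrow> kbot w (kjoin w z y) = z"
  using chain_outside[of z I k X] by (auto simp: kjoin_def kbot_def fun_eq_iff)

lemma ktop_kjoin: "w \<notin> I \<Longrightarrow> y \<in> chain I k X \<Longrightarrow> ktop w (kjoin w z y) = y"
  using chain_outside[of y I k X] by (auto simp: kjoin_def ktop_def fun_eq_iff)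

lemma kd_outside: "\<not> T \<subseteq> I \<Longrightarrow> kd I a f T = 0"
  by (simp add: kd_def)

lemma chain_mem: "f \<in> chain I k X \<Longrightarrow> 0 \<in> X \<Longrightarrow> f T \<in> X"
  by (auto simp: chain_def split: if_splits dest: spec[of _ T])

lemma chain_map:
  assumes "f \<in> chain I k X" and "\<And>x. x \<in> X \<Longrightarrow> h x \<in> Y" and "h 0 = 0"
  shows "(\<lambda>T. h (f T)) \<in> chain I k Y"
  using assms by (auto simp: chain_def)

lemma chain_add:
  assumes "f \<in> chain I k X" and "g \<in> chain I k X" and "\<And>x y. x \<in> X \<Longrightarrow> y \<in> X \<Longrightarrow> x + y \<in> X"
  shows "(\<lambda>T. f T + g T :: 'm::ab_group_add) \<in> chain I k X"
  using assms by (auto simp: chain_def)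

lemma chain_diff:
  assumes "f \<in> chain I k X" and "g \<in> chain I k X" and "\<And>x y. x \<in> X \<Longrightarrow> y \<in> X \<Longrightarrow> x - y \<in> X"
  shows "(\<lambda>T. f T - g T :: 'm::ab_group_add) \<in> chain I k X"
  using assms by (auto simp: chain_def)

lemma chain_choose:
  assumes "\<And>T. T \<subseteq> I \<Longrightarrow> int (card T) = k \<Longrightarrow> \<exists>x\<in>X. P T x"
  obtains f where "f \<in> chain I k X" and "\<And>T. T \<subseteq> I \<Longrightarrow> int (card T) = k \<Longrightarrow> P T (f T)"
proof -
  define f where "f T = (if T \<subseteq> I \<and> int (card T) = k then SOME x. x \<in> X \<and> P T x else 0)" for T
  have "f T \<in> X \<and> P T (f T)" if "T \<subseteq> I" "int (card T) = k" for T
    using someI_ex[of "\<lambda>x. x \<in> X \<and> P T x"] assms[OF that] that by (auto simp: f_def)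
  moreover have "f T = 0" if "\<not> (T \<subseteq> I \<and> int (card T) = k)" for T
    using that by (auto simp: f_def)
  ultimately show ?thesis
    using that[of f] by (auto simp: chain_def)
qed

lemma chain_lift:
  assumes "f \<in> chain I k (h ` X)" and "h 0 = 0"
  obtains g where "g \<in> chain I k X" and "(\<lambda>T. h (g T)) = f"
proof -
  have f: "if T \<subseteq> I \<and> int (card T) = k then f T \<in> h ` X else f T = 0" for T
    using assms(1) unfolding chain_def by blast
  have "\<exists>x\<in>X. h x = f T" if "T \<subseteq> I" "int (card T) = k" for T
    using f[of T] that by auto
  then obtain g where g: "g \<in> chain I k X" "\<And>T. T \<subseteq> I \<Longrightarrow> int (card T) = k \<Longrightarrow> h (g T) = f T"
    by (rule chain_choose[of I k X "\<lambda>T x. h x = f T"]) blast+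
  have "h (g T) = f T" for T
    using g f[of T] assms(2) by (cases "T \<subseteq> I \<and> int (card T) = k") (auto simp: chain_def)
  then show ?thesis
    using that g(1) by blast
qed

text \<open>Only commuting additive operators of degree one are demanded, and no scalars, so that
  free modules, their syzygies, the algebra and its truncations are all instances.\<close>

locale graded_ops =
  fixes I :: "'i::linorder set" and a :: "'i \<Rightarrow> 'm \<Rightarrow> 'm::ab_group_add" and X :: "int \<Rightarrow> 'm set"
  assumes finite_index: "finite I"
    and op_add: "v \<in> I \<Longrightarrow> a v (x + y) = a v x + a v y"
    and op_commute: "v \<in> I \<Longrightarrow> w \<in> I \<Longrightarrow> a v (a w x) = a w (a v x)"
    and zero_mem: "0 \<in> X j"
    and diff_mem: "x \<in> X j \<Longrightarrow> y \<in> X j \<Longrightarrow> x - y \<in> X j"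
    and op_mem: "v \<in> I \<Longrightarrow> x \<in> X j \<Longrightarrow> a v x \<in> X (j + 1)"
begin

lemma uminus_mem: "x \<in> X j \<Longrightarrow> - x \<in> X j"
  using diff_mem[OF zero_mem, of x j] by simp

lemma add_mem: "x \<in> X j \<Longrightarrow> y \<in> X j \<Longrightarrow> x + y \<in> X j"
  using diff_mem[OF _ uminus_mem, of x j y] by simp

lemma sum_mem: "(\<And>s. s \<in> S \<Longrightarrow> f s \<in> X j) \<Longrightarrow> (\<Sum>s\<in>S. f s) \<in> X j"
  by (induction S rule: infinite_finite_induct) (auto simp: zero_mem add_mem)

lemma sg_mem: "x \<in> X j \<Longrightarrow> sg v T x \<in> X j"
  by (simp add: sg_def uminus_mem)

lemma op_zero: "v \<in> I \<Longrightarrow> a v 0 = 0"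
  using op_add[of v 0 0] by simp

lemma op_uminus: "v \<in> I \<Longrightarrow> a v (- x) = - a v x"
  using op_add[of v x "- x"] op_zero[of v] by (simp add: eq_neg_iff_add_eq_0 add.commute)

lemma op_sg: "v \<in> I \<Longrightarrow> a v (sg w T x) = sg w T (a v x)"
  by (simp add: sg_def op_uminus)

lemma op_sum: "v \<in> I \<Longrightarrow> a v (\<Sum>s\<in>S. f s) = (\<Sum>s\<in>S. a v (f s))"
  by (induction S rule: infinite_finite_induct) (auto simp: op_zero op_add)

lemma subset: "J \<subseteq> I \<Longrightarrow> graded_ops J a X"
  by unfold_locales
    (auto intro: finite_subset finite_index op_add op_commute zero_mem diff_mem op_mem)

lemma kd_zero [simp]: "kd I a (\<lambda>_. 0) = (\<lambda>_. 0)"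
  by (auto simp: kd_def fun_eq_iff op_zero)

lemma kd_add: "kd I a (\<lambda>T. f T + g T) = (\<lambda>T. kd I a f T + kd I a g T)"
  by (auto simp: kd_def fun_eq_iff op_add sg_add sum.distrib)

lemma kd_uminus: "kd I a (\<lambda>T. - f T) = (\<lambda>T. - kd I a f T)"
  by (auto simp: kd_def fun_eq_iff op_uminus sg_uminus sum_negf)

lemma kd_diff: "kd I a (\<lambda>T. f T - g T) = (\<lambda>T. kd I a f T - kd I a g T)"
  using kd_add[of f "\<lambda>T. - g T"] by (simp add: kd_uminus)

lemma kd_sum: "kd I a (\<lambda>T. \<Sum>s\<in>S. f s T) = (\<lambda>T. \<Sum>s\<in>S. kd I a (f s) T)"
  by (induction S rule: infinite_finite_induct) (simp_all add: kd_add)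

lemma kd_chain:
  assumes "f \<in> chain I k (X j)"
  shows "kd I a f \<in> chain I (k - 1) (X (j + 1))"
proof -
  have "kd I a f T \<in> X (j + 1)" for T
    using chain_mem[OF assms zero_mem] by (auto simp: kd_def zero_mem intro!: sum_mem sg_mem op_mem)
  moreover have "kd I a f T = 0" if "T \<subseteq> I" "int (card T) \<noteq> k - 1" for T
  proof -
    have "f (insert v T) = 0" if "v \<in> I - T" for v
    proof -
      have "int (card (insert v T)) \<noteq> k"
        using that \<open>T \<subseteq> I\<close> \<open>int (card T) \<noteq> k - 1\<close> finite_subset[OF _ finite_index] by auto
      then show ?thesis
        using assms by (auto simp: chain_def)
    qed
    then show ?thesis
      by (simp add: kd_def op_zero)
  qed
  ultimately have "if T \<subseteq> I \<and> int (card T) = k - 1 then kd I a f T \<in> X (j + 1) else kd I a f T = 0" for T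
    by (cases "T \<subseteq> I") (simp_all add: kd_outside)
  then show ?thesis
    by (simp add: chain_def)
qed

lemma chain_zero: "(\<lambda>_. 0) \<in> chain I k (X j)"
  by (auto simp: chain_def zero_mem)

lemma kexact_negative: "k < 0 \<Longrightarrow> kexact I a X k j"
proof -
  assume "k < 0"
  then have "f = (\<lambda>_. 0)" if "f \<in> chain I k (X j)" for f
    using that by (auto simp: chain_def fun_eq_iff)
  then show ?thesis
    unfolding kexact_def using chain_zero kd_zero by metis
qed

end

section \<open>Adjoining one generator\<close>

locale graded_ops_insert = graded_ops "insert w I" a X
  for w :: "'i::linorder" and I :: "'i set" and a :: "'i \<Rightarrow> 'm \<Rightarrow> 'm::ab_group_add" and X :: "int \<Rightarrow> 'm set" +
  assumes new: "w \<notin> I"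
begin

sublocale sub: graded_ops I a X
  by (rule subset) auto

lemma kd_new: "kd I a (\<lambda>T. a w (f T)) T = a w (kd I a f T)"
proof -
  have "a v (a w x) = a w (a v x)" if "v \<in> I" for v x
    using that by (intro op_commute) auto
  then show ?thesis
    by (auto simp: kd_def op_zero op_sum op_sg intro!: sum.cong)
qed

text \<open>Contracting \<open>w\<close> itself returns \<open>a w (y T)\<close>; contracting any
  other generator has to pass e_w, which costs the sign in the second component.\<close>

lemma kd_kjoin:
  assumes "y \<in> chain I k U"
  shows "kd (insert w I) a (kjoin w z y) =
    kjoin w (\<lambda>T. kd I a z T + a w (y T)) (\<lambda>T. - kd I a y T)"
proof
  fix T
  consider "\<not> T \<subseteq> insert w I" | "T \<subseteq> I" | S where "T = insert w S" "S \<subseteq> I" "w \<notin> S"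
    by (metis Diff_insert_absorb insert_absorb new subset_insert subset_insert_iff mk_disjoint_insert)
  then show "kd (insert w I) a (kjoin w z y) T =
      kjoin w (\<lambda>T. kd I a z T + a w (y T)) (\<lambda>T. - kd I a y T) T"
  proof cases
    case 1
    then have "\<not> T \<subseteq> I" and "\<not> T - {w} \<subseteq> I"
      by auto
    then show ?thesis
      using 1 chain_outside[OF assms] by (simp add: kjoin_def kd_outside op_zero)
  next
    case 2
    then have w: "w \<notin> T"
      using new by auto
    have "insert w I - T = insert w (I - T)"
      using w by auto
    then have "kd (insert w I) a (kjoin w z y) T =
      sg w T (a w (kjoin w z y (insert w T))) + (\<Sum>v\<in>I - T. sg v T (a v (kjoin w z y (insert v T))))"
      using 2 new finite_index by (auto simp: kd_def)
    also have "kjoin w z y (insert w T) = sg w T (y T)"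
      using w by (simp add: kjoin_def)
    also have "(\<Sum>v\<in>I - T. sg v T (a v (kjoin w z y (insert v T)))) = kd I a z T"
      using 2 w new by (auto simp: kd_def kjoin_def intro!: sum.cong)
    finally show ?thesis
      using w by (simp add: kjoin_def[where T = T] op_sg add.commute)
  next
    case 3
    have fin: "finite S"
      using 3 finite_index finite_subset by auto
    have "insert w I - T = I - S"
      using 3 new by auto
    then have "kd (insert w I) a (kjoin w z y) T =
        (\<Sum>v\<in>I - S. sg v T (a v (kjoin w z y (insert v T))))"
      using 3 by (auto simp: kd_def)
    also have "\<dots> = (\<Sum>v\<in>I - S. sg w S (- (sg v S (a v (y (insert v S))))))"
    proof (intro sum.cong refl)
      fix v assume v: "v \<in> I - S"
      then have "v \<noteq> w"
        using new by auto
      then have "insert v T - {w} = insert v S"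
        using 3 by auto
      then have "sg v T (a v (kjoin w z y (insert v T))) =
          sg v (insert w S) (sg w (insert v S) (a v (y (insert v S))))"
        using 3 v by (simp add: kjoin_def op_sg)
      also have "\<dots> = - sg v S (sg w S (a v (y (insert v S))))"
        using fin 3 v \<open>v \<noteq> w\<close> by (intro sg_swap) auto
      also have "\<dots> = sg w S (- (sg v S (a v (y (insert v S)))))"
        unfolding sg_uminus by (rule arg_cong[OF sg_commute])
      finally show "sg v T (a v (kjoin w z y (insert v T))) =
        sg w S (- (sg v S (a v (y (insert v S)))))" .
    qed
    also have "\<dots> = kjoin w (\<lambda>T. kd I a z T + a w (y T)) (\<lambda>T. - kd I a y T) T"
      using 3 by (simp add: kjoin_def kd_def sg_sum[symmetric] sum_negf)
    finally show ?thesis .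
  qed
qed

lemma kjoin_chain:
  assumes "z \<in> chain I k (X j)" and "y \<in> chain I (k - 1) (X j)"
  shows "kjoin w z y \<in> chain (insert w I) k (X j)"
proof -
  have "if T \<subseteq> insert w I \<and> int (card T) = k then kjoin w z y T \<in> X j else kjoin w z y T = 0" for T
  proof (cases "w \<in> T")
    case False
    then have "T \<subseteq> insert w I \<longleftrightarrow> T \<subseteq> I"
      by auto
    then show ?thesis
      using assms(1) False by (auto simp: chain_def kjoin_def)
  next
    case True
    then have T: "T \<subseteq> insert w I \<longleftrightarrow> T - {w} \<subseteq> I"
      by auto
    have "int (card T) = k \<longleftrightarrow> int (card (T - {w})) = k - 1" if "T \<subseteq> insert w I"
    proof -
      have "finite T"
        using that finite_index finite_subset by blast
      then have "card T = Suc (card (T - {w}))"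
        using card.remove[OF _ True] by blast
      then show ?thesis by auto
    qed
    then have "T \<subseteq> insert w I \<and> int (card T) = k \<longleftrightarrow> T - {w} \<subseteq> I \<and> int (card (T - {w})) = k - 1"
      using T by blast
    moreover have "if T - {w} \<subseteq> I \<and> int (card (T - {w})) = k - 1 then y (T - {w}) \<in> X j else y (T - {w}) = 0"
      using assms(2) unfolding chain_def by blast
    ultimately show ?thesis
      using True by (simp add: kjoin_def sg_mem split: if_splits)
  qed
  then show ?thesis
    by (simp add: chain_def)
qed

lemma kbot_chain:
  assumes "f \<in> chain (insert w I) k (X j)"
  shows "kbot w f \<in> chain I k (X j)"
  using assms new by (auto simp: chain_def kbot_def subset_insert_iff)

lemma ktop_chain:
  assumes "f \<in> chain (insert w I) k (X j)"
  shows "ktop w f \<in> chain I (k - 1) (X j)"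
proof -
  have "if T \<subseteq> I \<and> int (card T) = k - 1 then ktop w f T \<in> X j else ktop w f T = 0" for T
  proof (cases "w \<in> T")
    case True
    then show ?thesis
      using new by (auto simp: ktop_def)
  next
    case False
    have "int (card (insert w T)) = k \<longleftrightarrow> int (card T) = k - 1" if "T \<subseteq> I"
    proof -
      have "finite T"
        using that sub.finite_index finite_subset by blast
      then have "card (insert w T) = Suc (card T)"
        using False by simp
      then show ?thesis
        by linarith
    qed
    moreover have "insert w T \<subseteq> insert w I \<longleftrightarrow> T \<subseteq> I"
      using False by auto
    moreover have "if insert w T \<subseteq> insert w I \<and> int (card (insert w T)) = k
        then f (insert w T) \<in> X j else f (insert w T) = 0"
      using assms unfolding chain_def by blast
    ultimately show ?thesis
      using False by (simp add: ktop_def sg_mem split: if_splits)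
  qed
  then show ?thesis
    by (simp add: chain_def)
qed

lemma cycle_parts:
  assumes f: "f \<in> chain (insert w I) k (X j)" and "kd (insert w I) a f = (\<lambda>_. 0)"
  obtains z y where "f = kjoin w z y" and "z \<in> chain I k (X j)" and "y \<in> chain I (k - 1) (X j)"
    and "\<And>T. kd I a z T = - a w (y T)" and "kd I a y = (\<lambda>_. 0)"
proof
  let ?z = "kbot w f" and ?y = "ktop w f"
  show eq: "f = kjoin w ?z ?y"
    by (simp add: kjoin_kbot_ktop)
  show z: "?z \<in> chain I k (X j)"
    by (rule kbot_chain[OF f])
  show y: "?y \<in> chain I (k - 1) (X j)"
    by (rule ktop_chain[OF f])
  have "kjoin w (\<lambda>T. kd I a ?z T + a w (?y T)) (\<lambda>T. - kd I a ?y T) = (\<lambda>_. 0)"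
    using kd_kjoin[OF y, of ?z] eq assms(2) by simp
  moreover have "(\<lambda>T. kd I a ?z T + a w (?y T)) \<in> chain I (k - 1) (X (j + 1))"
    using sub.kd_chain[OF z] chain_map[OF y, of "a w"]
    by (intro chain_add) (auto simp: op_mem op_zero add_mem)
  moreover have "(\<lambda>T. - kd I a ?y T) \<in> chain I (k - 2) (X (j + 1))"
    using chain_map[OF sub.kd_chain[OF y], of uminus] by (auto simp: uminus_mem)
  ultimately have "(\<lambda>T. kd I a ?z T + a w (?y T)) = kbot w (\<lambda>_. 0)" "(\<lambda>T. - kd I a ?y T) = ktop w (\<lambda>_. 0)"
    using kbot_kjoin ktop_kjoin new by metis+
  then have *: "kd I a ?z T + a w (?y T) = 0" "- kd I a ?y T = 0" for T
    unfolding fun_eq_iff kbot_def[of w "\<lambda>_. 0"] ktop_def[of w "\<lambda>_. 0"] by simp_all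
  show "kd I a ?z T = - a w (?y T)" for T
    using *(1) by (simp add: add_eq_0_iff2)
  show "kd I a ?y = (\<lambda>_. 0)"
    using *(2) by (simp add: fun_eq_iff)
qed

lemma kjoin_boundary:
  assumes "g = kjoin w u v" and "v \<in> chain I k U"
    and "\<And>T. kd I a u T + a w (v T) = z T" and "\<And>T. - kd I a v T = y T"
  shows "kd (insert w I) a g = kjoin w z y"
proof -
  have "(\<lambda>T. kd I a u T + a w (v T)) = z"
    by (rule ext) (rule assms(3))
  moreover have "(\<lambda>T. - kd I a v T) = y"
    by (rule ext) (rule assms(4))
  ultimately show ?thesis
    unfolding assms(1) kd_kjoin[OF assms(2)] by (rule arg_cong2)
qed

end

lemma (in graded_ops) insert_locale:
  assumes "w \<in> I"
  shows "graded_ops_insert w (I - {w}) a X"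
proof -
  have "graded_ops (insert w (I - {w})) a X"
    unfolding insert_Diff[OF assms] by (rule graded_ops_axioms)
  then show ?thesis
    by (rule graded_ops_insert.intro) (rule graded_ops_insert_axioms.intro, blast)
qed

text \<open>Induction over the generators through the cone. Besides squares of the smaller
  differential, the first component of the double boundary contains a_w dy twice, with opposite
  signs.\<close>

lemma (in graded_ops) kd_kd: "f \<in> chain I k (X j) \<Longrightarrow> kd I a (kd I a f) = (\<lambda>_. 0)"
  using finite_index graded_ops_axioms
proof (induction I arbitrary: f k j rule: finite_induct)
  case empty
  show ?case
    by (auto simp: kd_def fun_eq_iff)
next
  case (insert w I)
  interpret graded_ops_insert w I a X
    using insert.hyps insert.prems by (simp add: graded_ops_insert_def graded_ops_insert_axioms_def)
  let ?z = "kbot w f" and ?y = "ktop w f"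
  note z = kbot_chain[OF insert.prems(1)] and y = ktop_chain[OF insert.prems(1)]
  have IH: "kd I a (kd I a ?z) = (\<lambda>_. 0)" "kd I a (kd I a ?y) = (\<lambda>_. 0)"
    using insert.IH z y sub.graded_ops_axioms by blast+
  have y': "(\<lambda>T. - kd I a ?y T) \<in> chain I (k - 2) (X (j + 1))"
    using chain_map[OF sub.kd_chain[OF y], of uminus] by (auto simp: uminus_mem)
  have "kd (insert w I) a (kd (insert w I) a f) =
      kd (insert w I) a (kjoin w (\<lambda>T. kd I a ?z T + a w (?y T)) (\<lambda>T. - kd I a ?y T))"
    using kd_kjoin[OF y, of ?z] by (simp add: kjoin_kbot_ktop)
  also have "\<dots> = kjoin w (\<lambda>_. 0) (\<lambda>_. 0)"
    by (rule kjoin_boundary[OF refl y'])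
      (auto simp: sub.kd_add sub.kd_uminus IH kd_new op_uminus)
  finally show ?case
    by (auto simp: kjoin_def fun_eq_iff)
qed

text \<open>Exterior multiplication by e_w is a homotopy from \<open>a w\<close> to zero. For f = z
  + e_w \<and> y it gives e_w \<and> z with boundary a_w z - e_w \<and> dz, and dz = - a_w y since f
  is a cycle.\<close>

lemma (in graded_ops) kd_op_boundary:
  assumes w: "w \<in> I" and f: "f \<in> chain I k (X j)" and "kd I a f = (\<lambda>_. 0)"
  shows "\<exists>g\<in>chain I (k + 1) (X j). kd I a g = (\<lambda>T. a w (f T))"
proof -
  define J where "J = I - {w}"
  have I: "I = insert w J"
    using w by (auto simp: J_def)
  interpret graded_ops_insert w J a X
    unfolding J_def by (rule insert_locale[OF w])
  obtain z y where *: "f = kjoin w z y" "z \<in> chain J k (X j)" "y \<in> chain J (k - 1) (X j)"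
    "\<And>T. kd J a z T = - a w (y T)" "kd J a y = (\<lambda>_. 0)"
    by (rule cycle_parts[OF f[unfolded I] assms(3)[unfolded I]]) blast
  show ?thesis
  proof (intro bexI)
    have "kd I a (kjoin w (\<lambda>_. 0) z) = kjoin w (\<lambda>T. a w (z T)) (\<lambda>T. a w (y T))"
      unfolding I by (rule kjoin_boundary[OF refl *(2)]) (simp_all add: *(4))
    then show "kd I a (kjoin w (\<lambda>_. 0) z) = (\<lambda>T. a w (f T))"
      using w by (auto simp: *(1) kjoin_def fun_eq_iff op_sg I)
    show "kjoin w (\<lambda>_. 0) z \<in> chain I (k + 1) (X j)"
      unfolding I using *(2) by (intro kjoin_chain sub.chain_zero) auto
  qed
qed

context graded_ops_insert
begin

text \<open>A piece of the long exact sequence of the cone: y bounds some u, and z + a_w u is then a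
  cycle of the smaller complex.\<close>

lemma kexact_insert:
  assumes "kexact I a X k j" and "kexact I a X (k - 1) j"
  shows "kexact (insert w I) a X k j"
  unfolding kexact_def
proof (intro ballI impI)
  fix f assume "f \<in> chain (insert w I) k (X j)" "kd (insert w I) a f = (\<lambda>_. 0)"
  then obtain z y where *: "f = kjoin w z y" "z \<in> chain I k (X j)" "y \<in> chain I (k - 1) (X j)"
    "\<And>T. kd I a z T = - a w (y T)" "kd I a y = (\<lambda>_. 0)"
    by (rule cycle_parts) metis
  obtain u where u: "u \<in> chain I k (X (j - 1))" "kd I a u = y"
    using assms(2) *(3,5) unfolding kexact_def by force
  have awu: "(\<lambda>T. a w (u T)) \<in> chain I k (X j)"
    using chain_map[OF u(1), of "a w" "X j"] op_mem[of w _ "j - 1"] by (auto simp: op_zero)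
  have "(\<lambda>T. z T + a w (u T)) \<in> chain I k (X j)"
    using *(2) awu by (intro chain_add) (auto simp: add_mem)
  moreover have "kd I a (\<lambda>T. z T + a w (u T)) = (\<lambda>_. 0)"
    by (simp add: sub.kd_add kd_new u(2) *(4))
  ultimately obtain v where v: "v \<in> chain I (k + 1) (X (j - 1))" "kd I a v = (\<lambda>T. z T + a w (u T))"
    using assms(1) unfolding kexact_def by blast
  have u': "(\<lambda>T. - u T) \<in> chain I k (X (j - 1))"
    using chain_map[OF u(1), of uminus] by (auto simp: uminus_mem)
  have "kd (insert w I) a (kjoin w v (\<lambda>T. - u T)) = f"
    unfolding *(1) by (rule kjoin_boundary[OF refl u'])
      (simp_all add: v(2) op_uminus sub.kd_uminus u(2))
  moreover have "kjoin w v (\<lambda>T. - u T) \<in> chain (insert w I) (k + 1) (X (j - 1))"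
    using v(1) u' by (intro kjoin_chain) auto
  ultimately show "\<exists>g\<in>chain (insert w I) (k + 1) (X (j - 1)). kd (insert w I) a g = f"
    by blast
qed

text \<open>In the long exact sequence of the cone, the kernel of the map from the homology on
  \<open>I\<close> to that on \<open>insert w I\<close> is the image of \<open>a w\<close>. The
  assumption \<open>null\<close> makes this image zero, so the map is injective.\<close>

lemma kexact_insertD:
  assumes ex: "kexact (insert w I) a X k j"
    and null: "\<And>f. f \<in> chain I k (X (j - 1)) \<Longrightarrow> kd I a f = (\<lambda>_. 0) \<Longrightarrow>
      \<exists>g\<in>chain I (k + 1) (X (j - 1)). kd I a g = (\<lambda>T. a w (f T))"
  shows "kexact I a X k j"
  unfolding kexact_def
proof (intro ballI impI)
  fix f assume f: "f \<in> chain I k (X j)" "kd I a f = (\<lambda>_. 0)"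
  have z0: "(\<lambda>_. 0) \<in> chain I (k - 1) (X j)"
    by (rule sub.chain_zero)
  have "kjoin w f (\<lambda>_. 0) \<in> chain (insert w I) k (X j)"
    by (rule kjoin_chain[OF f(1) z0])
  moreover have "kd (insert w I) a (kjoin w f (\<lambda>_. 0)) = (\<lambda>_. 0)"
    using kjoin_boundary[OF refl z0, of f "\<lambda>_. 0" "\<lambda>_. 0"] f(2) by (auto simp: op_zero kjoin_def)
  ultimately obtain g where g: "g \<in> chain (insert w I) (k + 1) (X (j - 1))"
    "kd (insert w I) a g = kjoin w f (\<lambda>_. 0)"
    using ex unfolding kexact_def by blast
  let ?u = "kbot w g" and ?v = "ktop w g"
  note u = kbot_chain[OF g(1)] and v = ktop_chain[OF g(1)]
  have eq: "kjoin w (\<lambda>T. kd I a ?u T + a w (?v T)) (\<lambda>T. - kd I a ?v T) = kjoin w f (\<lambda>_. 0)"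
    using kd_kjoin[OF v, of ?u] g(2) by (simp add: kjoin_kbot_ktop)
  have "(\<lambda>T. kd I a ?u T + a w (?v T)) \<in> chain I k (X j)"
  proof (rule chain_add)
    show "kd I a ?u \<in> chain I k (X j)"
      using sub.kd_chain[OF u] by simp
    show "(\<lambda>T. a w (?v T)) \<in> chain I k (X j)"
      using chain_map[OF v, of "a w" "X j"] op_mem[of w _ "j - 1"] by (auto simp: op_zero)
  qed (rule add_mem)
  from kbot_kjoin[OF new this, of "\<lambda>T. - kd I a ?v T"] have 1: "(\<lambda>T. kd I a ?u T + a w (?v T)) = f"
    unfolding eq kbot_kjoin[OF new f(1)] by (rule sym)
  have "(\<lambda>T. - kd I a ?v T) \<in> chain I (k - 1) (X j)"
    using chain_map[OF sub.kd_chain[OF v], of uminus "X j"] by (auto simp: uminus_mem)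
  from ktop_kjoin[OF new this, of "\<lambda>T. kd I a ?u T + a w (?v T)"] have "(\<lambda>T. - kd I a ?v T) = (\<lambda>_. 0)"
    unfolding eq ktop_kjoin[OF new z0] by (rule sym)
  then have "kd I a ?v = (\<lambda>_. 0)"
    by (simp add: fun_eq_iff)
  moreover have "?v \<in> chain I k (X (j - 1))"
    using v by simp
  ultimately obtain h where h: "h \<in> chain I (k + 1) (X (j - 1))" "kd I a h = (\<lambda>T. a w (?v T))"
    using null by blast
  show "\<exists>g\<in>chain I (k + 1) (X (j - 1)). kd I a g = f"
  proof (intro bexI)
    show "kd I a (\<lambda>T. ?u T + h T) = f"
      using 1 h(2) by (simp add: sub.kd_add)
    show "(\<lambda>T. ?u T + h T) \<in> chain I (k + 1) (X (j - 1))"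
      using u h(1) by (intro chain_add) (auto simp: add_mem)
  qed
qed

end

text \<open>
  For \<open>w\<close> acting as a nonzerodivisor with cokernel \<open>\<pi>\<close>, the Koszul homology on \<open>insert w I\<close> is that
  of the quotient on \<open>I\<close>.
\<close>

locale regular_op = graded_ops_insert w I a X + quot: graded_ops I b Y
  for w :: "'i::linorder" and I a and X :: "int \<Rightarrow> 'm::ab_group_add set" and b and Y :: "int \<Rightarrow> 'n::ab_group_add set" +
  fixes \<pi> :: "'m \<Rightarrow> 'n"
  assumes pi_add: "\<pi> (x + y) = \<pi> x + \<pi> y"
    and pi_op: "v \<in> I \<Longrightarrow> \<pi> (a v x) = b v (\<pi> x)"
    and pi_image: "\<pi> ` X j = Y j"
    and pi_new: "\<pi> (a w x) = 0"
    and pi_kernel: "x \<in> X j \<Longrightarrow> \<pi> x = 0 \<Longrightarrow> \<exists>y\<in>X (j - 1). x = a w y"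
    and op_inj: "x \<in> X j \<Longrightarrow> a w x = 0 \<Longrightarrow> x = 0"
begin

lemma pi_zero: "\<pi> 0 = 0"
  using pi_add[of 0 0] by simp

lemma pi_uminus: "\<pi> (- x) = - \<pi> x"
  using pi_add[of x "- x"] pi_zero by (simp add: eq_neg_iff_add_eq_0 add.commute)

lemma pi_sg: "\<pi> (sg v T x) = sg v T (\<pi> x)"
  by (simp add: sg_def pi_uminus)

lemma pi_sum: "\<pi> (\<Sum>s\<in>S. f s) = (\<Sum>s\<in>S. \<pi> (f s))"
  by (induction S rule: infinite_finite_induct) (auto simp: pi_zero pi_add)

lemma pi_diff: "\<pi> (x - y) = \<pi> x - \<pi> y"
  using pi_add[of x "- y"] by (simp add: pi_uminus)

lemma pi_kd: "\<pi> (kd I a f T) = kd I b (\<lambda>T. \<pi> (f T)) T"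
  by (auto simp: kd_def pi_zero pi_sum pi_sg pi_op)

lemma pi_chain: "f \<in> chain I k (X j) \<Longrightarrow> (\<lambda>T. \<pi> (f T)) \<in> chain I k (Y j)"
  using chain_map[of f I k "X j" \<pi> "Y j"] pi_image pi_zero by blast

lemma lift_chain:
  assumes "f \<in> chain I k (Y j)"
  obtains g where "g \<in> chain I k (X j)" and "(\<lambda>T. \<pi> (g T)) = f"
  using chain_lift[of f I k \<pi> "X j"] assms that unfolding pi_image by (simp add: pi_zero) blast

lemma divide_chain:
  assumes "f \<in> chain I k (X j)" and "\<And>T. \<pi> (f T) = 0"
  obtains g where "g \<in> chain I k (X (j - 1))" and "f = (\<lambda>T. a w (g T))"
proof -
  have "\<exists>x\<in>X (j - 1). a w x = f T" if "T \<subseteq> I" "int (card T) = k" for T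
    using pi_kernel[OF chain_mem[OF assms(1) zero_mem] assms(2), of T] by metis
  then obtain g where g: "g \<in> chain I k (X (j - 1))" "\<And>T. T \<subseteq> I \<Longrightarrow> int (card T) = k \<Longrightarrow> a w (g T) = f T"
    by (rule chain_choose[of I k "X (j - 1)" "\<lambda>T x. a w x = f T"]) blast+
  have "a w (g T) = f T" for T
    using g assms by (cases "T \<subseteq> I \<and> int (card T) = k") (auto simp: chain_def op_zero)
  then show ?thesis
    using that g(1) by presburger
qed

text \<open>A cycle z + e_w \<and> y is governed by \<pi> z: if that bounds, then z = du + a_w v for
  some u and v, and as \<open>a w\<close> is injective, the cycle condition forces y = - dv.\<close>

lemma kexact_quotientD:
  assumes "kexact I b Y k j"
  shows "kexact (insert w I) a X k j"
  unfolding kexact_def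
proof (intro ballI impI)
  fix f assume "f \<in> chain (insert w I) k (X j)" "kd (insert w I) a f = (\<lambda>_. 0)"
  then obtain z y where *: "f = kjoin w z y" "z \<in> chain I k (X j)" "y \<in> chain I (k - 1) (X j)"
    "\<And>T. kd I a z T = - a w (y T)" "kd I a y = (\<lambda>_. 0)"
    by (rule cycle_parts) metis
  have "kd I b (\<lambda>T. \<pi> (z T)) = (\<lambda>_. 0)"
    unfolding fun_eq_iff pi_kd[symmetric] by (simp add: *(4) pi_uminus pi_new)
  then obtain g where "g \<in> chain I (k + 1) (Y (j - 1))" "kd I b g = (\<lambda>T. \<pi> (z T))"
    using assms pi_chain[OF *(2)] unfolding kexact_def by blast
  then obtain u where u: "u \<in> chain I (k + 1) (X (j - 1))" "kd I b (\<lambda>T. \<pi> (u T)) = (\<lambda>T. \<pi> (z T))"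
    by (metis lift_chain)
  have "(\<lambda>T. z T - kd I a u T) \<in> chain I k (X j)"
    using sub.kd_chain[OF u(1)] *(2) by (intro chain_diff) (auto simp: diff_mem)
  moreover have "\<pi> (z T - kd I a u T) = 0" for T
    by (simp add: pi_diff pi_kd u(2))
  ultimately obtain v where v: "v \<in> chain I k (X (j - 1))" "(\<lambda>T. z T - kd I a u T) = (\<lambda>T. a w (v T))"
    by (rule divide_chain)
  have "kd I a (\<lambda>T. z T - kd I a u T) = (\<lambda>T. - a w (y T))"
    by (simp add: sub.kd_diff sub.kd_kd[OF u(1)] *(4))
  then have "a w (kd I a v T + y T) = 0" for T
    by (simp add: v(2) fun_eq_iff kd_new op_add)
  moreover have "kd I a v T + y T \<in> X j" for T
    using chain_mem[OF sub.kd_chain[OF v(1)] zero_mem, of T] chain_mem[OF *(3) zero_mem, of T]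
    by (simp add: add_mem)
  ultimately have y: "kd I a v T + y T = 0" for T
    using op_inj by blast
  have "z T = kd I a u T + a w (v T)" for T
    using v(2) by (simp add: fun_eq_iff algebra_simps)
  then have "kd (insert w I) a (kjoin w u v) = f"
    unfolding *(1) using y by (intro kjoin_boundary[OF refl v(1)]) (simp_all add: minus_equation_iff add_eq_0_iff2)
  moreover have "kjoin w u v \<in> chain (insert w I) (k + 1) (X (j - 1))"
    using u(1) v(1) by (intro kjoin_chain) auto
  ultimately show "\<exists>g\<in>chain (insert w I) (k + 1) (X (j - 1)). kd (insert w I) a g = f"
    by blast
qed

text \<open>Any lift z of f has its boundary in the kernel of \<pi>, so - dz = a_w y for some y.
  This y is a cycle because \<open>a w\<close> is injective, and it is the missing e_w
  component.\<close>

lemma lift_cycle: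
  assumes "f \<in> chain I k (Y j)" and "kd I b f = (\<lambda>_. 0)"
  obtains g where "g \<in> chain (insert w I) k (X j)" and "kd (insert w I) a g = (\<lambda>_. 0)"
    and "\<And>T. T \<subseteq> I \<Longrightarrow> \<pi> (g T) = f T"
proof -
  obtain z where z: "z \<in> chain I k (X j)" "(\<lambda>T. \<pi> (z T)) = f"
    using lift_chain[OF assms(1)] by blast
  have dz: "(\<lambda>T. - kd I a z T) \<in> chain I (k - 1) (X (j + 1))"
    using chain_map[OF sub.kd_chain[OF z(1)], of uminus] by (auto simp: uminus_mem)
  moreover have "\<pi> (- kd I a z T) = 0" for T
    by (simp add: pi_uminus pi_kd z(2) assms(2))
  ultimately obtain y where y: "y \<in> chain I (k - 1) (X (j + 1 - 1))" "(\<lambda>T. - kd I a z T) = (\<lambda>T. a w (y T))"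
    by (rule divide_chain)
  have "kd I a (\<lambda>T. - kd I a z T) = (\<lambda>_. 0)"
    by (simp add: sub.kd_uminus sub.kd_kd[OF z(1)])
  then have "a w (kd I a y T) = 0" for T
    by (simp add: y(2) fun_eq_iff kd_new)
  then have dy: "kd I a y T = 0" for T
    using op_inj chain_mem[OF sub.kd_chain[OF y(1)] zero_mem] by blast
  have sum: "kd I a z T + a w (y T) = 0" for T
    using fun_cong[OF y(2), of T] by (metis add.right_inverse)
  show ?thesis
  proof
    show "kjoin w z y \<in> chain (insert w I) k (X j)"
      using z(1) y(1) by (intro kjoin_chain) auto
    show "kd (insert w I) a (kjoin w z y) = (\<lambda>_. 0)"
      using kjoin_boundary[OF refl y(1), of z "\<lambda>_. 0" "\<lambda>_. 0"] sum dy
      by (auto simp: kjoin_def)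
    show "\<pi> (kjoin w z y T) = f T" if "T \<subseteq> I" for T
      using z(2) new that by (auto simp: kjoin_def)
  qed
qed

end

text \<open>The long exact homology sequence of \<open>0 \<rightarrow> Z \<rightarrow> X \<rightarrow> Y \<rightarrow> 0\<close> for Koszul-acyclic \<open>X\<close>.\<close>

locale koszul_ses = graded_ops I a X + quot: graded_ops I b Y
  for I :: "'i::linorder set" and a and X :: "int \<Rightarrow> 'm::ab_group_add set"
    and b and Y :: "int \<Rightarrow> 'n::ab_group_add set" +
  fixes e :: "'m \<Rightarrow> 'n"
  assumes e_add: "x \<in> X j \<Longrightarrow> y \<in> X j \<Longrightarrow> e (x + y) = e x + e y"
    and e_op: "v \<in> I \<Longrightarrow> x \<in> X j \<Longrightarrow> e (a v x) = b v (e x)"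
    and e_image: "e ` X j = Y j"
    and acyclic: "k \<ge> 1 \<Longrightarrow> kexact I a X k j"
begin

definition Z :: "int \<Rightarrow> 'm set"
  where "Z j = {x \<in> X j. e x = 0}"

lemma e_zero: "e 0 = 0"
  using e_add[OF zero_mem zero_mem] by simp

lemma e_uminus: "x \<in> X j \<Longrightarrow> e (- x) = - e x"
  using e_add[OF _ uminus_mem, of x j x] e_zero by (simp add: eq_neg_iff_add_eq_0 add.commute)

lemma e_diff: "x \<in> X j \<Longrightarrow> y \<in> X j \<Longrightarrow> e (x - y) = e x - e y"
  using e_add[OF _ uminus_mem, of x j y] by (simp add: e_uminus)

lemma e_sg: "x \<in> X j \<Longrightarrow> e (sg v T x) = sg v T (e x)"
  by (simp add: sg_def e_uminus)

lemma e_sum: "(\<And>s. s \<in> S \<Longrightarrow> f s \<in> X j) \<Longrightarrow> e (\<Sum>s\<in>S. f s) = (\<Sum>s\<in>S. e (f s))"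
proof (induction S rule: infinite_finite_induct)
  case (insert x F)
  then show ?case
    using e_add[OF insert.prems sum_mem[of F f j], of x] by auto
qed (auto simp: e_zero)

lemma e_kd:
  assumes "f \<in> chain I k (X j)"
  shows "e (kd I a f T) = kd I b (\<lambda>T. e (f T)) T"
proof (cases "T \<subseteq> I")
  case True
  have mem: "a v (f U) \<in> X (j + 1)" if "v \<in> I" for v U
    using op_mem[OF that chain_mem[OF assms zero_mem]] .
  have "e (kd I a f T) = (\<Sum>v\<in>I - T. e (sg v T (a v (f (insert v T)))))"
    unfolding kd_def if_P[OF True] using mem by (intro e_sum[where j = "j + 1"]) (auto intro: sg_mem)
  also have "\<dots> = (\<Sum>v\<in>I - T. sg v T (b v (e (f (insert v T)))))"
    using mem e_op[OF _ chain_mem[OF assms zero_mem]]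
    by (intro sum.cong) (auto simp: e_sg[where j = "j + 1"])
  finally show ?thesis
    using True by (simp add: kd_def)
qed (simp add: kd_outside e_zero)

sublocale ker: graded_ops I a Z
proof
  show "x - y \<in> Z j" if "x \<in> Z j" "y \<in> Z j" for x y j
    using that by (auto simp: Z_def diff_mem e_diff[where j = j])
  show "a v x \<in> Z (j + 1)" if "v \<in> I" "x \<in> Z j" for v x j
    using that by (auto simp: Z_def op_mem e_op[where j = j] quot.op_zero)
qed (auto simp: finite_index op_add op_commute Z_def zero_mem e_zero)

lemma e_chain: "f \<in> chain I k (X j) \<Longrightarrow> (\<lambda>T. e (f T)) \<in> chain I k (Y j)"
  using chain_map[of f I k "X j" e "Y j"] e_image e_zero by blast

lemma ker_chain: "f \<in> chain I k (Z j) \<longleftrightarrow> f \<in> chain I k (X j) \<and> (\<forall>T. e (f T) = 0)"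
proof
  assume f: "f \<in> chain I k (Z j)"
  have "(\<lambda>T. id (f T)) \<in> chain I k (X j)"
    by (rule chain_map[OF f]) (auto simp: Z_def)
  then show "f \<in> chain I k (X j) \<and> (\<forall>T. e (f T) = 0)"
    using chain_mem[OF f ker.zero_mem] by (auto simp: Z_def)
next
  assume "f \<in> chain I k (X j) \<and> (\<forall>T. e (f T) = 0)"
  then show "f \<in> chain I k (Z j)"
    unfolding chain_def Z_def mem_Collect_eq by (metis (mono_tags, lifting))
qed

lemma lift_chain:
  assumes "f \<in> chain I k (Y j)"
  obtains g where "g \<in> chain I k (X j)" and "(\<lambda>T. e (g T)) = f"
  using chain_lift[of f I k e "X j"] assms that unfolding e_image by (simp add: e_zero) blast

text \<open>A chain over X with boundary in Z is a lift of a cycle over Y, and the right side says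
  that the connecting map is injective. Stated by chains, this covers k = 1, where the complex over
  X need not be exact one step lower.\<close>

lemma kexact_quotient_iff:
  assumes "k \<ge> 1"
  shows "kexact I b Y k j \<longleftrightarrow>
    (\<forall>g\<in>chain I k (X j). (\<forall>T. e (kd I a g T) = 0) \<longrightarrow> (\<exists>h\<in>chain I k (Z j). kd I a h = kd I a g))"
    (is "_ \<longleftrightarrow> ?R")
proof
  assume ex: "kexact I b Y k j"
  show ?R
  proof (intro ballI impI)
    fix g assume g: "g \<in> chain I k (X j)" "\<forall>T. e (kd I a g T) = 0"
    then have "kd I b (\<lambda>T. e (g T)) = (\<lambda>_. 0)"
      by (simp add: fun_eq_iff e_kd[symmetric])
    then obtain q where "q \<in> chain I (k + 1) (Y (j - 1))" "kd I b q = (\<lambda>T. e (g T))"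
      using ex e_chain[OF g(1)] unfolding kexact_def by blast
    then obtain p where p: "p \<in> chain I (k + 1) (X (j - 1))" "kd I b (\<lambda>T. e (p T)) = (\<lambda>T. e (g T))"
      by (metis lift_chain)
    have dp: "kd I a p \<in> chain I k (X j)"
      using kd_chain[OF p(1)] by simp
    have "(\<lambda>T. g T - kd I a p T) \<in> chain I k (Z j)"
      unfolding ker_chain using chain_diff[OF g(1) dp] diff_mem
        e_diff[OF chain_mem[OF g(1) zero_mem] chain_mem[OF dp zero_mem]]
      by (simp add: e_kd[OF p(1)] p(2))
    moreover have "kd I a (\<lambda>T. g T - kd I a p T) = kd I a g"
      by (simp add: kd_diff kd_kd[OF p(1)])
    ultimately show "\<exists>h\<in>chain I k (Z j). kd I a h = kd I a g"
      by blast
  qed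
next
  assume R: ?R
  show "kexact I b Y k j"
    unfolding kexact_def
  proof (intro ballI impI)
    fix f assume f: "f \<in> chain I k (Y j)" "kd I b f = (\<lambda>_. 0)"
    obtain g where g: "g \<in> chain I k (X j)" "(\<lambda>T. e (g T)) = f"
      using lift_chain[OF f(1)] by blast
    have "e (kd I a g T) = 0" for T
      by (simp add: e_kd[OF g(1)] g(2) f(2))
    then obtain h where h: "h \<in> chain I k (Z j)" "kd I a h = kd I a g"
      using R g(1) by blast
    have h': "h \<in> chain I k (X j)" "\<And>T. e (h T) = 0"
      using h(1) by (auto simp: ker_chain)
    have "(\<lambda>T. g T - h T) \<in> chain I k (X j)"
      using chain_diff[OF g(1) h'(1)] diff_mem by blast
    moreover have "kd I a (\<lambda>T. g T - h T) = (\<lambda>_. 0)"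
      by (simp add: kd_diff h(2))
    ultimately obtain p where p: "p \<in> chain I (k + 1) (X (j - 1))" "kd I a p = (\<lambda>T. g T - h T)"
      using acyclic[OF assms, of j] unfolding kexact_def by blast
    have "kd I b (\<lambda>T. e (p T)) = f"
      unfolding g(2)[symmetric] fun_eq_iff e_kd[OF p(1), symmetric] p(2)
      using e_diff[OF chain_mem[OF g(1) zero_mem] chain_mem[OF h'(1) zero_mem]] h'(2) by simp
    then show "\<exists>g\<in>chain I (k + 1) (Y (j - 1)). kd I b g = f"
      using e_chain[OF p(1)] by blast
  qed
qed

text \<open>For k \<ge> 2 the homology of X vanishes on both sides, so the connecting map is an
  isomorphism. It trades exterior degree for internal degree, keeping k + j.\<close>

lemma kexact_shift:
  assumes "k \<ge> 2"
  shows "kexact I b Y k j \<longleftrightarrow> kexact I a Z (k - 1) (j + 1)"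
proof -
  have "k \<ge> 1"
    using assms by simp
  note iff = kexact_quotient_iff[OF this, of j]
  show ?thesis
    unfolding iff
  proof (intro iffI ballI impI)
    assume R: "\<forall>g\<in>chain I k (X j). (\<forall>T. e (kd I a g T) = 0) \<longrightarrow>
      (\<exists>h\<in>chain I k (Z j). kd I a h = kd I a g)"
    show "kexact I a Z (k - 1) (j + 1)"
      unfolding kexact_def
    proof (intro ballI impI)
      fix f assume f: "f \<in> chain I (k - 1) (Z (j + 1))" "kd I a f = (\<lambda>_. 0)"
      have "kexact I a X (k - 1) (j + 1)"
        using assms by (intro acyclic) simp
      then obtain g where g: "g \<in> chain I k (X j)" "kd I a g = f"
        using f unfolding kexact_def ker_chain by auto
      have "\<forall>T. e (kd I a g T) = 0"
        using f(1) unfolding g(2) ker_chain by blast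
      then obtain h where "h \<in> chain I k (Z j)" "kd I a h = f"
        using R g by blast
      then show "\<exists>g\<in>chain I (k - 1 + 1) (Z (j + 1 - 1)). kd I a g = f"
        by auto
    qed
  next
    fix g assume ex: "kexact I a Z (k - 1) (j + 1)"
      and g: "g \<in> chain I k (X j)" "\<forall>T. e (kd I a g T) = 0"
    have "kd I a g \<in> chain I (k - 1) (Z (j + 1))"
      using kd_chain[OF g(1)] g(2) by (simp add: ker_chain)
    then show "\<exists>h\<in>chain I k (Z j). kd I a h = kd I a g"
      using ex kd_kd[OF g(1)] unfolding kexact_def by force
  qed
qed

end

section \<open>Exterior degrees 0 and 1\<close>

lemma chain_0_eqI:
  assumes "f \<in> chain I 0 X" and "g \<in> chain I 0 Y" and "f {} = g {}" and "finite I"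
  shows "f = g"
proof
  fix T
  show "f T = g T"
  proof (cases "T = {}")
    case False
    then have "\<not> (T \<subseteq> I \<and> int (card T) = 0)"
      using card_0_eq[OF finite_subset[OF _ assms(4)], of T] by auto
    then show ?thesis
      using assms(1,2) unfolding chain_def by auto
  qed (use assms(3) in simp)
qed

definition chain1 :: "'i set \<Rightarrow> ('i \<Rightarrow> 'm::zero) \<Rightarrow> ('i set \<Rightarrow> 'm)"
  where "chain1 I y T = (if T \<subseteq> I \<and> card T = 1 then y (the_elem T) else 0)"

lemma chain1_chain: "(\<And>v. v \<in> I \<Longrightarrow> y v \<in> X) \<Longrightarrow> chain1 I y \<in> chain I 1 X"
  by (auto simp: chain1_def chain_def card_1_singleton_iff)

lemma kd_empty: "kd I a f {} = (\<Sum>v\<in>I. a v (f {v}))"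
  by (simp add: kd_def sg_def)

lemma kd_chain1: "kd I a (chain1 I y) {} = (\<Sum>v\<in>I. a v (y v))"
  unfolding kd_empty by (rule sum.cong) (auto simp: chain1_def)

text \<open>With m the ideal of the generators, the right side says that mX \<inter> Z = mZ, that
  is, Z/mZ \<rightarrow> X/mX is injective. The kernel of this map is the first Koszul homology of
  Y.\<close>

lemma (in koszul_ses) kexact_1_iff:
  "kexact I b Y 1 j \<longleftrightarrow>
    (\<forall>y. (\<forall>v\<in>I. y v \<in> X j) \<and> e (\<Sum>v\<in>I. a v (y v)) = 0 \<longrightarrow>
      (\<exists>y'. (\<forall>v\<in>I. y' v \<in> Z j) \<and> (\<Sum>v\<in>I. a v (y' v)) = (\<Sum>v\<in>I. a v (y v))))"
    (is "_ \<longleftrightarrow> ?R")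
proof -
  have 1: "(1::int) \<ge> 1" by simp
  show ?thesis
    unfolding kexact_quotient_iff[OF 1]
  proof (intro iffI allI impI ballI)
    fix y assume R: "\<forall>g\<in>chain I 1 (X j). (\<forall>T. e (kd I a g T) = 0) \<longrightarrow>
      (\<exists>h\<in>chain I 1 (Z j). kd I a h = kd I a g)"
      and y: "(\<forall>v\<in>I. y v \<in> X j) \<and> e (\<Sum>v\<in>I. a v (y v)) = 0"
    have c: "chain1 I y \<in> chain I 1 (X j)"
      using y by (intro chain1_chain) auto
    have "e (kd I a (chain1 I y) T) = 0" for T
    proof (cases "T = {}")
      case True
      then show ?thesis
        using y by (simp add: kd_chain1)
    next
      case False
      then have "\<not> (T \<subseteq> I \<and> int (card T) = 1 - 1)"
        using card_0_eq[OF finite_subset[OF _ finite_index], of T] by auto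
      then have "kd I a (chain1 I y) T = 0"
        using kd_chain[OF c] unfolding chain_def by auto
      then show ?thesis
        by (simp add: e_zero)
    qed
    then obtain h where h: "h \<in> chain I 1 (Z j)" "kd I a h = kd I a (chain1 I y)"
      using R c by blast
    have "(\<Sum>v\<in>I. a v (h {v})) = (\<Sum>v\<in>I. a v (y v))"
      unfolding kd_empty[symmetric] h(2) kd_chain1 by (rule refl)
    moreover have "h {v} \<in> Z j" for v
      using chain_mem[OF h(1) ker.zero_mem] .
    ultimately show "\<exists>y'. (\<forall>v\<in>I. y' v \<in> Z j) \<and> (\<Sum>v\<in>I. a v (y' v)) = (\<Sum>v\<in>I. a v (y v))"
      by (intro exI[of _ "\<lambda>v. h {v}"]) blast
  next
    fix g assume R: ?R and g: "g \<in> chain I 1 (X j)" "\<forall>T. e (kd I a g T) = 0"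
    have "(\<forall>v\<in>I. g {v} \<in> X j) \<and> e (\<Sum>v\<in>I. a v (g {v})) = 0"
      using g(2) chain_mem[OF g(1) zero_mem] unfolding kd_empty[symmetric] by blast
    then obtain y where y: "\<forall>v\<in>I. y v \<in> Z j" "(\<Sum>v\<in>I. a v (y v)) = (\<Sum>v\<in>I. a v (g {v}))"
      using R[rule_format, of "\<lambda>v. g {v}"] by blast
    have c: "chain1 I y \<in> chain I 1 (Z j)"
      using y by (intro chain1_chain) auto
    have "kd I a (chain1 I y) = kd I a g"
    proof (rule chain_0_eqI)
      show "kd I a (chain1 I y) \<in> chain I 0 (Z (j + 1))"
        using ker.kd_chain[OF c] by simp
      show "kd I a g \<in> chain I 0 (X (j + 1))"
        using kd_chain[OF g(1)] by simp
    qed (simp_all only: kd_chain1 y(2) kd_empty[symmetric] finite_index)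
    then show "\<exists>h\<in>chain I 1 (Z j). kd I a h = kd I a g"
      using c by blast
  qed
qed

section \<open>Polynomials and free modules\<close>

abbreviation lookup :: "('a \<Rightarrow>\<^sub>0 'b::zero) \<Rightarrow> 'a \<Rightarrow> 'b"
  where "lookup \<equiv> Poly_Mapping.lookup"

abbreviation keys :: "('a \<Rightarrow>\<^sub>0 'b::zero) \<Rightarrow> 'a set"
  where "keys \<equiv> Poly_Mapping.keys"

definition pfilt :: "('a \<Rightarrow> bool) \<Rightarrow> ('a \<Rightarrow>\<^sub>0 'b::zero) \<Rightarrow> ('a \<Rightarrow>\<^sub>0 'b)"
  where "pfilt P p = Poly_Mapping.mapp (\<lambda>t c. if P t then c else 0) p"

lemma lookup_pfilt: "lookup (pfilt P p) t = (if P t then lookup p t else 0)"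
  by (auto simp: pfilt_def lookup_mapp in_keys_iff when_def)

lemma lookup_single_mult_add [simp]:
  fixes p :: "('a::cancel_comm_monoid_add) \<Rightarrow>\<^sub>0 ('k::comm_semiring_1)"
  shows "lookup (Poly_Mapping.single t c * p) (t + s) = c * lookup p s"
  by (simp add: lookup_mult lookup_single when_mult)

lemma lookup_single_mult_outside:
  fixes p :: "('a::cancel_comm_monoid_add) \<Rightarrow>\<^sub>0 ('k::comm_semiring_1)"
  shows "(\<And>s. u \<noteq> t + s) \<Longrightarrow> lookup (Poly_Mapping.single t c * p) u = 0"
  by (simp add: lookup_mult lookup_single when_mult)

lemma mon_degree_add: "mon_degree (s + t) = mon_degree s + mon_degree t"
  unfolding mon_degree_def
  using setsum_keys_plus_distrib[of "\<lambda>_ k. k" s t] by simp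

lemma mon_degree_single [simp]: "mon_degree (Poly_Mapping.single v k) = k"
  by (simp add: mon_degree_def)

lemma mon_degree_zero [simp]: "mon_degree 0 = 0"
  by (simp add: mon_degree_def)

lemma keys_add_nat: "keys (s + t) = keys s \<union> keys (t :: nat \<Rightarrow>\<^sub>0 nat)"
  by (auto simp: in_keys_iff lookup_add)

lemma polys_iff: "p \<in> polys m \<longleftrightarrow> (\<forall>t. lookup p t \<noteq> 0 \<longrightarrow> keys t \<subseteq> {..<m})"
  by (auto simp: polys_def in_keys_iff)

lemma homog_iff:
  "p \<in> homog m d \<longleftrightarrow> (\<forall>t. lookup p t \<noteq> 0 \<longrightarrow> keys t \<subseteq> {..<m} \<and> int (mon_degree t) = d)"
  by (auto simp: homog_def polys_iff in_keys_iff)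

lemma keys_mult_cases:
  assumes "lookup (p * q) t \<noteq> 0"
  obtains u v where "t = u + v" and "lookup p u \<noteq> 0" and "lookup q v \<noteq> 0"
  using assms keys_mult[of p q] by (auto simp: in_keys_iff subset_iff)

lemma polys_mult: "p \<in> polys m \<Longrightarrow> q \<in> polys m \<Longrightarrow> p * q \<in> polys m"
  unfolding polys_iff by (metis keys_mult_cases keys_add_nat Un_least)

lemma homog_mult:
  assumes "p \<in> homog m d" and "q \<in> homog m e"
  shows "p * q \<in> homog m (d + e)"
  unfolding homog_iff
proof (intro allI impI)
  fix t assume "lookup (p * q) t \<noteq> 0"
  then obtain u v where "t = u + v" "lookup p u \<noteq> 0" "lookup q v \<noteq> 0"
    by (rule keys_mult_cases)
  then show "keys t \<subseteq> {..<m} \<and> int (mon_degree t) = d + e"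
    using assms unfolding homog_iff by (auto simp: keys_add_nat mon_degree_add)
qed

lemma homog_diff: "p \<in> homog m d \<Longrightarrow> q \<in> homog m d \<Longrightarrow> p - q \<in> homog m d"
  unfolding homog_iff by (metis lookup_minus diff_self diff_zero)

lemma homog_add: "p \<in> homog m d \<Longrightarrow> q \<in> homog m d \<Longrightarrow> p + q \<in> homog m d"
  unfolding homog_iff by (metis lookup_add add_0)

lemma homog_zero [simp]: "0 \<in> homog m d"
  by (simp add: homog_iff)

lemma homog_subset_polys: "homog m d \<subseteq> polys m"
  by (auto simp: homog_def)

lemma homog_single: "keys t \<subseteq> {..<m} \<Longrightarrow> int (mon_degree t) = d \<Longrightarrow> Poly_Mapping.single t c \<in> homog m d"
  by (auto simp: homog_iff lookup_single when_def)

definition Var :: "nat \<Rightarrow> 'k::field mpoly"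
  where "Var v = Poly_Mapping.single (Poly_Mapping.single v 1) 1"

lemma Var_homog: "v < m \<Longrightarrow> Var v \<in> homog m 1"
  unfolding Var_def by (rule homog_single) auto

lemma Var_polys: "v < m \<Longrightarrow> Var v \<in> polys m"
  using Var_homog homog_subset_polys by blast

lemma Const_polys: "Const a \<in> polys m"
  by (auto simp: polys_iff Const_def lookup_single when_def)

lemma add_single_minus:
  "w \<in> keys t \<Longrightarrow> t = Poly_Mapping.single w 1 + (t - Poly_Mapping.single w (1::nat))"
  by (rule poly_mapping_eqI) (auto simp: lookup_add lookup_minus lookup_single in_keys_iff when_def)

section \<open>Free modules through scalar coefficients at a basis element and a monomial\<close>

definition coef :: "(nat \<Rightarrow>\<^sub>0 'k::zero mpoly) \<Rightarrow> nat \<Rightarrow> (nat \<Rightarrow>\<^sub>0 nat) \<Rightarrow> 'k"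
  where "coef x b t = lookup (lookup x b) t"

lemma coef_eqI: "(\<And>b t. coef x b t = coef y b t) \<Longrightarrow> x = y"
  unfolding coef_def by (intro poly_mapping_eqI) auto

lemma coef_zero [simp]: "coef 0 b t = 0"
  by (simp add: coef_def)

lemma coef_add: "coef (x + y) b t = coef x b t + coef (y :: nat \<Rightarrow>\<^sub>0 'k::field mpoly) b t"
  by (simp add: coef_def lookup_add)

lemma coef_diff: "coef (x - y) b t = coef x b t - coef (y :: nat \<Rightarrow>\<^sub>0 'k::field mpoly) b t"
  by (simp add: coef_def lookup_minus)

lemma coef_sum: "coef (\<Sum>s\<in>S. f s) b t = (\<Sum>s\<in>S. coef (f s :: nat \<Rightarrow>\<^sub>0 'k::field mpoly) b t)"
  by (simp add: coef_def lookup_sum)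

lemma lookup_smult: "lookup (smult p x) b = p * lookup x b"
  by (auto simp: smult_def map.rep_eq when_def)

lemma smult_add: "smult p (x + y) = smult p x + smult p y"
  by (rule poly_mapping_eqI) (simp add: lookup_smult lookup_add algebra_simps)

lemma smult_add_left: "smult (p + q) x = smult p x + smult q x"
  by (rule poly_mapping_eqI) (simp add: lookup_smult lookup_add algebra_simps)

lemma smult_smult: "smult p (smult q x) = smult (p * q) x"
  by (rule poly_mapping_eqI) (simp add: lookup_smult algebra_simps)

lemma smult_zero [simp]: "smult p 0 = 0"
  by (rule poly_mapping_eqI) (simp add: lookup_smult)

lemma coef_Var: "coef (smult (Var w) x) b t =
    (if w \<in> keys t then coef x b (t - Poly_Mapping.single w 1) else 0)"
proof (cases "w \<in> keys t")
  case True
  have "coef (smult (Var w) x) b t =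
      coef (smult (Var w) x) b (Poly_Mapping.single w 1 + (t - Poly_Mapping.single w 1))"
    by (rule arg_cong[OF add_single_minus[OF True]])
  also have "\<dots> = coef x b (t - Poly_Mapping.single w 1)"
    unfolding coef_def lookup_smult Var_def lookup_single_mult_add by (rule mult_1)
  finally show ?thesis
    using True by simp
next
  case False
  then have "t \<noteq> Poly_Mapping.single w 1 + s" for s
    by (auto simp: in_keys_iff lookup_add lookup_single)
  then show ?thesis
    using False by (simp add: coef_def lookup_smult Var_def lookup_single_mult_outside)
qed

lemma coef_Var_add: "coef (smult (Var w) x) b (Poly_Mapping.single w 1 + t) = coef x b t"
  by (simp add: coef_def lookup_smult Var_def)

definition ffilt :: "(nat \<Rightarrow> (nat \<Rightarrow>\<^sub>0 nat) \<Rightarrow> bool) \<Rightarrow> (nat \<Rightarrow>\<^sub>0 'k::field mpoly) \<Rightarrow> (nat \<Rightarrow>\<^sub>0 'k mpoly)"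
  where "ffilt P x = Poly_Mapping.mapp (\<lambda>b. pfilt (P b)) x"

lemma coef_ffilt: "coef (ffilt P x) b t = (if P b t then coef x b t else 0)"
  by (auto simp: ffilt_def coef_def lookup_mapp in_keys_iff when_def lookup_pfilt)

lemma ffilt_add: "ffilt P (x + y) = ffilt P x + ffilt P y"
  by (rule coef_eqI) (simp add: coef_ffilt coef_add)

lemma ffilt_zero [simp]: "ffilt P 0 = 0"
  by (rule coef_eqI) (simp add: coef_ffilt)

lemma ffilt_sum: "ffilt P (\<Sum>s\<in>S. f s) = (\<Sum>s\<in>S. ffilt P (f s))"
  by (rule coef_eqI) (simp add: coef_ffilt coef_sum)

definition fdiv :: "nat \<Rightarrow> (nat \<Rightarrow>\<^sub>0 'k::field mpoly) \<Rightarrow> (nat \<Rightarrow>\<^sub>0 'k mpoly)"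
  where "fdiv w x = Poly_Mapping.map (Poly_Mapping.map_key ((+) (Poly_Mapping.single w 1))) x"

lemma coef_fdiv: "coef (fdiv w x) b t = coef x b (Poly_Mapping.single w 1 + t)"
proof -
  have "inj ((+) (Poly_Mapping.single w (1::nat)))"
    by (auto intro: injI)
  then show ?thesis
    by (simp add: fdiv_def coef_def map.rep_eq map_key.rep_eq when_def)
qed

lemma smult_Var_fdiv:
  assumes "\<And>b t. coef x b t \<noteq> 0 \<Longrightarrow> w \<in> keys t"
  shows "smult (Var w) (fdiv w x) = x"
proof (rule coef_eqI)
  fix b t
  show "coef (smult (Var w) (fdiv w x)) b t = coef x b t"
  proof (cases "w \<in> keys t")
    case True
    then show ?thesis
      unfolding coef_Var coef_fdiv using add_single_minus[OF True] by presburger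
  next
    case False
    then show ?thesis
      using assms[of b t] by (auto simp: coef_Var)
  qed
qed

lemma coef_nonzero_iff: "lookup x b \<noteq> 0 \<longleftrightarrow> (\<exists>t. coef x b t \<noteq> 0)"
  unfolding coef_def by (metis lookup_zero poly_mapping_eqI)

lemma free_module_iff:
  "x \<in> free_module m B \<longleftrightarrow> (\<forall>b t. coef x b t \<noteq> 0 \<longrightarrow> b \<in> B \<and> keys t \<subseteq> {..<m})"
  by (auto simp: free_module_def polys_iff in_keys_iff coef_nonzero_iff subset_iff
      coef_def[symmetric])

lemma free_part_iff: "x \<in> free_part m B s j \<longleftrightarrow>
    (\<forall>b t. coef x b t \<noteq> 0 \<longrightarrow> b \<in> B \<and> keys t \<subseteq> {..<m} \<and> int (mon_degree t) = j - s b)"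
  by (auto simp: free_part_def homog_iff in_keys_iff coef_nonzero_iff subset_iff
      coef_def[symmetric])

lemma free_part_subset: "free_part m B s j \<subseteq> free_module m B"
  by (auto simp: free_part_iff free_module_iff)

lemma free_module_add: "x \<in> free_module m B \<Longrightarrow> y \<in> free_module m B \<Longrightarrow> x + y \<in> free_module m B"
  unfolding free_module_iff coef_add by (metis add_0)

lemma free_module_zero [simp]: "0 \<in> free_module m B"
  by (simp add: free_module_iff)

lemma free_module_sum: "(\<And>s. s \<in> S \<Longrightarrow> f s \<in> free_module m B) \<Longrightarrow> (\<Sum>s\<in>S. f s) \<in> free_module m B"
  by (induction S rule: infinite_finite_induct) (auto simp: free_module_add)

lemma free_module_smult: "p \<in> polys m \<Longrightarrow> x \<in> free_module m B \<Longrightarrow> smult p x \<in> free_module m B"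
  by (auto simp: free_module_def lookup_smult in_keys_iff intro: polys_mult)

lemma free_part_zero [simp]: "0 \<in> free_part m B s j"
  by (simp add: free_part_iff)

lemma free_part_diff: "x \<in> free_part m B s j \<Longrightarrow> y \<in> free_part m B s j \<Longrightarrow> x - y \<in> free_part m B s j"
  unfolding free_part_iff coef_diff by (metis diff_self diff_zero)

lemma free_part_add: "x \<in> free_part m B s j \<Longrightarrow> y \<in> free_part m B s j \<Longrightarrow> x + y \<in> free_part m B s j"
  unfolding free_part_iff coef_add by (metis add_0)

lemma free_part_Var:
  assumes "w < m" and "x \<in> free_part m B s j"
  shows "smult (Var w) x \<in> free_part m B s (j + 1)"
proof -
  have "lookup (smult (Var w) x) b \<in> homog m (j + 1 - s b)" for b
    using homog_mult[OF Var_homog[OF assms(1)], of "lookup x b" "j - s b"] assms(2)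
    by (simp add: lookup_smult free_part_def algebra_simps)
  then show ?thesis
    using assms(2) by (auto simp: free_part_def lookup_smult in_keys_iff)
qed

lemma free_part_fdiv: "x \<in> free_part m B s j \<Longrightarrow> fdiv w x \<in> free_part m B s (j - 1)"
  unfolding free_part_iff coef_fdiv
  by (force simp: keys_add_nat mon_degree_add)

lemma free_part_ffilt: "x \<in> free_part m B s j \<Longrightarrow> ffilt P x \<in> free_part m B s j"
  by (auto simp: free_part_iff coef_ffilt)

definition hc :: "(nat \<Rightarrow> int) \<Rightarrow> int \<Rightarrow> (nat \<Rightarrow>\<^sub>0 'k::field mpoly) \<Rightarrow> (nat \<Rightarrow>\<^sub>0 'k mpoly)"
  where "hc s j = ffilt (\<lambda>b t. int (mon_degree t) = j - s b)"

lemma hc_free_part: "x \<in> free_module m B \<Longrightarrow> hc s j x \<in> free_part m B s j"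
  by (auto simp: hc_def free_module_iff free_part_iff coef_ffilt)

lemma hc_same: "x \<in> free_part m B s j \<Longrightarrow> hc s j x = x"
  by (rule coef_eqI) (auto simp: hc_def free_part_iff coef_ffilt)

lemma hc_other: "x \<in> free_part m B s j \<Longrightarrow> l \<noteq> j \<Longrightarrow> hc s l x = 0"
  by (rule coef_eqI) (force simp: hc_def free_part_iff coef_ffilt)

text \<open>Any finite superset of the occurring degrees is allowed, so that a prescribed degree can
  be added to the range of summation.\<close>

lemma hc_decompose:
  obtains S where "finite S" and "\<And>S'. S \<subseteq> S' \<Longrightarrow> finite S' \<Longrightarrow> (\<Sum>j\<in>S'. hc s j x) = x"
proof
  let ?S = "(\<lambda>(b, t). int (mon_degree t) + s b) ` (SIGMA b:keys x. keys (lookup x b))"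
  show "finite ?S"
    by (intro finite_imageI finite_SigmaI) auto
  fix S' assume S': "?S \<subseteq> S'" "finite S'"
  show "(\<Sum>j\<in>S'. hc s j x) = x"
  proof (rule coef_eqI)
    fix b t
    have "coef (\<Sum>j\<in>S'. hc s j x) b t = (\<Sum>j\<in>S'. if int (mon_degree t) + s b = j then coef x b t else 0)"
      unfolding coef_sum hc_def coef_ffilt by (intro sum.cong) (auto simp: algebra_simps)
    also have "\<dots> = coef x b t"
    proof (cases "coef x b t = 0")
      case False
      then have "b \<in> keys x" "t \<in> keys (lookup x b)"
        by (auto simp: coef_def in_keys_iff)
      then have "int (mon_degree t) + s b \<in> S'"
        using S'(1) by force
      then show ?thesis
        using S'(2) by simp
    qed (simp add: sum.neutral)
    finally show "coef (\<Sum>j\<in>S'. hc s j x) b t = coef x b t" .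
  qed
qed

locale graded_map =
  fixes m :: nat and B :: "nat set" and s :: "nat \<Rightarrow> int" and B' :: "nat set" and s' :: "nat \<Rightarrow> int"
    and d :: "(nat \<Rightarrow>\<^sub>0 'k::field mpoly) \<Rightarrow> (nat \<Rightarrow>\<^sub>0 'k mpoly)"
  assumes d_add: "x \<in> free_module m B \<Longrightarrow> y \<in> free_module m B \<Longrightarrow> d (x + y) = d x + d y"
    and d_smult: "p \<in> polys m \<Longrightarrow> x \<in> free_module m B \<Longrightarrow> d (smult p x) = smult p (d x)"
    and d_part: "d ` free_part m B s j \<subseteq> free_part m B' s' j"
begin

lemma d_zero: "d 0 = 0"
proof -
  have "d 0 + 0 = d 0 + d 0"
    using d_add[of 0 0] by (simp only: free_module_zero add_0_right)
  then show ?thesis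
    by (simp only: add_left_cancel)
qed

lemma d_sum: "(\<And>v. v \<in> S \<Longrightarrow> f v \<in> free_module m B) \<Longrightarrow> d (\<Sum>v\<in>S. f v) = (\<Sum>v\<in>S. d (f v))"
proof (induction S rule: infinite_finite_induct)
  case (insert v S)
  then show ?case
    using d_add[of "f v" "\<Sum>v\<in>S. f v"] free_module_sum[of S f m B] by auto
qed (auto simp: d_zero)

lemma d_diff: "x \<in> free_module m B \<Longrightarrow> y \<in> free_module m B \<Longrightarrow> x - y \<in> free_module m B \<Longrightarrow> d (x - y) = d x - d y"
  using d_add[of "x - y" y] by (simp add: algebra_simps)

text \<open>Apply \<open>d\<close> to the sum of the homogeneous components: those of degree other
  than \<open>j\<close> do not reach degree \<open>j\<close>. Exactness of a resolution is stated
  for whole modules, and this turns it into exactness in each degree.\<close>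

lemma d_hc:
  assumes "x \<in> free_module m B"
  shows "d (hc s j x) = hc s' j (d x)"
proof -
  obtain S where S: "finite S" "\<And>S'. S \<subseteq> S' \<Longrightarrow> finite S' \<Longrightarrow> (\<Sum>j\<in>S'. hc s j x) = x"
    using hc_decompose by blast
  let ?S = "insert j S"
  have mem: "d (hc s l x) \<in> free_part m B' s' l" for l
    using d_part hc_free_part[OF assms] by blast
  have "d x = d (\<Sum>l\<in>?S. hc s l x)"
    using S by (metis finite_insert subset_insertI)
  also have "\<dots> = (\<Sum>l\<in>?S. d (hc s l x))"
    using hc_free_part[OF assms] free_part_subset by (intro d_sum) blast
  finally have "hc s' j (d x) = (\<Sum>l\<in>?S. hc s' j (d (hc s l x)))"
    by (simp only: hc_def ffilt_sum)
  also have "\<dots> = (\<Sum>l\<in>?S. if l = j then d (hc s l x) else 0)"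
    by (intro sum.cong refl) (auto simp: hc_same[OF mem] hc_other[OF mem])
  also have "\<dots> = d (hc s j x)"
    using S(1) by (simp add: sum.delta)
  finally show ?thesis ..
qed

end

text \<open>The index set of the variables is arbitrary, so that it can be made disjoint from other ones.\<close>

locale free_koszul =
  fixes m :: nat and B :: "nat set" and s :: "nat \<Rightarrow> int" and I :: "'i::linorder set" and \<rho> :: "'i \<Rightarrow> nat"
  assumes bij: "bij_betw \<rho> I {..<m}"
begin

text \<open>The quotient of the free module by the variables in \<open>J\<close>, realised as the
  span of the monomials free of them. Reduction modulo one more variable then becomes a filter on
  terms.\<close>

definition part :: "nat set \<Rightarrow> int \<Rightarrow> (nat \<Rightarrow>\<^sub>0 'k::field mpoly) set"
  where "part J j = {x \<in> free_part m B s j. \<forall>b t. coef x b t \<noteq> 0 \<longrightarrow> keys t \<inter> J = {}}"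

lemma rho_less: "v \<in> I \<Longrightarrow> \<rho> v < m"
  using bij by (auto simp: bij_betw_def)

lemma finite_I: "finite I"
  using bij bij_betw_finite by blast

lemma part_ops:
  assumes "K \<subseteq> I" and "\<rho> ` K \<inter> J = {}"
  shows "graded_ops K (\<lambda>v. smult (Var (\<rho> v))) (part J :: int \<Rightarrow> (nat \<Rightarrow>\<^sub>0 'k::field mpoly) set)"
proof
  show "finite K"
    using assms finite_I finite_subset by blast
  show "x - y \<in> part J j" if "x \<in> part J j" "y \<in> part J j" for x y :: "nat \<Rightarrow>\<^sub>0 'k mpoly" and j
  proof -
    have "x - y \<in> free_part m B s j"
      using that by (auto simp: part_def intro: free_part_diff)
    moreover have "keys t \<inter> J = {}" if "coef (x - y) b t \<noteq> 0" for b t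
    proof -
      have "coef x b t \<noteq> 0 \<or> coef y b t \<noteq> 0"
        using that by (auto simp: coef_diff)
      then show ?thesis
        using \<open>x \<in> part J j\<close> \<open>y \<in> part J j\<close> unfolding part_def mem_Collect_eq by blast
    qed
    ultimately show ?thesis
      by (simp add: part_def)
  qed
  show "smult (Var (\<rho> v)) x \<in> part J (j + 1)" if "v \<in> K" "x \<in> part J j"
    for v x j
  proof -
    have "smult (Var (\<rho> v)) x \<in> free_part m B s (j + 1)"
      using that assms rho_less by (auto simp: part_def intro!: free_part_Var)
    moreover have "keys t \<inter> J = {}" if c: "coef (smult (Var (\<rho> v)) x) b t \<noteq> 0" for b t
    proof -
      have t: "\<rho> v \<in> keys t" "coef x b (t - Poly_Mapping.single (\<rho> v) 1) \<noteq> 0"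
        using c by (auto simp: coef_Var split: if_splits)
      have "keys (t - Poly_Mapping.single (\<rho> v) 1) \<inter> J = {}"
        using t(2) \<open>x \<in> part J j\<close> by (auto simp: part_def)
      moreover have "\<rho> v \<notin> J"
        using assms(2) \<open>v \<in> K\<close> by auto
      ultimately show ?thesis
        using arg_cong[OF add_single_minus[OF t(1)], of keys] unfolding keys_add_nat by auto
    qed
    ultimately show ?thesis
      by (simp add: part_def)
  qed
qed (auto simp: smult_add smult_smult part_def mult.commute)

lemma part_regular:
  assumes "K \<subseteq> I" and "w \<in> I" and "w \<notin> K" and "\<rho> ` insert w K \<inter> J = {}"
  shows "regular_op w K (\<lambda>v. smult (Var (\<rho> v))) (part J :: int \<Rightarrow> (nat \<Rightarrow>\<^sub>0 'k::field mpoly) set)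
    (\<lambda>v. smult (Var (\<rho> v))) (part (insert (\<rho> w) J)) (ffilt (\<lambda>b t. \<rho> w \<notin> keys t))"
proof -
  have neq: "\<rho> v \<noteq> \<rho> w" if "v \<in> K" for v
    using that assms bij by (auto simp: bij_betw_def inj_on_def)
  have K: "graded_ops (insert w K) (\<lambda>v. smult (Var (\<rho> v))) (part J :: int \<Rightarrow> (nat \<Rightarrow>\<^sub>0 'k mpoly) set)"
    using assms by (intro part_ops) auto
  have K': "graded_ops K (\<lambda>v. smult (Var (\<rho> v)))
      (part (insert (\<rho> w) J) :: int \<Rightarrow> (nat \<Rightarrow>\<^sub>0 'k mpoly) set)"
    using assms neq by (intro part_ops) force+
  show ?thesis
    unfolding regular_op_def
  proof (intro conjI)
    show "graded_ops_insert w K (\<lambda>v. smult (Var (\<rho> v))) (part J :: int \<Rightarrow> (nat \<Rightarrow>\<^sub>0 'k mpoly) set)"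
      using K assms(3) by (intro graded_ops_insert.intro graded_ops_insert_axioms.intro)
    show "graded_ops K (\<lambda>v. smult (Var (\<rho> v)))
      (part (insert (\<rho> w) J) :: int \<Rightarrow> (nat \<Rightarrow>\<^sub>0 'k mpoly) set)"
      by (rule K')
    show "regular_op_axioms w K (\<lambda>v. smult (Var (\<rho> v))) (part J :: int \<Rightarrow> (nat \<Rightarrow>\<^sub>0 'k mpoly) set)
      (\<lambda>v. smult (Var (\<rho> v))) (part (insert (\<rho> w) J)) (ffilt (\<lambda>b t. \<rho> w \<notin> keys t))"
    proof
      fix x y :: "nat \<Rightarrow>\<^sub>0 'k mpoly" and j :: int
      show "ffilt (\<lambda>b t. \<rho> w \<notin> keys t) (x + y) =
          ffilt (\<lambda>b t. \<rho> w \<notin> keys t) x + ffilt (\<lambda>b t. \<rho> w \<notin> keys t) y"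
        by (rule ffilt_add)
      show "ffilt (\<lambda>b t. \<rho> w \<notin> keys t) (smult (Var (\<rho> v)) x) =
          smult (Var (\<rho> v)) (ffilt (\<lambda>b t. \<rho> w \<notin> keys t) x)" if "v \<in> K" for v
        by (rule coef_eqI) (use neq[OF that] in \<open>auto simp: coef_ffilt coef_Var in_keys_iff lookup_minus lookup_single when_def\<close>)
      show "ffilt (\<lambda>b t. \<rho> w \<notin> keys t) (smult (Var (\<rho> w)) x) = 0"
        by (rule coef_eqI) (auto simp: coef_ffilt coef_Var)
      have "ffilt (\<lambda>b t. \<rho> w \<notin> keys t) z \<in> part (insert (\<rho> w) J) j" if "z \<in> part J j"
        for z :: "nat \<Rightarrow>\<^sub>0 'k mpoly"
        using that free_part_ffilt by (fastforce simp: part_def coef_ffilt split: if_splits)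
      moreover have "z \<in> part J j \<and> ffilt (\<lambda>b t. \<rho> w \<notin> keys t) z = z" if "z \<in> part (insert (\<rho> w) J) j"
        for z :: "nat \<Rightarrow>\<^sub>0 'k mpoly"
      proof
        show "z \<in> part J j"
          using that by (fastforce simp: part_def)
        show "ffilt (\<lambda>b t. \<rho> w \<notin> keys t) z = z"
          by (rule coef_eqI) (use that in \<open>auto simp: part_def coef_ffilt\<close>)
      qed
      ultimately show "ffilt (\<lambda>b t. \<rho> w \<notin> keys t) ` part J j =
          (part (insert (\<rho> w) J) j :: (nat \<Rightarrow>\<^sub>0 'k mpoly) set)"
        by (force simp: image_iff)
      show "\<exists>y\<in>part J (j - 1). x = smult (Var (\<rho> w)) y"
        if x: "x \<in> part J j" and "ffilt (\<lambda>b t. \<rho> w \<notin> keys t) x = 0"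
      proof
        have "\<rho> w \<in> keys t" if "coef x b t \<noteq> 0" for b t
        proof (rule ccontr)
          assume "\<rho> w \<notin> keys t"
          then have "coef x b t = coef (ffilt (\<lambda>b t. \<rho> w \<notin> keys t) x) b t"
            by (simp add: coef_ffilt)
          then show False
            using that \<open>ffilt (\<lambda>b t. \<rho> w \<notin> keys t) x = 0\<close> by simp
        qed
        then show "x = smult (Var (\<rho> w)) (fdiv (\<rho> w) x)"
          by (intro smult_Var_fdiv[symmetric])
        show "fdiv (\<rho> w) x \<in> part J (j - 1)"
          using x free_part_fdiv by (fastforce simp: part_def coef_fdiv keys_add_nat)
      qed
      show "x = 0" if "smult (Var (\<rho> w)) x = 0"
      proof (rule coef_eqI)
        show "coef x b t = coef 0 b t" for b t
          using coef_Var_add[of "\<rho> w" x b t] that by simp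
      qed
    qed
  qed
qed

text \<open>The variables form a regular sequence on a free module. They are divided out one by one
  until no generator is left, and then there is no set of cardinality k \<ge> 1.\<close>

lemma kexact_part:
  assumes "K \<subseteq> I" and "\<rho> ` K \<inter> J = {}" and "k \<ge> 1"
  shows "kexact K (\<lambda>v. smult (Var (\<rho> v))) (part J :: int \<Rightarrow> (nat \<Rightarrow>\<^sub>0 'k::field mpoly) set) k j"
proof -
  have "finite K"
    using assms(1) finite_I finite_subset by blast
  then show ?thesis
    using assms
  proof (induction K arbitrary: J rule: finite_induct)
    case empty
    interpret graded_ops "{}" "\<lambda>v. smult (Var (\<rho> v))" "part J :: int \<Rightarrow> (nat \<Rightarrow>\<^sub>0 'k mpoly) set"
      by (rule part_ops) auto
    show ?case
      unfolding kexact_def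
    proof (intro ballI impI bexI)
      fix f :: "'i set \<Rightarrow> (nat \<Rightarrow>\<^sub>0 'k mpoly)"
      assume "f \<in> chain {} k (part J j)"
      then have "f = (\<lambda>_. 0)"
        using \<open>k \<ge> 1\<close> by (auto simp: chain_def fun_eq_iff)
      then show "kd {} (\<lambda>v. smult (Var (\<rho> v))) (\<lambda>_. 0) = f"
        by simp
    qed (rule chain_zero)
  next
    case (insert w K)
    interpret regular_op w K "\<lambda>v. smult (Var (\<rho> v))" "part J :: int \<Rightarrow> (nat \<Rightarrow>\<^sub>0 'k mpoly) set"
      "\<lambda>v. smult (Var (\<rho> v))" "part (insert (\<rho> w) J)" "ffilt (\<lambda>b t. \<rho> w \<notin> keys t)"
      using insert by (intro part_regular) auto
    have "\<rho> w \<notin> \<rho> ` K"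
      using insert.hyps insert.prems bij by (auto simp: bij_betw_def inj_on_def)
    then show ?case
      using insert by (intro kexact_quotientD insert.IH) auto
  qed
qed

lemma part_empty: "part {} = free_part m B s"
  by (auto simp: part_def fun_eq_iff)

lemma free_part_ops: "graded_ops I (\<lambda>v. smult (Var (\<rho> v))) (free_part m B s)"
  using part_ops[of I "{}"] by (simp add: part_empty)

lemma kexact_free_part: "k \<ge> 1 \<Longrightarrow> kexact I (\<lambda>v. smult (Var (\<rho> v))) (free_part m B s) k j"
  using kexact_part[of I "{}" k j] by (simp add: part_empty)

text \<open>Each term is charged to one variable that divides it: those divisible by the variable of
  \<open>w\<close> to \<open>w\<close>, the others by induction.\<close>

lemma irrelevant_part:
  assumes "K \<subseteq> I" and "x \<in> free_part m B s j"
    and "\<And>b t. coef x b t \<noteq> 0 \<Longrightarrow> keys t \<inter> \<rho> ` K \<noteq> {}"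
  shows "\<exists>y. (\<forall>v\<in>K. y v \<in> free_part m B s (j - 1)) \<and> (\<Sum>v\<in>K. smult (Var (\<rho> v)) (y v)) = x"
proof -
  have "finite K"
    using assms(1) finite_I finite_subset by blast
  then show ?thesis
    using assms
  proof (induction K arbitrary: x rule: finite_induct)
    case empty
    then have "x = 0"
      by (intro coef_eqI) auto
    then show ?case
      by simp
  next
    case (insert w K)
    define x1 where "x1 = ffilt (\<lambda>b t. \<rho> w \<in> keys t) x"
    define x2 where "x2 = ffilt (\<lambda>b t. \<rho> w \<notin> keys t) x"
    have x: "x = x1 + x2"
      by (rule coef_eqI) (auto simp: x1_def x2_def coef_add coef_ffilt)
    have mem: "x1 \<in> free_part m B s j" "x2 \<in> free_part m B s j"
      using insert.prems by (auto simp: x1_def x2_def free_part_ffilt)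
    have "keys t \<inter> \<rho> ` K \<noteq> {}" if "coef x2 b t \<noteq> 0" for b t
      using that insert.prems(3)[of b t] by (auto simp: x2_def coef_ffilt split: if_splits)
    then obtain y where y: "\<forall>v\<in>K. y v \<in> free_part m B s (j - 1)"
      "(\<Sum>v\<in>K. smult (Var (\<rho> v)) (y v)) = x2"
      using insert.IH[OF _ mem(2)] insert.prems(1) by blast
    have x1: "smult (Var (\<rho> w)) (fdiv (\<rho> w) x1) = x1"
      by (rule smult_Var_fdiv) (auto simp: x1_def coef_ffilt split: if_splits)
    have "(\<Sum>v\<in>K. smult (Var (\<rho> v)) ((y(w := fdiv (\<rho> w) x1)) v)) = x2"
      unfolding y(2)[symmetric] using insert.hyps by (intro sum.cong) auto
    then have "(\<Sum>v\<in>insert w K. smult (Var (\<rho> v)) ((y(w := fdiv (\<rho> w) x1)) v)) = x"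
      using insert.hyps x1 x by simp
    moreover have "\<forall>v\<in>insert w K. (y(w := fdiv (\<rho> w) x1)) v \<in> free_part m B s (j - 1)"
      using y(1) free_part_fdiv[OF mem(1)] by auto
    ultimately show ?case
      by blast
  qed
qed

lemma irrelevant_iff:
  assumes "x \<in> free_part m B s j"
  shows "(\<forall>b. coef x b 0 = 0) \<longleftrightarrow>
    (\<exists>y. (\<forall>v\<in>I. y v \<in> free_part m B s (j - 1)) \<and> (\<Sum>v\<in>I. smult (Var (\<rho> v)) (y v)) = x)"
proof
  assume *: "\<forall>b. coef x b 0 = 0"
  have "keys t \<inter> \<rho> ` I \<noteq> {}" if "coef x b t \<noteq> 0" for b t
  proof -
    have "t \<noteq> 0" using * that by auto
    then have "keys t \<noteq> {}" by simp
    moreover have "keys t \<subseteq> \<rho> ` I"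
      using assms that bij by (auto simp: free_part_iff bij_betw_def)
    ultimately show ?thesis by blast
  qed
  then show "\<exists>y. (\<forall>v\<in>I. y v \<in> free_part m B s (j - 1)) \<and> (\<Sum>v\<in>I. smult (Var (\<rho> v)) (y v)) = x"
    by (intro irrelevant_part[OF subset_refl assms]) auto
next
  assume "\<exists>y. (\<forall>v\<in>I. y v \<in> free_part m B s (j - 1)) \<and> (\<Sum>v\<in>I. smult (Var (\<rho> v)) (y v)) = x"
  then show "\<forall>b. coef x b 0 = 0"
    by (auto simp: coef_sum coef_Var)
qed

end

section \<open>Tor and Koszul homology\<close>

definition const_part :: "(nat \<Rightarrow>\<^sub>0 'k::field mpoly) \<Rightarrow> (nat \<Rightarrow>\<^sub>0 'k)"
  where "const_part x = Poly_Mapping.map (\<lambda>p. lookup p 0) x"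

definition const_incl :: "(nat \<Rightarrow>\<^sub>0 'k::field) \<Rightarrow> (nat \<Rightarrow>\<^sub>0 'k mpoly)"
  where "const_incl v = Poly_Mapping.map Const v"

lemma lookup_const_part: "lookup (const_part x) b = coef x b 0"
  by (simp add: const_part_def coef_def map.rep_eq when_def)

lemma coef_const_incl: "coef (const_incl v) b t = (if t = 0 then lookup v b else 0)"
  by (auto simp: const_incl_def coef_def map.rep_eq when_def Const_def lookup_single)

lemma tensor_diff_eq: "tensor_diff F i v = const_part (diff F i (const_incl v))"
  by (simp add: tensor_diff_def const_part_def const_incl_def)

lemma const_part_incl: "const_part (const_incl v) = v"
  by (rule poly_mapping_eqI) (simp add: lookup_const_part coef_const_incl)

lemma const_part_zero [simp]: "const_part 0 = 0"
  by (rule poly_mapping_eqI) (simp add: lookup_const_part)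

lemma const_part_diff: "const_part (x - y) = const_part x - const_part y"
  by (rule poly_mapping_eqI) (simp add: lookup_const_part coef_diff lookup_minus)

lemma const_part_eq_0_iff: "const_part x = 0 \<longleftrightarrow> (\<forall>b. coef x b 0 = 0)"
  by (simp add: poly_mapping_eq_iff fun_eq_iff lookup_const_part)

lemma const_incl_part: "v \<in> tensor_part F i j \<Longrightarrow> const_incl v \<in> free_part m (basis F i) (shift F i) j"
  by (auto simp: tensor_part_def free_part_iff coef_const_incl in_keys_iff subset_iff split: if_splits)

lemma const_part_part: "x \<in> free_part m (basis F i) (shift F i) j \<Longrightarrow> const_part x \<in> tensor_part F i j"
  by (force simp: tensor_part_def free_part_iff lookup_const_part in_keys_iff)

locale resolution =
  fixes m :: nat and A :: "int \<Rightarrow> 'r::comm_ring_1 set" and \<phi> :: "'k::field mpoly \<Rightarrow> 'r"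
    and F :: "'k free_complex" and I :: "'i::linorder set" and \<rho> :: "'i \<Rightarrow> nat"
  assumes phi_add: "p \<in> polys m \<Longrightarrow> q \<in> polys m \<Longrightarrow> \<phi> (p + q) = \<phi> p + \<phi> q"
    and phi_mult: "p \<in> polys m \<Longrightarrow> q \<in> polys m \<Longrightarrow> \<phi> (p * q) = \<phi> p * \<phi> q"
    and phi_image: "\<phi> ` homog m j = A j"
    and res: "graded_free_resolution A m \<phi> F"
    and rho: "bij_betw \<rho> I {..<m}"
begin

abbreviation M where "M l \<equiv> free_module m (basis F l) :: (nat \<Rightarrow>\<^sub>0 'k mpoly) set"
abbreviation D where "D l j \<equiv> free_part m (basis F l) (shift F l) j :: (nat \<Rightarrow>\<^sub>0 'k mpoly) set"
abbreviation X where "X v x \<equiv> smult (Var (\<rho> v)) x :: nat \<Rightarrow>\<^sub>0 'k mpoly"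
abbreviation Y where "Y v x \<equiv> \<phi> (Var (\<rho> v)) * x"

lemma rho_less: "v \<in> I \<Longrightarrow> \<rho> v < m"
  using rho by (auto simp: bij_betw_def)

lemma D_subset: "x \<in> D l j \<Longrightarrow> x \<in> M l"
  using free_part_subset by blast

sublocale fk: free_koszul m "basis F l" "shift F l" I \<rho> for l
  using rho by unfold_locales

lemmas res' = res[unfolded graded_free_resolution_def Let_def]

lemma diff_graded: "graded_map m (basis F (Suc i)) (shift F (Suc i)) (basis F i) (shift F i) (diff F i)"
proof
  show "diff F i (x + y) = diff F i x + diff F i y" if "x \<in> M (Suc i)" "y \<in> M (Suc i)" for x y
    using res'[THEN conjunct1] that by blast
  show "diff F i (smult p x) = smult p (diff F i x)" if "p \<in> polys m" "x \<in> M (Suc i)" for p x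
    using res'[THEN conjunct2, THEN conjunct1] that by blast
  show "diff F i ` D (Suc i) j \<subseteq> D i j" for j
    using res'[THEN conjunct2, THEN conjunct2, THEN conjunct1] by blast
qed

lemma exact: "{x \<in> M (Suc i). diff F i x = 0} = diff F (Suc i) ` M (Suc (Suc i))"
  using res'[THEN conjunct2, THEN conjunct2, THEN conjunct2, THEN conjunct1] by blast

lemma ex_augmentation: "\<exists>\<epsilon>. (\<forall>x\<in>M 0. \<forall>y\<in>M 0. \<epsilon> (x + y) = \<epsilon> x + \<epsilon> y) \<and>
    (\<forall>p\<in>polys m. \<forall>x\<in>M 0. \<epsilon> (smult p x) = \<phi> p * \<epsilon> x) \<and>
    (\<forall>j. \<epsilon> ` D 0 j = A j) \<and> {x \<in> M 0. \<epsilon> x = 0} = diff F 0 ` M 1"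
  by (rule res'[THEN conjunct2, THEN conjunct2, THEN conjunct2, THEN conjunct2])

definition aug :: "(nat \<Rightarrow>\<^sub>0 'k mpoly) \<Rightarrow> 'r"
  where "aug = (SOME \<epsilon>. (\<forall>x\<in>M 0. \<forall>y\<in>M 0. \<epsilon> (x + y) = \<epsilon> x + \<epsilon> y) \<and>
    (\<forall>p\<in>polys m. \<forall>x\<in>M 0. \<epsilon> (smult p x) = \<phi> p * \<epsilon> x) \<and>
    (\<forall>j. \<epsilon> ` D 0 j = A j) \<and> {x \<in> M 0. \<epsilon> x = 0} = diff F 0 ` M 1)"

lemma aug_props: "(\<forall>x\<in>M 0. \<forall>y\<in>M 0. aug (x + y) = aug x + aug y) \<and>
    (\<forall>p\<in>polys m. \<forall>x\<in>M 0. aug (smult p x) = \<phi> p * aug x) \<and>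
    (\<forall>j. aug ` D 0 j = A j) \<and> {x \<in> M 0. aug x = 0} = diff F 0 ` M 1"
  unfolding aug_def by (rule someI_ex[OF ex_augmentation])

lemma aug_add: "x \<in> M 0 \<Longrightarrow> y \<in> M 0 \<Longrightarrow> aug (x + y) = aug x + aug y"
  and aug_smult: "p \<in> polys m \<Longrightarrow> x \<in> M 0 \<Longrightarrow> aug (smult p x) = \<phi> p * aug x"
  and aug_image: "aug ` D 0 j = A j"
  and aug_kernel: "{x \<in> M 0. aug x = 0} = diff F 0 ` M (Suc 0)"
  using aug_props by auto

text \<open>\<open>syz l\<close> lies in the free module at position \<open>l\<close>, so A is D_0
  modulo \<open>syz 0\<close>, and \<open>syz l\<close> is D_{l+1} modulo
  \<open>syz (Suc l)\<close>. It is the syzygy module of index l + 1.\<close>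

definition syz :: "nat \<Rightarrow> int \<Rightarrow> (nat \<Rightarrow>\<^sub>0 'k mpoly) set"
  where "syz l j = {x \<in> D l j. case l of 0 \<Rightarrow> aug x = 0 | Suc i \<Rightarrow> diff F i x = 0}"

text \<open>A preimage provided by exactness need not be homogeneous, but its component of degree
  \<open>j\<close> is a preimage too.\<close>

lemma syz_image: "diff F l ` D (Suc l) j = syz l j"
proof -
  interpret graded_map m "basis F (Suc l)" "shift F (Suc l)" "basis F l" "shift F l" "diff F l"
    by (rule diff_graded)
  have ker: "diff F l ` M (Suc l) = {x \<in> M l. case l of 0 \<Rightarrow> aug x = 0 | Suc i \<Rightarrow> diff F i x = 0}"
  proof (cases l)
    case 0
    then show ?thesis
      using aug_kernel by simp
  next
    case (Suc i)
    then show ?thesis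
      using exact[of i] by simp
  qed
  show ?thesis
  proof (intro equalityI subsetI)
    fix z assume "z \<in> diff F l ` D (Suc l) j"
    then obtain x where x: "x \<in> D (Suc l) j" "z = diff F l x"
      by blast
    then have "z \<in> diff F l ` M (Suc l)"
      using D_subset by blast
    then show "z \<in> syz l j"
      using x d_part unfolding ker syz_def by blast
  next
    fix z assume z: "z \<in> syz l j"
    then have "z \<in> diff F l ` M (Suc l)"
      unfolding ker syz_def using D_subset by blast
    then obtain x where x: "x \<in> M (Suc l)" "z = diff F l x"
      by blast
    have "diff F l (hc (shift F (Suc l)) j x) = z"
      unfolding d_hc[OF x(1)] x(2)[symmetric] using z by (intro hc_same[of _ m "basis F l"]) (simp add: syz_def)
    then show "z \<in> diff F l ` D (Suc l) j"
      using hc_free_part[OF x(1)] by blast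
  qed
qed

lemma A_ops: "graded_ops I Y A"
proof
  show "finite I"
    using rho bij_betw_finite by blast
  show "0 \<in> A j" for j
  proof -
    have "\<phi> 0 + 0 = \<phi> 0 + \<phi> 0"
      using phi_add[of 0 0] by (simp add: polys_iff)
    then have "\<phi> 0 = 0"
      by (simp only: add_left_cancel)
    then show ?thesis
      using phi_image[of j] homog_zero by force
  qed
  show "x - y \<in> A j" if xy: "x \<in> A j" "y \<in> A j" for x y j
  proof -
    obtain p q where pq: "p \<in> homog m j" "q \<in> homog m j" "x = \<phi> p" "y = \<phi> q"
      using xy unfolding phi_image[symmetric] by blast
    then have "\<phi> (p - q + q) = \<phi> (p - q) + \<phi> q"
      using homog_diff homog_subset_polys by (intro phi_add) blast+
    then have "x - y = \<phi> (p - q)"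
      using pq by simp
    then show ?thesis
      using pq homog_diff phi_image by blast
  qed
  show "Y v x \<in> A (j + 1)" if v: "v \<in> I" and "x \<in> A j" for v x j
  proof -
    obtain p where p: "p \<in> homog m j" "x = \<phi> p"
      using \<open>x \<in> A j\<close> unfolding phi_image[symmetric] by blast
    have "Y v x = \<phi> (Var (\<rho> v) * p)"
      using phi_mult[OF Var_polys[OF rho_less[OF v]], of p] p homog_subset_polys by force
    moreover have "Var (\<rho> v) * p \<in> homog m (1 + j)"
      using p v rho_less Var_homog homog_mult by blast
    ultimately show ?thesis
      using phi_image[of "j + 1"] by (auto simp: add.commute)
  qed
qed (auto simp: algebra_simps)

lemma aug_ses: "koszul_ses I X (D 0) Y A aug"
  unfolding koszul_ses_def koszul_ses_axioms_def
  using fk.free_part_ops[of 0] A_ops aug_add[OF D_subset D_subset] aug_image fk.kexact_free_part[of _ 0]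
    aug_smult[OF Var_polys[OF rho_less] D_subset]
  by blast

lemma syz_0: "koszul_ses.Z (D 0) aug = syz 0"
  using koszul_ses.Z_def[OF aug_ses] by (simp add: fun_eq_iff syz_def)

lemma diff_ses: "koszul_ses I X (D (Suc l)) X (syz l) (diff F l)"
  and syz_Suc: "koszul_ses.Z (D (Suc l)) (diff F l) = syz (Suc l)"
proof -
  have *: "graded_ops I X (syz l) \<Longrightarrow> koszul_ses I X (D (Suc l)) X (syz l) (diff F l)" for l
  proof -
    interpret graded_map m "basis F (Suc l)" "shift F (Suc l)" "basis F l" "shift F l" "diff F l"
      by (rule diff_graded)
    assume "graded_ops I X (syz l)"
    then show ?thesis
      unfolding koszul_ses_def koszul_ses_axioms_def
      using fk.free_part_ops[of "Suc l"] d_add[OF D_subset D_subset] syz_image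
        fk.kexact_free_part[of _ "Suc l"] d_smult[OF Var_polys[OF rho_less] D_subset]
      by blast
  qed
  have Z: "koszul_ses I X (D (Suc l)) X (syz l) (diff F l) \<Longrightarrow>
      koszul_ses.Z (D (Suc l)) (diff F l) = syz (Suc l)" for l
    by (rule ext) (simp add: koszul_ses.Z_def syz_def)
  have ops: "graded_ops I X (syz l)" for l
  proof (induction l)
    case 0
    interpret koszul_ses I X "D 0" Y A aug
      by (rule aug_ses)
    show ?case
      using ker.graded_ops_axioms by (simp add: syz_0)
  next
    case (Suc l)
    interpret koszul_ses I X "D (Suc l)" X "syz l" "diff F l"
      by (rule *[OF Suc.IH])
    show ?case
      using ker.graded_ops_axioms Z[OF *[OF Suc.IH]] by simp
  qed
  show "koszul_ses I X (D (Suc l)) X (syz l) (diff F l)"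
    by (rule *[OF ops])
  then show "koszul_ses.Z (D (Suc l)) (diff F l) = syz (Suc l)"
    by (rule Z)
qed

text \<open>The sequences at the positions 0, ..., l each turn one exterior degree into one internal
  degree.\<close>

lemma kexact_syz: "k - int l \<ge> 2 \<Longrightarrow> kexact I Y A k j \<longleftrightarrow> kexact I X (syz l) (k - int l - 1) (j + int l + 1)"
proof (induction l)
  case 0
  interpret koszul_ses I X "D 0" Y A aug
    by (rule aug_ses)
  show ?case
    using kexact_shift[of k j] 0 by (simp add: syz_0)
next
  case (Suc l)
  interpret koszul_ses I X "D (Suc l)" X "syz l" "diff F l"
    by (rule diff_ses)
  have "kexact I Y A k j \<longleftrightarrow> kexact I X (syz l) (k - int l - 1) (j + int l + 1)"
    using Suc by simp
  also have "\<dots> \<longleftrightarrow> kexact I X (syz (Suc l)) (k - int l - 1 - 1) (j + int l + 1 + 1)"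
    using kexact_shift[of "k - int l - 1" "j + int l + 1"] Suc.prems by (simp add: syz_Suc)
  finally show ?case
    by (simp add: algebra_simps)
qed

text \<open>In degree \<open>j\<close> this is mD \<inter> Z = mZ, where D is the free module at
  position \<open>l\<close>, Z is \<open>syz l\<close> and m is generated by the variables. It
  expresses the vanishing of Tor at position l + 1, also for resolutions that are not
  minimal.\<close>

definition minimal_at :: "nat \<Rightarrow> int \<Rightarrow> bool"
  where "minimal_at l j \<longleftrightarrow>
    (\<forall>y. (\<forall>v\<in>I. y v \<in> D l (j - 1)) \<and> (\<Sum>v\<in>I. X v (y v)) \<in> syz l j \<longrightarrow>
      (\<exists>y'. (\<forall>v\<in>I. y' v \<in> syz l (j - 1)) \<and> (\<Sum>v\<in>I. X v (y' v)) = (\<Sum>v\<in>I. X v (y v))))"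

lemma sum_X_mem: "(\<And>v. v \<in> I \<Longrightarrow> y v \<in> D l (j - 1)) \<Longrightarrow> (\<Sum>v\<in>I. X v (y v)) \<in> D l j"
proof -
  interpret graded_ops I "\<lambda>v. X v" "D l"
    by (rule fk.free_part_ops)
  assume "\<And>v. v \<in> I \<Longrightarrow> y v \<in> D l (j - 1)"
  then show ?thesis
    using op_mem[of _ "y _" "j - 1"] by (intro sum_mem) auto
qed

lemma kexact_iff_minimal: "kexact I Y A (int (Suc l)) (j - int (Suc l)) \<longleftrightarrow> minimal_at l j"
proof (cases l)
  case 0
  interpret koszul_ses I X "D 0" Y A aug
    by (rule aug_ses)
  have "minimal_at 0 j \<longleftrightarrow> kexact I Y A 1 (j - 1)"
    unfolding kexact_1_iff syz_0 minimal_at_def using sum_X_mem[where l = 0 and j = j]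
    by (simp add: syz_def) blast
  then show ?thesis
    using 0 by simp
next
  case (Suc i)
  interpret koszul_ses I X "D (Suc i)" X "syz i" "diff F i"
    by (rule diff_ses)
  have "kexact I Y A (int (Suc l)) (j - int (Suc l)) \<longleftrightarrow>
      kexact I X (syz i) (int (Suc l) - int i - 1) (j - int (Suc l) + int i + 1)"
    using Suc by (intro kexact_syz) simp
  also have "\<dots> \<longleftrightarrow> kexact I X (syz i) 1 (j - 1)"
    using Suc by simp
  also have "\<dots> \<longleftrightarrow> minimal_at (Suc i) j"
    unfolding kexact_1_iff syz_Suc minimal_at_def using sum_X_mem[where l = "Suc i" and j = j]
    by (simp add: syz_def) blast
  finally show ?thesis
    using Suc by simp
qed

lemma irrelevant_iff: "x \<in> D l j \<Longrightarrow> const_part x = 0 \<longleftrightarrow>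
    (\<exists>y. (\<forall>v\<in>I. y v \<in> D l (j - 1)) \<and> (\<Sum>v\<in>I. X v (y v)) = x)"
  unfolding const_part_eq_0_iff by (rule fk.irrelevant_iff)

lemma diff_sum_X:
  assumes "\<And>v. v \<in> I \<Longrightarrow> y v \<in> D (Suc l) j"
  shows "diff F l (\<Sum>v\<in>I. X v (y v)) = (\<Sum>v\<in>I. X v (diff F l (y v)))"
proof -
  interpret graded_map m "basis F (Suc l)" "shift F (Suc l)" "basis F l" "shift F l" "diff F l"
    by (rule diff_graded)
  have "diff F l (\<Sum>v\<in>I. X v (y v)) = (\<Sum>v\<in>I. diff F l (X v (y v)))"
    using assms D_subset rho_less Var_polys by (intro d_sum free_module_smult) blast+
  also have "\<dots> = (\<Sum>v\<in>I. X v (diff F l (y v)))"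
    using assms D_subset rho_less Var_polys by (intro sum.cong refl d_smult) blast+
  finally show ?thesis .
qed

text \<open>By linearity the differential maps mD into mD, so the constant part of the result
  depends only on that of \<open>g\<close>. This links \<open>tensor_diff\<close>, defined on
  constant vectors, to arbitrary representatives.\<close>

lemma const_part_diff_map:
  assumes "g \<in> D (Suc l) j"
  shows "const_part (diff F l g) = tensor_diff F l (const_part g)"
proof -
  interpret graded_map m "basis F (Suc l)" "shift F (Suc l)" "basis F l" "shift F l" "diff F l"
    by (rule diff_graded)
  let ?c = "const_incl (const_part g)"
  have c: "?c \<in> D (Suc l) j"
    by (rule const_incl_part[OF const_part_part[OF assms]])
  have gc: "g - ?c \<in> D (Suc l) j"
    using assms c by (rule free_part_diff)
  moreover have "const_part (g - ?c) = 0"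
    by (simp add: const_part_diff const_part_incl)
  ultimately obtain y where y: "\<forall>v\<in>I. y v \<in> D (Suc l) (j - 1)" "(\<Sum>v\<in>I. X v (y v)) = g - ?c"
    using irrelevant_iff by blast
  have 1: "diff F l (g - ?c) = (\<Sum>v\<in>I. X v (diff F l (y v)))"
    unfolding y(2)[symmetric] using y(1) by (intro diff_sum_X) blast
  have 2: "\<forall>v\<in>I. diff F l (y v) \<in> D l (j - 1)"
    using y(1) d_part by blast
  have "diff F l (g - ?c) \<in> D l j"
    using gc d_part by blast
  then have "const_part (diff F l (g - ?c)) = 0"
    unfolding irrelevant_iff[OF \<open>diff F l (g - ?c) \<in> D l j\<close>]
    using 1[symmetric] 2 by (intro exI[of _ "\<lambda>v. diff F l (y v)"] conjI)
  then have "const_part (diff F l g) = const_part (diff F l ?c)"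
    using d_diff[OF D_subset[OF assms] D_subset[OF c] D_subset[OF gc]] by (simp add: const_part_diff)
  then show ?thesis
    by (simp add: tensor_diff_eq)
qed

lemma boundary_of_syz:
  assumes v: "v \<in> tensor_part F l j" and u: "\<And>i. i \<in> I \<Longrightarrow> u i \<in> D l (j - 1)"
    and "const_incl v - (\<Sum>i\<in>I. X i (u i)) \<in> syz l j"
  shows "v \<in> tensor_boundaries F l j"
proof -
  obtain g where g: "g \<in> D (Suc l) j" "const_incl v - (\<Sum>i\<in>I. X i (u i)) = diff F l g"
    using assms(3) unfolding syz_image[symmetric] by (rule imageE)
  have "const_part (\<Sum>i\<in>I. X i (u i)) = 0"
    using irrelevant_iff[OF sum_X_mem[of u l j]] u by blast
  then have "v = tensor_diff F l (const_part g)"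
    using const_part_diff_map[OF g(1)] unfolding g(2)[symmetric]
    by (simp add: const_part_diff const_part_incl)
  then show ?thesis
    unfolding tensor_boundaries_def using const_part_part[OF g(1)] by blast
qed

text \<open>Forward: a tensor cycle v, viewed as a constant vector x, gives a syzygy dx in mD; hence
  dx = ds with s in mD, and x - s is a syzygy with constant part v. Backward: if z = df lies in mD,
  the constant part of f is a cycle, hence a boundary. Correcting f by a boundary puts it into mD,
  and then z is an m-multiple of syzygies.\<close>

lemma minimal_iff_tensor: "minimal_at l j \<longleftrightarrow> tensor_cycles F (Suc l) j \<subseteq> tensor_boundaries F (Suc l) j"
proof -
  interpret graded_map m "basis F (Suc l)" "shift F (Suc l)" "basis F l" "shift F l" "diff F l"
    by (rule diff_graded)
  show ?thesis
  proof (intro iffI subsetI)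
    fix v assume min: "minimal_at l j" and "v \<in> tensor_cycles F (Suc l) j"
    then have v: "v \<in> tensor_part F (Suc l) j" "tensor_diff F l v = 0"
      by (auto simp: tensor_cycles_def)
    let ?x = "const_incl v"
    have x: "?x \<in> D (Suc l) j"
      by (rule const_incl_part[OF v(1)])
    then have dx: "diff F l ?x \<in> syz l j"
      using syz_image by blast
    then have "diff F l ?x \<in> D l j"
      by (simp add: syz_def)
    moreover have "const_part (diff F l ?x) = 0"
      using v(2) by (simp add: tensor_diff_eq)
    ultimately obtain y where y: "\<forall>i\<in>I. y i \<in> D l (j - 1)" "(\<Sum>i\<in>I. X i (y i)) = diff F l ?x"
      using irrelevant_iff by blast
    then have "(\<forall>i\<in>I. y i \<in> D l (j - 1)) \<and> (\<Sum>i\<in>I. X i (y i)) \<in> syz l j"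
      using dx by simp
    from min[unfolded minimal_at_def, rule_format, OF this]
    obtain y' where y': "\<forall>i\<in>I. y' i \<in> syz l (j - 1)" "(\<Sum>i\<in>I. X i (y' i)) = diff F l ?x"
      unfolding y(2) by blast
    then have "\<forall>i\<in>I. \<exists>u\<in>D (Suc l) (j - 1). y' i = diff F l u"
      unfolding syz_image[symmetric] by blast
    then obtain u where u: "\<forall>i\<in>I. u i \<in> D (Suc l) (j - 1)" "\<forall>i\<in>I. y' i = diff F l (u i)"
      by metis
    let ?s = "\<Sum>i\<in>I. X i (u i)"
    have s: "?s \<in> D (Suc l) j"
      using u(1) by (intro sum_X_mem) blast
    have "diff F l ?s = diff F l ?x"
      using u y'(2) diff_sum_X[of u l "j - 1"] by simp
    then have "diff F l (?x - ?s) = 0"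
      using d_diff[OF D_subset[OF x] D_subset[OF s] D_subset[OF free_part_diff[OF x s]]] by simp
    then have "?x - ?s \<in> syz (Suc l) j"
      using free_part_diff[OF x s] by (simp add: syz_def)
    then show "v \<in> tensor_boundaries F (Suc l) j"
      using u(1) by (intro boundary_of_syz[OF v(1)]) blast+
  next
    assume triv: "tensor_cycles F (Suc l) j \<subseteq> tensor_boundaries F (Suc l) j"
    show "minimal_at l j"
      unfolding minimal_at_def
    proof (intro allI impI, elim conjE)
      fix y assume y: "\<forall>v\<in>I. y v \<in> D l (j - 1)" "(\<Sum>v\<in>I. X v (y v)) \<in> syz l j"
      let ?z = "\<Sum>v\<in>I. X v (y v)"
      obtain f where f: "f \<in> D (Suc l) j" "?z = diff F l f"
        using y(2) unfolding syz_image[symmetric] by (rule imageE)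
      have "const_part ?z = 0"
        using irrelevant_iff[OF sum_X_mem[of y l j]] y(1) by blast
      then have "tensor_diff F l (const_part f) = 0"
        using const_part_diff_map[OF f(1)] f(2) by simp
      then have "const_part f \<in> tensor_cycles F (Suc l) j"
        using const_part_part[OF f(1)] by (simp add: tensor_cycles_def)
      then obtain w where w: "w \<in> tensor_part F (Suc (Suc l)) j" "const_part f = tensor_diff F (Suc l) w"
        using triv unfolding tensor_boundaries_def by blast
      let ?h = "diff F (Suc l) (const_incl w)"
      have h: "?h \<in> syz (Suc l) j"
        using const_incl_part[OF w(1)] syz_image by blast
      then have h': "?h \<in> D (Suc l) j" "diff F l ?h = 0"
        by (auto simp: syz_def)
      have fh: "f - ?h \<in> D (Suc l) j"
        using f(1) h'(1) by (rule free_part_diff)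
      moreover have "const_part (f - ?h) = 0"
        using w(2) by (simp add: const_part_diff tensor_diff_eq)
      ultimately obtain u where u: "\<forall>i\<in>I. u i \<in> D (Suc l) (j - 1)" "(\<Sum>i\<in>I. X i (u i)) = f - ?h"
        using irrelevant_iff by blast
      have "?z = diff F l (f - ?h)"
        using d_diff[OF D_subset[OF f(1)] D_subset[OF h'(1)] D_subset[OF fh]] f(2) h'(2) by simp
      also have "\<dots> = (\<Sum>i\<in>I. X i (diff F l (u i)))"
        unfolding u(2)[symmetric] using u(1) by (intro diff_sum_X) blast
      finally show "\<exists>y'. (\<forall>v\<in>I. y' v \<in> syz l (j - 1)) \<and> (\<Sum>v\<in>I. X v (y' v)) = ?z"
        using u(1) syz_image[of l "j - 1"] by (intro exI[of _ "\<lambda>i. diff F l (u i)"] conjI) auto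
    qed
  qed
qed

text \<open>Exactness in exterior degree 0 means A_j = mA_{j-1}. So the image of a constant vector
  of degree \<open>j\<close> is also reached from mD_0, and the difference is a syzygy.\<close>

lemma tensor_0_trivial:
  assumes "kexact I Y A 0 j"
  shows "tensor_cycles F 0 j \<subseteq> tensor_boundaries F 0 j"
proof
  interpret koszul_ses I X "D 0" Y A aug
    by (rule aug_ses)
  fix v assume "v \<in> tensor_cycles F 0 j"
  then have v: "v \<in> tensor_part F 0 j"
    by (simp add: tensor_cycles_def)
  let ?x = "const_incl v"
  have x: "?x \<in> D 0 j"
    by (rule const_incl_part[OF v])
  define f :: "'i set \<Rightarrow> 'r" where "f T = (if T = {} then aug ?x else 0)" for T
  have "int (card T) = 0 \<longleftrightarrow> T = {}" if "T \<subseteq> I" for T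
    using finite_subset[OF that finite_index] by simp
  then have f: "f \<in> chain I 0 (A j)"
    using x aug_image[of j] by (auto simp: chain_def f_def)
  have "kd I Y f = (\<lambda>_. 0)"
    by (auto simp: kd_def f_def fun_eq_iff)
  then obtain g where g: "g \<in> chain I 1 (A (j - 1))" "kd I Y g = f"
    using assms f unfolding kexact_def by auto
  have "g {i} \<in> A (j - 1)" for i
    using chain_mem[OF g(1) quot.zero_mem] .
  then have "g {i} \<in> aug ` D 0 (j - 1)" for i
    by (simp only: aug_image)
  then have "\<exists>x. x \<in> D 0 (j - 1) \<and> g {i} = aug x" for i
    by (simp add: image_iff Bex_def)
  then obtain u where "\<And>i. u i \<in> D 0 (j - 1) \<and> g {i} = aug (u i)"
    using choice[of "\<lambda>i x. x \<in> D 0 (j - 1) \<and> g {i} = aug x"] by blast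
  then have u: "\<And>i. u i \<in> D 0 (j - 1)" "\<And>i. g {i} = aug (u i)"
    by blast+
  let ?s = "\<Sum>i\<in>I. X i (u i)"
  have s: "?s \<in> D 0 j"
    using u(1) by (intro sum_X_mem)
  have "aug ?s = (\<Sum>i\<in>I. aug (X i (u i)))"
    using u(1) op_mem[of _ "u _" "j - 1"] by (intro e_sum[where j = j]) auto
  also have "\<dots> = (\<Sum>i\<in>I. Y i (g {i}))"
    using u e_op[where j = "j - 1"] by (intro sum.cong) auto
  also have "\<dots> = aug ?x"
    using fun_cong[OF g(2), of "{}"] by (simp add: kd_empty f_def)
  finally have "aug (?x - ?s) = 0"
    using e_diff[OF x s] by simp
  then have "?x - ?s \<in> syz 0 j"
    using free_part_diff[OF x s] by (simp add: syz_def)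
  then show "v \<in> tensor_boundaries F 0 j"
    using u(1) by (intro boundary_of_syz[OF v])
qed

lemma nonzero_class_iff:
  "(\<exists>h\<in>tensor_homology F i j. 0 \<notin> h) \<longleftrightarrow> \<not> tensor_cycles F i j \<subseteq> tensor_boundaries F i j"
proof -
  have "const_incl 0 = (0 :: nat \<Rightarrow>\<^sub>0 'k mpoly)"
    by (rule coef_eqI) (simp add: coef_const_incl)
  then have "tensor_diff F l 0 = 0" for l
    using graded_map.d_zero[OF diff_graded[of l]] by (simp add: tensor_diff_eq)
  then have zero: "0 \<in> tensor_cycles F i j"
    by (auto simp: tensor_cycles_def tensor_part_def split: nat.split)
  let ?R = "{(v, w) \<in> tensor_cycles F i j \<times> tensor_cycles F i j. v - w \<in> tensor_boundaries F i j}"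
  have "0 \<in> ?R `` {v} \<longleftrightarrow> v \<in> tensor_boundaries F i j" if "v \<in> tensor_cycles F i j" for v
    using that zero by auto
  then show ?thesis
    unfolding tensor_homology_def quotient_def by blast
qed

theorem nonzero_class_iff_kexact:
  assumes "i \<ge> 1"
  shows "(\<exists>h\<in>tensor_homology F i j. 0 \<notin> h) \<longleftrightarrow> \<not> kexact I Y A (int i) (j - int i)"
proof -
  obtain l where "i = Suc l"
    using assms by (cases i) auto
  then show ?thesis
    using nonzero_class_iff minimal_iff_tensor kexact_iff_minimal by simp
qed

theorem zero_classes: "kexact I Y A (int i) (j - int i) \<Longrightarrow> h \<in> tensor_homology F i j \<Longrightarrow> 0 \<in> h"
  using nonzero_class_iff_kexact[of i j] nonzero_class_iff[of 0 j] tensor_0_trivial[of j]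
  by (cases "i = 0") auto

end

section \<open>Existence of free resolutions\<close>

lemma free_part_smult:
  assumes "p \<in> homog m d" and "x \<in> free_part m B s e"
  shows "smult p x \<in> free_part m B s (d + e)"
proof -
  have "lookup (smult p x) b \<in> homog m (d + e - s b)" for b
    using homog_mult[OF assms(1), of "lookup x b" "e - s b"] assms(2)
    by (simp add: lookup_smult free_part_def algebra_simps)
  then show ?thesis
    using assms(2) by (auto simp: free_part_def lookup_smult in_keys_iff)
qed

definition graded_submodule ::
    "nat \<Rightarrow> nat set \<Rightarrow> (nat \<Rightarrow> int) \<Rightarrow> (nat \<Rightarrow>\<^sub>0 'k::field mpoly) set \<Rightarrow> bool"
  where "graded_submodule m B s Z \<longleftrightarrow> Z \<subseteq> free_module m B \<and> 0 \<in> Z \<and>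
    (\<forall>x\<in>Z. \<forall>y\<in>Z. x + y \<in> Z) \<and> (\<forall>p\<in>polys m. \<forall>x\<in>Z. smult p x \<in> Z) \<and> (\<forall>j. \<forall>x\<in>Z. hc s j x \<in> Z)"

lemma ex_encoding: "\<exists>\<kappa> :: nat \<times> (nat \<Rightarrow>\<^sub>0 nat) \<Rightarrow> nat. inj \<kappa>"
proof -
  have "Poly_Mapping.nth (map (lookup f) [0..<Poly_Mapping.degree f]) = f" for f :: "nat \<Rightarrow>\<^sub>0 nat"
    by (rule poly_mapping_eqI) (simp add: lookup_nth nth_default_def beyond_degree_lookup_zero)
  then have "surj (Poly_Mapping.nth :: nat list \<Rightarrow> nat \<Rightarrow>\<^sub>0 nat)"
    by (rule surjI)
  then have "countable (UNIV :: (nat \<Rightarrow>\<^sub>0 nat) set)"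
    using countable_image[of "UNIV :: nat list set" Poly_Mapping.nth] by simp
  then have "countable (UNIV \<times> UNIV :: (nat \<times> (nat \<Rightarrow>\<^sub>0 nat)) set)"
    by (intro countable_SIGMA) auto
  then show ?thesis
    unfolding countable_def UNIV_Times_UNIV .
qed

text \<open>Elimination will subtract scalar multiples only, so any injection into the naturals
  gives a usable order of the terms, compatible with multiplication or not.\<close>

definition enc :: "nat \<times> (nat \<Rightarrow>\<^sub>0 nat) \<Rightarrow> nat"
  where "enc = (SOME \<kappa>. inj \<kappa>)"

lemma inj_enc: "inj enc"
  unfolding enc_def by (rule someI_ex[OF ex_encoding])

definition supp :: "(nat \<Rightarrow>\<^sub>0 'k::zero mpoly) \<Rightarrow> (nat \<times> (nat \<Rightarrow>\<^sub>0 nat)) set"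
  where "supp x = {(b, t). coef x b t \<noteq> 0}"

lemma finite_supp: "finite (supp x)"
proof -
  have "supp x \<subseteq> (SIGMA b:keys x. keys (lookup x b))"
    by (auto simp: supp_def coef_def in_keys_iff)
  then show ?thesis
    by (rule finite_subset) (intro finite_SigmaI finite_keys)
qed

lemma supp_eq_empty: "supp x = {} \<longleftrightarrow> x = 0"
proof
  assume "supp x = {}"
  then show "x = 0"
    by (intro coef_eqI) (auto simp: supp_def)
qed (simp add: supp_def)

text \<open>Encoded position of the last term in the enumeration \<open>enc\<close> of the countable \<open>K\<close>-basis.\<close>

definition lead :: "(nat \<Rightarrow>\<^sub>0 'k::zero mpoly) \<Rightarrow> nat"
  where "lead x = Max (enc ` supp x)"

lemma lead_obtain:
  assumes "x \<noteq> 0"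
  obtains b t where "coef x b t \<noteq> 0" and "lead x = enc (b, t)"
proof -
  have "lead x \<in> enc ` supp x"
    unfolding lead_def using assms finite_supp supp_eq_empty by (intro Max_in) auto
  then show ?thesis
    using that by (auto simp: supp_def)
qed

lemma lead_ge: "coef x b t \<noteq> 0 \<Longrightarrow> enc (b, t) \<le> lead x"
  unfolding lead_def by (intro Max_ge finite_imageI finite_supp) (auto simp: supp_def)

text \<open>
  Homogeneous elements of a graded submodule, one for each leading position, generate it by
  elimination of leading terms.
\<close>

definition is_gen ::
    "nat \<Rightarrow> nat set \<Rightarrow> (nat \<Rightarrow> int) \<Rightarrow> (nat \<Rightarrow>\<^sub>0 'k::field mpoly) set \<Rightarrow> nat \<Rightarrow> (nat \<Rightarrow>\<^sub>0 'k mpoly) \<Rightarrow> bool"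
  where "is_gen m B s Z n z \<longleftrightarrow> z \<in> Z \<and> z \<noteq> 0 \<and> lead z = n \<and> (\<exists>j. z \<in> free_part m B s j)"

definition gen where "gen m B s Z n = (SOME z. is_gen m B s Z n z)"
definition gen_basis where "gen_basis m B s Z = {n. \<exists>z. is_gen m B s Z n z}"
definition gen_shift where "gen_shift m B s Z n = (SOME j. gen m B s Z n \<in> free_part m B s j)"
definition gen_diff where "gen_diff m B s Z x = (\<Sum>n\<in>keys x. smult (lookup x n) (gen m B s Z n))"

locale graded_submodule_gens =
  fixes m :: nat and B :: "nat set" and s :: "nat \<Rightarrow> int" and Z :: "(nat \<Rightarrow>\<^sub>0 'k::field mpoly) set"
  assumes sub: "graded_submodule m B s Z"
begin

abbreviation "G \<equiv> gen m B s Z"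
abbreviation "B' \<equiv> gen_basis m B s Z"
abbreviation "s' \<equiv> gen_shift m B s Z"
abbreviation "d \<equiv> gen_diff m B s Z"

lemma Z_subset: "x \<in> Z \<Longrightarrow> x \<in> free_module m B"
  and Z_zero: "0 \<in> Z"
  and Z_add: "x \<in> Z \<Longrightarrow> y \<in> Z \<Longrightarrow> x + y \<in> Z"
  and Z_smult: "p \<in> polys m \<Longrightarrow> x \<in> Z \<Longrightarrow> smult p x \<in> Z"
  and Z_hc: "x \<in> Z \<Longrightarrow> hc s j x \<in> Z"
  using sub unfolding graded_submodule_def by blast+

lemma Z_sum: "(\<And>v. v \<in> S \<Longrightarrow> f v \<in> Z) \<Longrightarrow> (\<Sum>v\<in>S. f v) \<in> Z"
  by (induction S rule: infinite_finite_induct) (auto simp: Z_zero Z_add)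

lemma G_gen: "n \<in> B' \<Longrightarrow> is_gen m B s Z n (G n)"
  unfolding gen_def gen_basis_def mem_Collect_eq by (rule someI_ex)

lemma G_mem: "n \<in> B' \<Longrightarrow> G n \<in> Z"
  and G_nonzero: "n \<in> B' \<Longrightarrow> G n \<noteq> 0"
  and G_lead: "n \<in> B' \<Longrightarrow> lead (G n) = n"
  using G_gen unfolding is_gen_def by blast+

lemma G_part: "n \<in> B' \<Longrightarrow> G n \<in> free_part m B s (s' n)"
proof -
  assume "n \<in> B'"
  then have "\<exists>j. G n \<in> free_part m B s j"
    using G_gen unfolding is_gen_def by blast
  then show ?thesis
    unfolding gen_shift_def by (rule someI_ex)
qed

lemma d_superset:
  assumes "finite S" and "keys x \<subseteq> S"
  shows "d x = (\<Sum>n\<in>S. smult (lookup x n) (G n))"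
  unfolding gen_diff_def
proof (rule sum.mono_neutral_left[OF assms])
  have "smult 0 y = 0" for y :: "nat \<Rightarrow>\<^sub>0 'k mpoly"
    by (rule poly_mapping_eqI) (simp add: lookup_smult)
  then show "\<forall>i\<in>S - keys x. smult (lookup x i) (G i) = 0"
    by (simp add: in_keys_iff)
qed

lemma gen_diff_add: "d (x + y) = d x + d y"
proof -
  have S: "finite (keys x \<union> keys y)" "keys (x + y) \<subseteq> keys x \<union> keys y"
    by (simp_all add: Poly_Mapping.keys_add)
  show ?thesis
    by (simp add: d_superset[OF S] d_superset[OF S(1), of x] d_superset[OF S(1), of y]
        lookup_add smult_add_left sum.distrib)
qed

lemma smult_sum: "smult p (\<Sum>v\<in>S. f v) = (\<Sum>v\<in>S. smult p (f v :: nat \<Rightarrow>\<^sub>0 'k mpoly))"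
  by (induction S rule: infinite_finite_induct) (auto simp: smult_add)

lemma gen_diff_smult: "d (smult p x) = smult p (d x)"
proof -
  have "keys (smult p x) \<subseteq> keys x"
    by (auto simp: in_keys_iff lookup_smult)
  then have "d (smult p x) = (\<Sum>n\<in>keys x. smult (lookup (smult p x) n) (G n))"
    by (intro d_superset) auto
  then show ?thesis
    by (simp add: gen_diff_def smult_sum lookup_smult smult_smult)
qed

lemma d_part: "d ` free_part m B' s' j \<subseteq> free_part m B s j"
proof
  fix z assume "z \<in> d ` free_part m B' s' j"
  then obtain x where x: "x \<in> free_part m B' s' j" "z = d x"
    by blast
  have "smult (lookup x n) (G n) \<in> free_part m B s j" if "n \<in> keys x" for n
  proof -
    have "lookup x n \<in> homog m (j - s' n)" "n \<in> B'"
      using x(1) that by (auto simp: free_part_def)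
    then show ?thesis
      using free_part_smult[OF _ G_part, of "lookup x n" "j - s' n" n] by simp
  qed
  then have "(\<Sum>n\<in>S. smult (lookup x n) (G n)) \<in> free_part m B s j" if "S \<subseteq> keys x" for S
    using that by (induction S rule: infinite_finite_induct) (auto intro: free_part_add)
  then show "z \<in> free_part m B s j"
    unfolding x(2) gen_diff_def by blast
qed

sublocale graded_map m B' s' B s d
  by unfold_locales (simp_all only: gen_diff_add gen_diff_smult d_part)

lemma homogeneous_in_image:
  assumes "z \<in> Z" and "z \<in> free_part m B s j"
  shows "z \<in> d ` free_module m B'"
  using assms
proof (induction "lead z" arbitrary: z rule: less_induct)
  case less
  show ?case
  proof (cases "z = 0")
    case True
    then show ?thesis
      using d_zero free_module_zero by (metis imageI)
  next
    case False
    define n where "n = lead z"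
    have n: "n \<in> B'"
      using False less.prems unfolding gen_basis_def is_gen_def n_def by blast
    obtain b t where bt: "coef z b t \<noteq> 0" "n = enc (b, t)"
      using lead_obtain[OF False] n_def by metis
    obtain b' t' where bt': "coef (G n) b' t' \<noteq> 0" "n = enc (b', t')"
      using lead_obtain[OF G_nonzero[OF n]] G_lead[OF n] by metis
    have eq: "b' = b" "t' = t"
      using bt(2) bt'(2) inj_enc by (auto dest: injD)
    \<comment> \<open>The generator and \<open>z\<close> share the term (b, t), which determines the
      degree of each.\<close>
    have "s' n = j"
    proof -
      have "int (mon_degree t) = j - s b"
        using less.prems(2) bt(1) unfolding free_part_iff by blast
      moreover have "int (mon_degree t) = s' n - s b"
        using G_part[OF n] bt'(1) unfolding free_part_iff eq by blast
      ultimately show ?thesis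
        by simp
    qed
    define c where "c = coef z b t / coef (G n) b t"
    define z' where "z' = z + smult (Const (- c)) (G n)"
    have Const0: "Const a \<in> homog m 0" for a :: 'k
      unfolding Const_def by (rule homog_single) auto
    have coefC: "coef (smult (Const a) x) b t = a * coef x b t" for a :: 'k and x b t
      using lookup_single_mult_add[of 0 a "lookup x b" t] by (simp add: coef_def lookup_smult Const_def)
    have z'Z: "z' \<in> Z"
      unfolding z'_def using less.prems(1) G_mem[OF n] Const_polys by (intro Z_add Z_smult)
    have "smult (Const (- c)) (G n) \<in> free_part m B s j"
      using free_part_smult[OF Const0 G_part[OF n], of "- c"] \<open>s' n = j\<close> by simp
    then have z'j: "z' \<in> free_part m B s j"
      unfolding z'_def using less.prems(2) by (intro free_part_add)
    have "z' \<in> d ` free_module m B'"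
    proof (cases "z' = 0")
      case True
      then show ?thesis
        using d_zero free_module_zero by (metis imageI)
    next
      case nz: False
      obtain b1 t1 where 1: "coef z' b1 t1 \<noteq> 0" "lead z' = enc (b1, t1)"
        using lead_obtain[OF nz] by metis
      have "coef z b1 t1 \<noteq> 0 \<or> coef (G n) b1 t1 \<noteq> 0"
        using 1(1) by (auto simp: z'_def coef_add coefC)
      then have "enc (b1, t1) \<le> n"
        using lead_ge G_lead[OF n] n_def by metis
      moreover have "enc (b1, t1) \<noteq> n"
      proof
        assume "enc (b1, t1) = n"
        then have "b1 = b" "t1 = t"
          using bt(2) inj_enc by (auto dest: injD)
        moreover have "coef (G n) b t \<noteq> 0"
          using bt'(1) eq by simp
        ultimately show False
          using 1(1) by (simp add: z'_def coef_add coefC c_def)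
      qed
      ultimately have "lead z' < lead z"
        using 1(2) n_def by simp
      then show ?thesis
        using less.hyps z'Z z'j by blast
    qed
    then obtain x' where x': "x' \<in> free_module m B'" "z' = d x'"
      by blast
    let ?e = "Poly_Mapping.single n (Const c) :: nat \<Rightarrow>\<^sub>0 'k mpoly"
    have e: "?e \<in> free_module m B'"
      using n Const_polys by (auto simp: free_module_def lookup_single when_def polys_iff)
    have de: "d ?e = smult (Const c) (G n)"
      using d_superset[of "{n}" ?e] by simp
    have "smult (Const c) (G n) + smult (Const (- c)) (G n) = 0"
      by (rule coef_eqI) (simp add: coef_add coefC)
    moreover have "d (x' + ?e) = z + (smult (Const c) (G n) + smult (Const (- c)) (G n))"
    proof -
      have "d (x' + ?e) = z' + smult (Const c) (G n)"
        by (simp only: d_add[OF x'(1) e] de x'(2))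
      then show ?thesis
        unfolding z'_def by (simp only: add.assoc add.commute[of "smult (Const (- c)) (G n)"])
    qed
    ultimately have "z = d (x' + ?e)"
      by simp
    then show ?thesis
      using x'(1) e free_module_add by blast
  qed
qed

lemma d_image: "d ` free_module m B' = Z"
proof (intro equalityI subsetI)
  fix z assume "z \<in> d ` free_module m B'"
  then obtain x where x: "x \<in> free_module m B'" "z = d x"
    by blast
  show "z \<in> Z"
    unfolding x(2) gen_diff_def
  proof (intro Z_sum Z_smult)
    show "lookup x n \<in> polys m" "G n \<in> Z" if "n \<in> keys x" for n
      using x(1) that G_mem by (auto simp: free_module_def)
  qed
next
  fix z assume z: "z \<in> Z"
  have "hc s j z \<in> d ` free_module m B'" for j
    using Z_hc[OF z] hc_free_part[OF Z_subset[OF z]] by (rule homogeneous_in_image)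
  then have "\<forall>j. \<exists>x. x \<in> free_module m B' \<and> hc s j z = d x"
    by (simp add: image_iff Bex_def)
  then obtain x where x: "\<And>j. x j \<in> free_module m B' \<and> hc s j z = d (x j)"
    using choice[of "\<lambda>j x. x \<in> free_module m B' \<and> hc s j z = d x"] by blast
  obtain S where S: "finite S" "\<And>S'. S \<subseteq> S' \<Longrightarrow> finite S' \<Longrightarrow> (\<Sum>j\<in>S'. hc s j z) = z"
    using hc_decompose[of s z] by blast
  have "z = (\<Sum>j\<in>S. d (x j))"
    using S(2)[OF subset_refl S(1)] x by simp
  also have "\<dots> = d (\<Sum>j\<in>S. x j)"
    using x by (intro d_sum[symmetric]) blast
  finally have "z = d (\<Sum>j\<in>S. x j)" .
  then show "z \<in> d ` free_module m B'"
    using x free_module_sum[of S x m B'] by blast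
qed

lemma kernel_submodule: "graded_submodule m B' s' {x \<in> free_module m B'. d x = 0}"
  unfolding graded_submodule_def
proof (intro conjI ballI allI)
  fix j x assume "x \<in> {x \<in> free_module m B'. d x = 0}"
  then have x: "x \<in> free_module m B'" "d x = 0"
    by auto
  have "d (hc s' j x) = 0"
    unfolding d_hc[OF x(1)] x(2) by (simp add: hc_def)
  then show "hc s' j x \<in> {x \<in> free_module m B'. d x = 0}"
    using hc_free_part[OF x(1)] free_part_subset by blast
qed (auto simp: free_module_add gen_diff_add d_zero gen_diff_smult free_module_smult)

end

text \<open>The last component is the module still to be covered: the given kernel at the start,
  afterwards the kernel of the map from the chosen generators. Generators are named by their leading
  positions, so every basis consists of naturals again.\<close>

primrec stage ::
    "nat \<Rightarrow> (nat \<Rightarrow>\<^sub>0 'k::field mpoly) set \<Rightarrow> nat \<Rightarrow> nat set \<times> (nat \<Rightarrow> int) \<times> (nat \<Rightarrow>\<^sub>0 'k mpoly) set"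
  where
    "stage m Z 0 = ({0}, (\<lambda>_. 0), Z)"
  | "stage m Z (Suc i) = (case stage m Z i of (B, s, Z') \<Rightarrow>
      (gen_basis m B s Z', gen_shift m B s Z', {x \<in> free_module m (gen_basis m B s Z'). gen_diff m B s Z' x = 0}))"

text \<open>The last assumption is homogeneity of the kernel of \<open>\<phi>\<close>. It has to be
  supplied because \<open>A\<close> is a mere family of sets, which does not record that the sum of
  its members is direct.\<close>

lemma ex_resolution:
  fixes \<phi> :: "'k::field mpoly \<Rightarrow> 'r::comm_ring_1"
  assumes add: "\<And>p q. p \<in> polys m \<Longrightarrow> q \<in> polys m \<Longrightarrow> \<phi> (p + q) = \<phi> p + \<phi> q"
    and mult: "\<And>p q. p \<in> polys m \<Longrightarrow> q \<in> polys m \<Longrightarrow> \<phi> (p * q) = \<phi> p * \<phi> q"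
    and image: "\<And>j. \<phi> ` homog m j = A j"
    and ker: "\<And>p j. p \<in> polys m \<Longrightarrow> \<phi> p = 0 \<Longrightarrow> \<phi> (pfilt (\<lambda>t. int (mon_degree t) = j) p) = 0"
  shows "\<exists>F. graded_free_resolution A m \<phi> F"
proof -
  \<comment> \<open>The free module on the single basis element 0 is identified with the polynomial
    ring.\<close>
  define \<epsilon> :: "(nat \<Rightarrow>\<^sub>0 'k mpoly) \<Rightarrow> 'r" where "\<epsilon> x = \<phi> (lookup x 0)" for x
  define Z where "Z = {x \<in> free_module m {0}. \<epsilon> x = 0}"
  define B where "B i = fst (stage m Z i)" for i
  define s where "s i = fst (snd (stage m Z i))" for i
  define ZZ where "ZZ i = snd (snd (stage m Z i))" for i
  have stage: "stage m Z i = (B i, s i, ZZ i)" for i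
    by (simp add: B_def s_def ZZ_def)
  have simps: "B 0 = {0}" "s 0 = (\<lambda>_. 0)" "ZZ 0 = Z"
    "B (Suc i) = gen_basis m (B i) (s i) (ZZ i)" "s (Suc i) = gen_shift m (B i) (s i) (ZZ i)"
    "ZZ (Suc i) = {x \<in> free_module m (B (Suc i)). gen_diff m (B i) (s i) (ZZ i) x = 0}" for i
    unfolding B_def[of 0] s_def[of 0] ZZ_def[of 0] B_def[of "Suc i"] s_def[of "Suc i"]
      ZZ_def[of "Suc i"] stage.simps stage[of i] by simp_all
  define F where "F = \<lparr>basis = B, shift = s, diff = (\<lambda>i. gen_diff m (B i) (s i) (ZZ i))\<rparr>"
  have poly: "lookup x 0 \<in> polys m" if "x \<in> free_module m {0}" for x
    using that by (auto simp: free_module_def)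
  have phi0: "\<phi> 0 = 0"
  proof -
    have "\<phi> 0 + 0 = \<phi> 0 + \<phi> 0"
      using add[of 0 0] by (simp add: polys_iff)
    then show ?thesis
      by (simp only: add_left_cancel)
  qed
  have "graded_submodule m {0} (\<lambda>_. 0) Z"
    unfolding graded_submodule_def
  proof (intro conjI ballI allI)
    fix x j assume "x \<in> Z"
    then have x: "x \<in> free_module m {0}" "\<phi> (lookup x 0) = 0"
      by (auto simp: Z_def \<epsilon>_def)
    have "lookup (hc (\<lambda>_. 0) j x) 0 = pfilt (\<lambda>t. int (mon_degree t) = j) (lookup x 0)"
      by (rule poly_mapping_eqI) (simp add: coef_def[symmetric] hc_def coef_ffilt lookup_pfilt)
    then have "\<epsilon> (hc (\<lambda>_. 0) j x) = 0"
      using ker[OF poly[OF x(1)] x(2)] by (simp add: \<epsilon>_def)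
    then show "hc (\<lambda>_. 0) j x \<in> Z"
      using hc_free_part[OF x(1)] free_part_subset unfolding Z_def by blast
  qed (auto simp: Z_def \<epsilon>_def lookup_add lookup_smult add mult poly phi0 free_module_add free_module_smult)
  then have sub: "graded_submodule m (B i) (s i) (ZZ i)" for i
  proof (induction i)
    case (Suc i)
    interpret graded_submodule_gens m "B i" "s i" "ZZ i"
      using Suc by unfold_locales simp
    show ?case
      using kernel_submodule by (simp add: simps)
  qed (simp add: simps)
  have gens: "graded_submodule_gens m (B i) (s i) (ZZ i)" for i
    using sub by unfold_locales
  note image_d = graded_submodule_gens.d_image[OF gens, folded simps]
  have "graded_free_resolution A m \<phi> F"
    unfolding graded_free_resolution_def Let_def F_def free_complex.simps
  proof (intro conjI allI ballI)
    fix i j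
    show "gen_diff m (B i) (s i) (ZZ i) (x + y) =
      gen_diff m (B i) (s i) (ZZ i) x + gen_diff m (B i) (s i) (ZZ i) y" for x y
      by (rule graded_submodule_gens.gen_diff_add[OF gens])
    show "gen_diff m (B i) (s i) (ZZ i) (smult p x) = smult p (gen_diff m (B i) (s i) (ZZ i) x)" for p x
      by (rule graded_submodule_gens.gen_diff_smult[OF gens])
    show "gen_diff m (B i) (s i) (ZZ i) ` free_part m (B (Suc i)) (s (Suc i)) j \<subseteq>
        free_part m (B i) (s i) j"
      using graded_submodule_gens.d_part[OF gens] by (simp add: simps)
    show "{x \<in> free_module m (B (Suc i)). gen_diff m (B i) (s i) (ZZ i) x = 0} =
        gen_diff m (B (Suc i)) (s (Suc i)) (ZZ (Suc i)) ` free_module m (B (Suc (Suc i)))"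
      unfolding image_d by (simp add: simps)
    show "\<exists>\<epsilon>. (\<forall>x\<in>free_module m (B 0). \<forall>y\<in>free_module m (B 0). \<epsilon> (x + y) = \<epsilon> x + \<epsilon> y) \<and>
      (\<forall>p\<in>polys m. \<forall>x\<in>free_module m (B 0). \<epsilon> (smult p x) = \<phi> p * \<epsilon> x) \<and>
      (\<forall>j. \<epsilon> ` free_part m (B 0) (s 0) j = A j) \<and>
      {x \<in> free_module m (B 0). \<epsilon> x = 0} = gen_diff m (B 0) (s 0) (ZZ 0) ` free_module m (B 1)"
    proof (intro exI[of _ \<epsilon>] conjI)
      show "\<forall>x\<in>free_module m (B 0). \<forall>y\<in>free_module m (B 0). \<epsilon> (x + y) = \<epsilon> x + \<epsilon> y"
        by (auto simp: simps \<epsilon>_def lookup_add add poly)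
      show "\<forall>p\<in>polys m. \<forall>x\<in>free_module m (B 0). \<epsilon> (smult p x) = \<phi> p * \<epsilon> x"
        by (auto simp: simps \<epsilon>_def lookup_smult mult poly)
      show "\<forall>j. \<epsilon> ` free_part m (B 0) (s 0) j = A j"
      proof
        fix j
        have "(\<lambda>x. lookup x 0) ` free_part m {0} (\<lambda>_. 0) j = (homog m j :: 'k mpoly set)"
        proof (intro equalityI subsetI)
          fix p :: "'k mpoly" assume "p \<in> homog m j"
          then have "Poly_Mapping.single 0 p \<in> free_part m {0} (\<lambda>_. 0) j"
            by (auto simp: free_part_def lookup_single when_def)
          moreover have "p = lookup (Poly_Mapping.single (0::nat) p) 0"
            by simp
          ultimately show "p \<in> (\<lambda>x. lookup x 0) ` free_part m {0} (\<lambda>_. 0) j"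
            by (rule rev_image_eqI)
        qed (auto simp: free_part_def)
        then have "\<epsilon> ` free_part m {0} (\<lambda>_. 0) j = \<phi> ` homog m j"
          unfolding \<epsilon>_def image_image[symmetric, of \<phi> "\<lambda>x. lookup x 0"] by simp
        then show "\<epsilon> ` free_part m (B 0) (s 0) j = A j"
          by (simp add: simps image)
      qed
      show "{x \<in> free_module m (B 0). \<epsilon> x = 0} = gen_diff m (B 0) (s 0) (ZZ 0) ` free_module m (B 1)"
        using image_d[of 0] by (simp add: simps Z_def)
    qed
  qed
  then show ?thesis
    by blast
qed

section \<open>Change of generators\<close>

lemma kexact_cong:
  assumes "\<And>v x. v \<in> I \<Longrightarrow> a v x = b v x"
  shows "kexact I a X k j \<longleftrightarrow> kexact I b X k j"
proof -
  have "kd I a = kd I b"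
    by (auto simp: kd_def fun_eq_iff assms intro!: sum.cong)
  then show ?thesis
    by (simp add: kexact_def)
qed

text \<open>A generator that depends on the others acts as zero on Koszul homology, by a combination
  of the homotopies in \<open>kd_op_boundary\<close>. The cone sequence breaks into short ones, and
  the new H_k is built from the old H_k and H_{k-1}. This is why all degrees up to \<open>p\<close>
  are treated together.\<close>

lemma kexact_dependent_generators:
  fixes \<alpha> :: "'i::linorder \<Rightarrow> 'r::comm_ring_1"
  assumes "finite J" and "I \<inter> J = {}" and "graded_ops (I \<union> J) (\<lambda>v x. \<alpha> v * x) X"
    and "\<And>w. w \<in> J \<Longrightarrow> \<exists>l. \<alpha> w = (\<Sum>v\<in>I. l v * \<alpha> v) \<and> (\<forall>v\<in>I. \<forall>j. \<forall>x\<in>X j. l v * x \<in> X j)"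
  shows "(\<forall>k\<le>p. \<forall>j\<ge>q. kexact I (\<lambda>v x. \<alpha> v * x) X (int k) j) \<longleftrightarrow>
    (\<forall>k\<le>p. \<forall>j\<ge>q. kexact (I \<union> J) (\<lambda>v x. \<alpha> v * x) X (int k) j)"
  using assms
proof (induction J rule: finite_induct)
  case (insert w J)
  let ?a = "\<lambda>v x. \<alpha> v * x"
  have eq: "I \<union> insert w J = insert w (I \<union> J)"
    by auto
  interpret graded_ops_insert w "I \<union> J" ?a X
    using insert.prems(1,2) insert.hyps unfolding eq
    by (intro graded_ops_insert.intro graded_ops_insert_axioms.intro) auto
  have IH: "(\<forall>k\<le>p. \<forall>j\<ge>q. kexact I ?a X (int k) j) \<longleftrightarrow> (\<forall>k\<le>p. \<forall>j\<ge>q. kexact (I \<union> J) ?a X (int k) j)"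
    using insert.prems sub.graded_ops_axioms by (intro insert.IH) auto
  obtain l where l: "\<alpha> w = (\<Sum>v\<in>I. l v * \<alpha> v)" "\<forall>v\<in>I. \<forall>j. \<forall>x\<in>X j. l v * x \<in> X j"
    using insert.prems(3) by blast
  have null: "\<exists>g\<in>chain (I \<union> J) (k + 1) (X j). kd (I \<union> J) ?a g = (\<lambda>T. \<alpha> w * f T)"
    if f: "f \<in> chain (I \<union> J) k (X j)" "kd (I \<union> J) ?a f = (\<lambda>_. 0)" for f k j
  proof -
    have "\<exists>g. g \<in> chain (I \<union> J) (k + 1) (X j) \<and> kd (I \<union> J) ?a g = (\<lambda>T. \<alpha> v * f T)" if "v \<in> I" for v
      using sub.kd_op_boundary[OF _ f, of v] that by auto
    then have "\<forall>v\<in>I. \<exists>g. g \<in> chain (I \<union> J) (k + 1) (X j) \<and> kd (I \<union> J) ?a g = (\<lambda>T. \<alpha> v * f T)"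
      by blast
    from bchoice[OF this] obtain g where g: "\<forall>v\<in>I. g v \<in> chain (I \<union> J) (k + 1) (X j) \<and>
        kd (I \<union> J) ?a (g v) = (\<lambda>T. \<alpha> v * f T)"
      by blast
    have scale: "kd (I \<union> J) ?a (\<lambda>T. r * h T) = (\<lambda>T. r * kd (I \<union> J) ?a h T)" for r h
    proof -
      have "sg v T (r * x) = r * sg v T x" for v T and x :: 'r
        by (simp add: sg_def)
      then show ?thesis
        by (auto simp: kd_def fun_eq_iff sum_distrib_left mult.left_commute intro!: sum.cong)
    qed
    let ?g = "\<lambda>T. \<Sum>v\<in>I. l v * g v T"
    have "?g \<in> chain (I \<union> J) (k + 1) (X j)"
      unfolding chain_def mem_Collect_eq
    proof (intro allI)
      fix T
      have "g v T \<in> X j" if "v \<in> I" for v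
        using g that chain_mem[of "g v" _ _ "X j"] zero_mem by blast
      then have "?g T \<in> X j"
        using l(2) by (intro sum_mem) blast
      moreover have "?g T = 0" if "\<not> (T \<subseteq> I \<union> J \<and> int (card T) = k + 1)"
      proof -
        have "g v T = 0" if "v \<in> I" for v
          using g that \<open>\<not> (T \<subseteq> I \<union> J \<and> int (card T) = k + 1)\<close> unfolding chain_def by auto
        then show ?thesis
          by simp
      qed
      ultimately show "if T \<subseteq> I \<union> J \<and> int (card T) = k + 1 then ?g T \<in> X j else ?g T = 0"
        by simp
    qed
    moreover have "kd (I \<union> J) ?a ?g = (\<lambda>T. \<alpha> w * f T)"
    proof
      fix T
      have "kd (I \<union> J) ?a ?g T = (\<Sum>v\<in>I. l v * kd (I \<union> J) ?a (g v) T)"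
        by (simp add: sub.kd_sum scale)
      also have "\<dots> = (\<Sum>v\<in>I. l v * (\<alpha> v * f T))"
        using g by (intro sum.cong) auto
      finally show "kd (I \<union> J) ?a ?g T = \<alpha> w * f T"
        by (simp add: l(1) sum_distrib_right mult.assoc)
    qed
    ultimately show ?thesis
      by blast
  qed
  have "(\<forall>k\<le>p. \<forall>j\<ge>q. kexact (I \<union> J) ?a X (int k) j) \<longleftrightarrow>
      (\<forall>k\<le>p. \<forall>j\<ge>q. kexact (insert w (I \<union> J)) ?a X (int k) j)"
  proof (intro iffI allI impI)
    fix k j assume *: "\<forall>k\<le>p. \<forall>j\<ge>q. kexact (I \<union> J) ?a X (int k) j" and kj: "k \<le> p" "j \<ge> q"
    have "kexact (I \<union> J) ?a X (int k - 1) j"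
    proof (cases k)
      case 0
      then show ?thesis
        by (intro sub.kexact_negative) simp
    next
      case (Suc l)
      then have "kexact (I \<union> J) ?a X (int l) j"
        using * kj by simp
      then show ?thesis
        using Suc by simp
    qed
    then show "kexact (insert w (I \<union> J)) ?a X (int k) j"
      using * kj by (intro kexact_insert) simp_all
  next
    fix k j assume "\<forall>k\<le>p. \<forall>j\<ge>q. kexact (insert w (I \<union> J)) ?a X (int k) j" and "k \<le> p" "j \<ge> q"
    then show "kexact (I \<union> J) ?a X (int k) j"
      by (intro kexact_insertD null) auto
  qed
  then show ?case
    using IH unfolding eq by blast
qed simp

section \<open>Presentations of Veronese subrings\<close>

definition mons :: "nat \<Rightarrow> nat \<Rightarrow> (nat \<Rightarrow>\<^sub>0 nat) set"
  where "mons n d = {t. keys t \<subseteq> {..<n} \<and> mon_degree t = d}"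

definition mono_op :: "(nat \<Rightarrow>\<^sub>0 nat) \<Rightarrow> 'k::field mpoly \<Rightarrow> 'k mpoly"
  where "mono_op t x = Poly_Mapping.single t 1 * x"

lemma mons_decompose:
  assumes "t \<in> mons n (Suc d)"
  obtains v u where "v < n" and "u \<in> mons n d" and "t = Poly_Mapping.single v 1 + u"
proof -
  have "t \<noteq> 0"
    using assms by (auto simp: mons_def)
  then obtain v where v: "v \<in> keys t"
    by (metis all_not_in_conv keys_eq_empty)
  define u where "u = t - Poly_Mapping.single v 1"
  have t: "t = Poly_Mapping.single v 1 + u"
    unfolding u_def by (rule add_single_minus[OF v])
  have "u \<in> mons n d"
    using assms unfolding t by (auto simp: mons_def mon_degree_add keys_add_nat)
  moreover have "v < n"
    using assms v by (auto simp: mons_def)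
  ultimately show ?thesis
    using that t by blast
qed

lemma mons_0: "mons n 0 = {0}"
  by (auto simp: mons_def mon_degree_def in_keys_iff intro!: poly_mapping_eqI)

lemma mons_add: "s \<in> mons n d \<Longrightarrow> t \<in> mons n e \<Longrightarrow> s + t \<in> mons n (d + e)"
  by (auto simp: mons_def keys_add_nat mon_degree_add)

lemma finite_mons: "finite (mons n d)"
proof (induction d)
  case (Suc d)
  have "mons n (Suc d) \<subseteq> (\<Union>v<n. (+) (Poly_Mapping.single v 1) ` mons n d)"
  proof
    fix t assume "t \<in> mons n (Suc d)"
    then obtain v u where "v < n" "u \<in> mons n d" "t = Poly_Mapping.single v 1 + u"
      by (rule mons_decompose)
    then show "t \<in> (\<Union>v<n. (+) (Poly_Mapping.single v 1) ` mons n d)"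
      by blast
  qed
  then show ?case
    by (rule finite_subset) (simp add: Suc)
qed (simp add: mons_0)

lemma mons_split: "t \<in> mons n (d + e) \<Longrightarrow> \<exists>u\<in>mons n d. \<exists>v\<in>mons n e. t = u + v"
proof (induction d arbitrary: t)
  case (Suc d)
  then obtain v u where v: "v < n" "u \<in> mons n (d + e)" "t = Poly_Mapping.single v 1 + u"
    using mons_decompose[of t n "d + e"] by auto
  then obtain u1 u2 where u: "u1 \<in> mons n d" "u2 \<in> mons n e" "u = u1 + u2"
    using Suc.IH by blast
  have "Poly_Mapping.single v 1 + u1 \<in> mons n (Suc d)"
    using v(1) u(1) by (auto simp: mons_def keys_add_nat mon_degree_add)
  then show ?case
    using u v(3) by (metis add.assoc)
qed (simp add: mons_0)

lemma homog_nat_iff: "p \<in> homog n (int d) \<longleftrightarrow> keys p \<subseteq> mons n d"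
  by (auto simp: homog_iff mons_def in_keys_iff)

lemma homog_negative: "d < 0 \<Longrightarrow> homog n d = {0}"
  by (auto simp: homog_iff intro!: poly_mapping_eqI)

lemma poly_eq_sum: "p = (\<Sum>t\<in>keys p. Poly_Mapping.single t (lookup p t))"
proof (rule poly_mapping_eqI)
  fix t
  have "lookup (\<Sum>t\<in>keys p. Poly_Mapping.single t (lookup p t)) t =
      (\<Sum>u\<in>keys p. if u = t then lookup p u else 0)"
    unfolding lookup_sum by (intro sum.cong) (auto simp: lookup_single when_def)
  also have "\<dots> = lookup p t"
    by (simp add: sum.delta in_keys_iff)
  finally show "lookup p t = lookup (\<Sum>t\<in>keys p. Poly_Mapping.single t (lookup p t)) t" ..
qed

lemma Const_mult: "Const a * Poly_Mapping.single t b = Poly_Mapping.single t (a * b)"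
  by (simp add: Const_def mult_single)

lemma Const_homog: "x \<in> homog n d \<Longrightarrow> Const a * x \<in> homog n d"
  using homog_mult[of "Const a" n 0 x d] homog_single[of 0 n 0 a] by (simp add: Const_def)

text \<open>On exponent vectors, this is the passage to the e-th power of a monomial.\<close>

definition nsmul :: "nat \<Rightarrow> 'a::comm_monoid_add \<Rightarrow> 'a"
  where "nsmul e x = (\<Sum>i<e. x)"

lemma nsmul_0 [simp]: "nsmul 0 x = 0"
  and nsmul_Suc: "nsmul (Suc e) x = nsmul e x + x"
  by (simp_all add: nsmul_def)

lemma nsmul_1 [simp]: "nsmul (Suc 0) x = x"
  by (simp add: nsmul_Suc)

lemma nsmul_add: "nsmul (d + e) x = nsmul d x + nsmul e x"
  by (induction e) (simp_all add: nsmul_Suc add.assoc)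

text \<open>The toric presentation: variable \<open>v\<close> goes to the monomial
  \<open>\<mu> v\<close> of degree \<open>c\<close>, and \<open>E\<close> is the induced map of
  exponents. It is onto because a monomial of degree dc splits into d monomials of degree c.
  Existence is what gives meaning to the choice in \<open>green_lazarsfeld_index\<close>.\<close>

lemma ex_presentation:
  assumes c: "c > 0"
  shows "\<exists>m \<phi>. graded_quotient Const (veronese n c :: int \<Rightarrow> 'k::field mpoly set) m \<phi>"
proof -
  obtain \<mu> where mu: "bij_betw \<mu> {..<card (mons n c)} (mons n c)"
    using ex_bij_betw_nat_finite[OF finite_mons, of n c] by (auto simp: atLeast0LessThan)
  let ?m = "card (mons n c)"
  define E where "E t = (\<Sum>v\<in>keys t. nsmul (lookup t v) (\<mu> v))" for t :: "nat \<Rightarrow>\<^sub>0 nat"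
  have E_add: "E (s + t) = E s + E t" for s t
    unfolding E_def by (rule setsum_keys_plus_distrib) (auto simp: nsmul_add)
  have E_0: "E 0 = 0"
    by (simp add: E_def)
  have E_single: "E (Poly_Mapping.single v 1) = \<mu> v" for v
    by (simp add: E_def)
  define \<phi> where "\<phi> p = (\<Sum>t\<in>keys p. Poly_Mapping.single (E t) (lookup p t))" for p :: "'k mpoly"
  have add: "\<phi> (p + q) = \<phi> p + \<phi> q" for p q
    unfolding \<phi>_def by (rule setsum_keys_plus_distrib) (auto simp: single_add)
  have zero: "\<phi> 0 = 0"
    by (simp add: \<phi>_def)
  have sum: "\<phi> (\<Sum>s\<in>S. f s) = (\<Sum>s\<in>S. \<phi> (f s))" for S :: "(nat \<Rightarrow>\<^sub>0 nat) set" and f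
    by (induction S rule: infinite_finite_induct) (auto simp: zero add)
  have single: "\<phi> (Poly_Mapping.single t a) = Poly_Mapping.single (E t) a" for t a
    by (auto simp: \<phi>_def)
  have mult: "\<phi> (p * q) = \<phi> p * \<phi> q" for p q
  proof -
    have "\<phi> (p * q) = \<phi> ((\<Sum>s\<in>keys p. Poly_Mapping.single s (lookup p s)) * (\<Sum>t\<in>keys q. Poly_Mapping.single t (lookup q t)))"
      by (simp flip: poly_eq_sum)
    also have "\<dots> = (\<Sum>s\<in>keys p. \<Sum>t\<in>keys q. Poly_Mapping.single (E s + E t) (lookup p s * lookup q t))"
      by (simp add: sum_product sum mult_single single E_add)
    also have "\<dots> = \<phi> p * \<phi> q"
      by (simp add: \<phi>_def sum_product mult_single)
    finally show ?thesis .
  qed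
  have E_mons: "E t \<in> mons n (mon_degree t * c)" if "keys t \<subseteq> {..<?m}" for t
    using that
  proof (induction "mon_degree t" arbitrary: t)
    case 0
    then have "t \<in> mons ?m 0"
      by (simp add: mons_def)
    then have "t = 0"
      by (simp add: mons_0)
    then show ?case
      by (simp add: E_0 mons_0)
  next
    case (Suc d)
    then have "t \<in> mons ?m (Suc d)"
      by (simp add: mons_def)
    then obtain v u where vu: "v < ?m" "u \<in> mons ?m d" "t = Poly_Mapping.single v 1 + u"
      by (rule mons_decompose)
    have "E u \<in> mons n (d * c)"
      using Suc.hyps(1)[of u] vu(2) by (auto simp: mons_def)
    moreover have "\<mu> v \<in> mons n c"
      using mu vu(1) by (auto simp: bij_betw_def)
    ultimately have "E t \<in> mons n (c + d * c)"
      unfolding vu(3) E_add E_single by (intro mons_add)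
    then show ?case
      using Suc.hyps(2) by (metis mult_Suc)
  qed
  have E_surj: "\<exists>t\<in>mons ?m d. E t = u" if "u \<in> mons n (d * c)" for u d
    using that
  proof (induction d arbitrary: u)
    case 0
    then show ?case
      by (auto simp: mons_0 E_0)
  next
    case (Suc d)
    then have "u \<in> mons n (c + d * c)"
      by simp
    then obtain w u' where w: "w \<in> mons n c" "u' \<in> mons n (d * c)" "u = w + u'"
      using mons_split by blast
    then obtain v where v: "v < ?m" "w = \<mu> v"
      using mu by (auto simp: bij_betw_def)
    obtain t where t: "t \<in> mons ?m d" "E t = u'"
      using Suc.IH w(2) by blast
    have "Poly_Mapping.single v 1 + t \<in> mons ?m (Suc d)"
      using v(1) t(1) by (auto simp: mons_def keys_add_nat mon_degree_add)
    moreover have "E (Poly_Mapping.single v 1 + t) = u"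
      unfolding E_add E_single t(2) w(3) v(2) ..
    ultimately show ?case
      by blast
  qed
  have image_nat: "\<phi> ` homog ?m (int d) = homog n (int (d * c))" for d
  proof (intro equalityI subsetI)
    fix q assume "q \<in> \<phi> ` homog ?m (int d)"
    then obtain p where p: "p \<in> homog ?m (int d)" "q = \<phi> p"
      by blast
    have "Poly_Mapping.single (E t) (lookup p t) \<in> homog n (int (d * c))" if "t \<in> keys p" for t
    proof -
      have "keys t \<subseteq> {..<?m}" "mon_degree t = d"
        using p(1) that unfolding homog_nat_iff by (auto simp: mons_def)
      then show ?thesis
        using E_mons[of t] by (intro homog_single) (auto simp: mons_def)
    qed
    then have "(\<Sum>t\<in>S. Poly_Mapping.single (E t) (lookup p t)) \<in> homog n (int (d * c))" if "S \<subseteq> keys p" for S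
      using that by (induction S rule: infinite_finite_induct) (auto intro: homog_add)
    then show "q \<in> homog n (int (d * c))"
      unfolding p(2) \<phi>_def by blast
  next
    fix q :: "'k mpoly" assume "q \<in> homog n (int (d * c))"
    then have "\<forall>u\<in>keys q. \<exists>t. t \<in> mons ?m d \<and> E t = u"
      using E_surj unfolding homog_nat_iff by blast
    from bchoice[OF this] obtain h where h: "\<forall>u\<in>keys q. h u \<in> mons ?m d \<and> E (h u) = u"
      by blast
    let ?p = "\<Sum>u\<in>keys q. Poly_Mapping.single (h u) (lookup q u)"
    have "Poly_Mapping.single (h u) (lookup q u) \<in> homog ?m (int d)" if "u \<in> keys q" for u
      using h that by (intro homog_single) (auto simp: mons_def)
    then have "(\<Sum>u\<in>S. Poly_Mapping.single (h u) (lookup q u)) \<in> homog ?m (int d)" if "S \<subseteq> keys q" for S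
      using that by (induction S rule: infinite_finite_induct) (auto intro: homog_add)
    moreover have "\<phi> ?p = q"
    proof -
      have "\<phi> ?p = (\<Sum>u\<in>keys q. Poly_Mapping.single u (lookup q u))"
        unfolding sum single using h by (intro sum.cong) auto
      then show ?thesis
        by (simp flip: poly_eq_sum)
    qed
    ultimately show "q \<in> \<phi> ` homog ?m (int d)"
      by (intro image_eqI[where x = ?p]) simp_all
  qed
  have image: "\<phi> ` homog ?m i = veronese n c i" for i
  proof (cases "i \<ge> 0")
    case True
    then obtain d where "i = int d"
      using nonneg_int_cases by blast
    then show ?thesis
      using image_nat[of d] by (simp add: veronese_def)
  next
    case neg: False
    then have "i * int c < 0"
      using c by (simp add: mult_neg_pos)
    then show ?thesis
      using neg by (simp add: veronese_def homog_negative zero)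
  qed
  have "\<phi> (Const a) = Const a" for a
    unfolding Const_def single E_0 ..
  then have "graded_quotient Const (veronese n c) ?m \<phi>"
    unfolding graded_quotient_def using add mult image by blast
  then show ?thesis
    by blast
qed

section \<open>An arbitrary presentation\<close>

locale veronese_presentation =
  fixes n c m :: nat and \<phi> :: "'k::field mpoly \<Rightarrow> 'k mpoly"
  assumes c_pos: "c > 0"
    and presentation: "graded_quotient Const (veronese n c :: int \<Rightarrow> 'k mpoly set) m \<phi>"
begin

lemma phi_Const: "\<phi> (Const a) = Const a"
  and phi_add: "p \<in> polys m \<Longrightarrow> q \<in> polys m \<Longrightarrow> \<phi> (p + q) = \<phi> p + \<phi> q"
  and phi_mult: "p \<in> polys m \<Longrightarrow> q \<in> polys m \<Longrightarrow> \<phi> (p * q) = \<phi> p * \<phi> q"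
  and phi_image: "\<phi> ` homog m j = veronese n c j"
  using presentation unfolding graded_quotient_def by blast+

lemma phi_zero: "\<phi> 0 = 0"
  using phi_Const[of 0] by (simp add: Const_def)

lemma polys_sum: "(\<And>s. s \<in> S \<Longrightarrow> f s \<in> polys m) \<Longrightarrow> (\<Sum>s\<in>S. f s) \<in> polys m"
proof (induction S rule: infinite_finite_induct)
  case (insert s S)
  have "p + q \<in> polys m" if "p \<in> polys m" "q \<in> polys m" for p q :: "'b mpoly"
    using that unfolding polys_iff by (metis lookup_add add_0)
  then show ?case
    using insert by simp
qed (auto simp: polys_iff)

lemma phi_sum: "(\<And>s. s \<in> S \<Longrightarrow> f s \<in> polys m) \<Longrightarrow> \<phi> (\<Sum>s\<in>S. f s) = (\<Sum>s\<in>S. \<phi> (f s))"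
proof (induction S rule: infinite_finite_induct)
  case (insert s S)
  then show ?case
    using phi_add[of "f s" "\<Sum>s\<in>S. f s"] polys_sum[of S f] by auto
qed (auto simp: phi_zero)

text \<open>The homogeneous components of \<open>p\<close> have their images in the degrees lc.
  These are distinct for distinct l, so the images cannot cancel.\<close>

lemma phi_component:
  assumes "p \<in> polys m" and "\<phi> p = 0"
  shows "\<phi> (pfilt (\<lambda>t. int (mon_degree t) = j) p) = 0"
proof -
  let ?h = "\<lambda>j. pfilt (\<lambda>t. int (mon_degree t) = j) p"
  define S where "S = insert j ((\<lambda>t. int (mon_degree t)) ` keys p)"
  have S: "finite S"
    by (simp add: S_def)
  have p: "p = (\<Sum>l\<in>S. ?h l)"
  proof (rule poly_mapping_eqI)
    fix t
    have "lookup (\<Sum>l\<in>S. ?h l) t = (\<Sum>l\<in>S. if int (mon_degree t) = l then lookup p t else 0)"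
      by (simp add: lookup_sum lookup_pfilt)
    also have "\<dots> = lookup p t"
    proof (cases "lookup p t = 0")
      case False
      then have "int (mon_degree t) \<in> S"
        by (auto simp: S_def in_keys_iff)
      then show ?thesis
        using S by simp
    qed (auto intro!: sum.neutral)
    finally show "lookup p t = lookup (\<Sum>l\<in>S. ?h l) t" ..
  qed
  have h: "?h l \<in> homog m l" for l
    using assms(1) by (auto simp: homog_iff polys_iff lookup_pfilt)
  have "\<phi> p = (\<Sum>l\<in>S. \<phi> (?h l))"
    using h homog_subset_polys by (subst p, intro phi_sum) blast
  then have sum: "(\<Sum>l\<in>S. \<phi> (?h l)) = 0"
    using assms(2) by simp
  have mem: "\<phi> (?h l) \<in> homog n (l * int c)" for l
    using h[of l] phi_image[of l] unfolding veronese_def by blast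
  show ?thesis
  proof (rule poly_mapping_eqI)
    fix t
    have "lookup (\<phi> (?h l)) t = 0" if "l \<noteq> j" "int (mon_degree t) = j * int c" for l
    proof (rule ccontr)
      assume "lookup (\<phi> (?h l)) t \<noteq> 0"
      then have "int (mon_degree t) = l * int c"
        using mem[of l] unfolding homog_iff by blast
      then show False
        using that c_pos by simp
    qed
    then have "lookup (\<phi> (?h j)) t = (\<Sum>l\<in>S. lookup (\<phi> (?h l)) t)" if "int (mon_degree t) = j * int c"
      using S that sum.remove[of S j "\<lambda>l. lookup (\<phi> (?h l)) t"]
      by (simp add: S_def sum.neutral)
    moreover have "(\<Sum>l\<in>S. lookup (\<phi> (?h l)) t) = 0"
      using sum by (simp flip: lookup_sum)
    moreover have "lookup (\<phi> (?h j)) t = 0" if "int (mon_degree t) \<noteq> j * int c"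
      using mem[of j] that unfolding homog_iff by blast
    ultimately show "lookup (\<phi> (?h j)) t = lookup 0 t"
      by (cases "int (mon_degree t) = j * int c") simp_all
  qed
qed

text \<open>
  The variables are indexed by monomials of degree greater than \<open>c\<close>, so that they are disjoint from
  the index set \<open>mons n c\<close> of the standard generators.
\<close>

definition var_index :: "(nat \<Rightarrow>\<^sub>0 nat) set"
  where "var_index = (\<lambda>v. Poly_Mapping.single 0 (Suc c + v)) ` {..<m}"

definition var_of :: "(nat \<Rightarrow>\<^sub>0 nat) \<Rightarrow> nat"
  where "var_of t = lookup t 0 - Suc c"

lemma var_of_bij: "bij_betw var_of var_index {..<m}"
proof (rule bij_betwI')
  show "var_of x = var_of y \<longleftrightarrow> x = y" if "x \<in> var_index" "y \<in> var_index" for x y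
    using that by (auto simp: var_index_def var_of_def)
qed (auto simp: var_index_def var_of_def image_iff)

lemma var_index_disjoint: "var_index \<inter> mons n c = {}"
  by (auto simp: var_index_def mons_def)

lemma var_of_less: "v \<in> var_index \<Longrightarrow> var_of v < m"
  using var_of_bij by (auto simp: bij_betw_def)

text \<open>The same choice as in \<open>Tor\<close>, which therefore unfolds to
  \<open>tensor_homology res\<close>.\<close>

definition res :: "'k free_complex"
  where "res = (SOME F. graded_free_resolution (veronese n c) m \<phi> F)"

sublocale resolution m "veronese n c" \<phi> res var_index var_of
proof
  have "\<exists>F. graded_free_resolution (veronese n c) m \<phi> F"
    by (rule ex_resolution) (simp_all add: phi_add phi_mult phi_image phi_component)
  then show "graded_free_resolution (veronese n c) m \<phi> res"
    unfolding res_def by (rule someI_ex)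
qed (simp_all add: phi_add phi_mult phi_image var_of_bij)

lemma top_degree_le_iff:
  "top_degree (veronese n c) m \<phi> i \<le> ereal (real i + 1) \<longleftrightarrow>
    (\<forall>j. (\<exists>h\<in>tensor_homology res i j. 0 \<notin> h) \<longrightarrow> j \<le> int i + 1)"
proof -
  have "real_of_int j \<le> real i + 1 \<longleftrightarrow> j \<le> int i + 1" for j
    by linarith
  then show ?thesis
    unfolding top_degree_def Tor_def res_def[symmetric] Sup_le_iff
    by (simp only: ereal_less_eq(3)[symmetric]) blast
qed

text \<open>Internal degree j at position i is degree i + j of Tor, so the strands j \<ge> 2 are
  exactly those that t_i \<le> i + 1 excludes.\<close>

lemma index_over_ge:
  assumes "\<forall>k\<le>p. \<forall>j\<ge>2. kexact var_index (\<lambda>v x. \<phi> (Var (var_of v)) * x) (veronese n c) (int k) j"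
  shows "enat p \<le> index_over (veronese n c) m \<phi>"
proof -
  have "top_degree (veronese n c) m \<phi> i \<le> ereal (real i + 1)" if "i \<le> p" for i
    unfolding top_degree_le_iff
  proof (intro allI impI)
    fix j assume "\<exists>h\<in>tensor_homology res i j. 0 \<notin> h"
    then have "\<not> kexact var_index (\<lambda>v x. \<phi> (Var (var_of v)) * x) (veronese n c) (int i) (j - int i)"
      using zero_classes by blast
    then have "\<not> j - int i \<ge> 2"
      using assms that by blast
    then show "j \<le> int i + 1"
      by simp
  qed
  then show ?thesis
    unfolding index_over_def by (intro Sup_upper) blast
qed

text \<open>The algebra is generated in degree 1. This confines failures of exactness with j \<ge> 2
  to k \<ge> 1, where \<open>nonzero_class_iff_kexact\<close> turns them into classes of
  Tor.\<close>

lemma kexact_0: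
  assumes "j \<ge> 1"
  shows "kexact var_index (\<lambda>v x. \<phi> (Var (var_of v)) * x) (veronese n c) 0 j"
proof -
  interpret A: graded_ops var_index "\<lambda>v x. \<phi> (Var (var_of v)) * x" "veronese n c"
    by (rule A_ops)
  interpret P: free_koszul m "{0}" "\<lambda>_. 0" var_index var_of
    using var_of_bij by unfold_locales
  show ?thesis
    unfolding kexact_def
  proof (intro ballI impI)
    fix f :: "(nat \<Rightarrow>\<^sub>0 nat) set \<Rightarrow> 'k mpoly" assume f: "f \<in> chain var_index 0 (veronese n c j)"
    then have "f {} \<in> \<phi> ` homog m j"
      unfolding phi_image using chain_mem[OF f A.zero_mem] by blast
    then obtain p where p: "f {} = \<phi> p" "p \<in> homog m j"
      by (rule imageE)
    let ?x = "Poly_Mapping.single (0::nat) p"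
    have x: "?x \<in> free_part m {0} (\<lambda>_. 0) j"
      using p(2) by (auto simp: free_part_def lookup_single when_def)
    have "lookup p 0 = 0"
      using p(2) assms unfolding homog_iff by fastforce
    then have "\<forall>b. coef ?x b 0 = 0"
      by (auto simp: coef_def lookup_single when_def)
    then obtain y where y: "\<forall>v\<in>var_index. y v \<in> free_part m {0} (\<lambda>_. 0) (j - 1)"
      "(\<Sum>v\<in>var_index. smult (Var (var_of v)) (y v)) = ?x"
      using P.irrelevant_iff[OF x] by blast
    have hom: "lookup (y v) 0 \<in> homog m (j - 1)" if "v \<in> var_index" for v
      using y(1) that by (auto simp: free_part_def)
    have pol: "lookup (y v) 0 \<in> polys m" if "v \<in> var_index" for v
      using hom[OF that] homog_subset_polys by blast
    have "p = (\<Sum>v\<in>var_index. Var (var_of v) * lookup (y v) 0)"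
      using arg_cong[OF y(2), of "\<lambda>x. lookup x 0"] by (simp add: lookup_sum lookup_smult)
    then have "\<phi> p = \<phi> (\<Sum>v\<in>var_index. Var (var_of v) * lookup (y v) 0)"
      by (rule arg_cong)
    also have "\<dots> = (\<Sum>v\<in>var_index. \<phi> (Var (var_of v) * lookup (y v) 0))"
      using pol var_of_less by (intro phi_sum polys_mult Var_polys)
    also have "\<dots> = (\<Sum>v\<in>var_index. \<phi> (Var (var_of v)) * \<phi> (lookup (y v) 0))"
      using pol Var_polys var_of_less by (intro sum.cong refl phi_mult) auto
    finally have phi_p: "\<phi> p = (\<Sum>v\<in>var_index. \<phi> (Var (var_of v)) * \<phi> (lookup (y v) 0))" .
    let ?g = "chain1 var_index (\<lambda>v. \<phi> (lookup (y v) 0))"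
    have g: "?g \<in> chain var_index 1 (veronese n c (j - 1))"
      using hom phi_image by (intro chain1_chain) blast
    have "kd var_index (\<lambda>v x. \<phi> (Var (var_of v)) * x) ?g = f"
    proof (rule chain_0_eqI)
      show "kd var_index (\<lambda>v x. \<phi> (Var (var_of v)) * x) ?g \<in> chain var_index 0 (veronese n c (j - 1 + 1))"
        using A.kd_chain[OF g] by simp
      show "f \<in> chain var_index 0 (veronese n c j)"
        by (rule f)
    qed (simp_all only: kd_chain1 p(1) phi_p A.finite_index)
    then show "\<exists>g\<in>chain var_index (0 + 1) (veronese n c (j - 1)).
        kd var_index (\<lambda>v x. \<phi> (Var (var_of v)) * x) g = f"
      using g by auto
  qed
qed

lemma index_over_less:
  assumes "\<not> (\<forall>k\<le>p. \<forall>j\<ge>2. kexact var_index (\<lambda>v x. \<phi> (Var (var_of v)) * x) (veronese n c) (int k) j)"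
  shows "index_over (veronese n c) m \<phi> < enat p"
proof -
  obtain k j where kj: "k \<le> p" "j \<ge> 2"
    "\<not> kexact var_index (\<lambda>v x. \<phi> (Var (var_of v)) * x) (veronese n c) (int k) j"
    using assms by blast
  have k: "k \<ge> 1"
  proof (rule ccontr)
    assume "\<not> k \<ge> 1"
    then have "int k = 0"
      by simp
    then show False
      using kj(2,3) kexact_0[of j] by simp
  qed
  have "\<not> top_degree (veronese n c) m \<phi> k \<le> ereal (real k + 1)"
  proof
    assume *: "top_degree (veronese n c) m \<phi> k \<le> ereal (real k + 1)"
    have "\<exists>h\<in>tensor_homology res k (j + int k). 0 \<notin> h"
      using kj(3) nonzero_class_iff_kexact[OF k, of "j + int k"] by simp
    then have "j + int k \<le> int k + 1"
      using * unfolding top_degree_le_iff by blast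
    then show False
      using kj(2) by simp
  qed
  then have "q \<le> k - 1" if "\<forall>i\<le>q. top_degree (veronese n c) m \<phi> i \<le> ereal (real i + 1)" for q
    using that by (cases "k \<le> q") auto
  then have "index_over (veronese n c) m \<phi> \<le> enat (k - 1)"
    unfolding index_over_def by (intro Sup_least) auto
  also have "\<dots> < enat p"
    using k kj(1) by simp
  finally show ?thesis .
qed

text \<open>Both families span the component of degree 1, so each is compared with their disjoint
  union: a monomial of degree \<open>c\<close> is the image of a linear form, and the image of a
  variable is a combination of such monomials.\<close>

lemma generators_change:
  "(\<forall>k\<le>p. \<forall>j\<ge>2. kexact var_index (\<lambda>v x. \<phi> (Var (var_of v)) * x) (veronese n c) (int k) j) \<longleftrightarrow>
    (\<forall>k\<le>p. \<forall>j\<ge>2. kexact (mons n c) mono_op (veronese n c :: int \<Rightarrow> 'k mpoly set) (int k) j)"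
proof -
  let ?V = "mons n c"
  \<comment> \<open>One multiplier for the union. Indices keep the two families apart even if a
    variable is mapped to a monomial.\<close>
  define \<alpha> where "\<alpha> t = (if t \<in> ?V then Poly_Mapping.single t 1 else \<phi> (Var (var_of t)))" for t
  have alpha: "\<alpha> t = \<phi> (Var (var_of t))" if "t \<in> var_index" for t
    using that var_index_disjoint by (auto simp: \<alpha>_def)
  have scale: "Const a * x \<in> veronese n c j" if "x \<in> veronese n c j" for a :: 'k and x j
    using that unfolding veronese_def by (rule Const_homog)
  have gen: "\<phi> (Var (var_of t)) \<in> homog n (int c)" if "t \<in> var_index" for t
    using Var_homog[OF var_of_less[OF that]] phi_image[of 1] by (auto simp: veronese_def)
  have mem: "\<alpha> t \<in> homog n (int c)" if "t \<in> var_index \<union> ?V" for t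
  proof (cases "t \<in> ?V")
    case True
    then show ?thesis
      unfolding \<alpha>_def by (auto simp: mons_def intro!: homog_single)
  next
    case False
    then show ?thesis
      using that gen by (simp add: \<alpha>_def)
  qed
  have ops: "graded_ops (var_index \<union> ?V) (\<lambda>v x. \<alpha> v * x) (veronese n c)"
  proof
    show "finite (var_index \<union> ?V)"
      by (simp add: var_index_def finite_mons)
    show "x - y \<in> veronese n c j" if "x \<in> veronese n c j" "y \<in> veronese n c j" for x y j
      using that unfolding veronese_def by (rule homog_diff)
    show "\<alpha> v * x \<in> veronese n c (j + 1)" if "v \<in> var_index \<union> ?V" "x \<in> veronese n c j" for v x j
      using homog_mult[OF mem[OF that(1)], of x "j * int c"] that(2)
      by (simp add: veronese_def algebra_simps)
  qed (auto simp: algebra_simps veronese_def)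
  have span1: "\<exists>l. \<alpha> w = (\<Sum>v\<in>var_index. l v * \<alpha> v) \<and>
      (\<forall>v\<in>var_index. \<forall>j. \<forall>x\<in>veronese n c j. l v * x \<in> veronese n c j)" if w: "w \<in> ?V" for w
  proof -
    have "\<alpha> w \<in> \<phi> ` homog m 1"
      unfolding phi_image using mem[of w] w by (simp add: veronese_def)
    then obtain p where p: "\<alpha> w = \<phi> p" "p \<in> homog m 1"
      by (rule imageE)
    let ?l = "\<lambda>v. Const (lookup p (Poly_Mapping.single (var_of v) 1)) :: 'k mpoly"
    have keys_p: "keys p \<subseteq> (\<lambda>v. Poly_Mapping.single v 1) ` {..<m}"
    proof
      fix t assume "t \<in> keys p"
      then have "t \<in> mons m (Suc 0)"
        using p(2) homog_nat_iff[of p m 1] by auto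
      then show "t \<in> (\<lambda>v. Poly_Mapping.single v 1) ` {..<m}"
        by (rule mons_decompose) (auto simp: mons_0)
    qed
    have "p = (\<Sum>t\<in>keys p. Poly_Mapping.single t (lookup p t))"
      by (rule poly_eq_sum)
    also have "\<dots> = (\<Sum>t\<in>(\<lambda>v. Poly_Mapping.single v 1) ` {..<m}. Poly_Mapping.single t (lookup p t))"
      using keys_p by (intro sum.mono_neutral_left) (auto simp: in_keys_iff)
    also have "\<dots> = (\<Sum>v<m. Poly_Mapping.single (Poly_Mapping.single v 1) (lookup p (Poly_Mapping.single v 1)))"
    proof -
      have "inj_on (\<lambda>v. Poly_Mapping.single v (1::nat)) {..<m}"
      proof (rule inj_onI)
        fix x y assume "Poly_Mapping.single x (1::nat) = Poly_Mapping.single y 1"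
        then have "keys (Poly_Mapping.single x (1::nat)) = keys (Poly_Mapping.single y (1::nat))"
          by simp
        then show "x = y"
          by simp
      qed
      then show ?thesis
        by (simp add: sum.reindex)
    qed
    also have "\<dots> = (\<Sum>v\<in>var_index. Poly_Mapping.single (Poly_Mapping.single (var_of v) 1)
        (lookup p (Poly_Mapping.single (var_of v) 1)))"
      by (rule sum.reindex_bij_betw[OF var_of_bij, symmetric])
    also have "\<dots> = (\<Sum>v\<in>var_index. ?l v * Var (var_of v))"
      by (simp add: Var_def Const_mult)
    finally have "\<phi> p = \<phi> (\<Sum>v\<in>var_index. ?l v * Var (var_of v))"
      by (rule arg_cong)
    also have "\<dots> = (\<Sum>v\<in>var_index. \<phi> (?l v * Var (var_of v)))"
      using var_of_less by (intro phi_sum polys_mult Const_polys Var_polys)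
    also have "\<dots> = (\<Sum>v\<in>var_index. ?l v * \<alpha> v)"
      using var_of_less by (intro sum.cong refl) (simp add: phi_mult Const_polys Var_polys phi_Const alpha)
    finally show ?thesis
      using p(1) scale by (intro exI[of _ ?l]) simp
  qed
  have span2: "\<exists>l. \<alpha> w = (\<Sum>v\<in>?V. l v * \<alpha> v) \<and>
      (\<forall>v\<in>?V. \<forall>j. \<forall>x\<in>veronese n c j. l v * x \<in> veronese n c j)" if w: "w \<in> var_index" for w
  proof -
    let ?l = "\<lambda>v. Const (lookup (\<alpha> w) v) :: 'k mpoly"
    have "keys (\<alpha> w) \<subseteq> ?V"
      using mem[of w] w by (simp add: homog_nat_iff)
    then have "(\<Sum>t\<in>keys (\<alpha> w). Poly_Mapping.single t (lookup (\<alpha> w) t)) =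
        (\<Sum>t\<in>?V. Poly_Mapping.single t (lookup (\<alpha> w) t))"
      by (intro sum.mono_neutral_left finite_mons) (auto simp: in_keys_iff)
    also have "\<dots> = (\<Sum>v\<in>?V. ?l v * \<alpha> v)"
      by (intro sum.cong refl) (simp add: \<alpha>_def Const_mult)
    finally have "\<alpha> w = (\<Sum>v\<in>?V. ?l v * \<alpha> v)"
      unfolding poly_eq_sum[symmetric] .
    then show ?thesis
      using scale by (intro exI[of _ ?l]) simp
  qed
  have cong1: "kexact var_index (\<lambda>v x. \<phi> (Var (var_of v)) * x) (veronese n c) k j \<longleftrightarrow>
      kexact var_index (\<lambda>v x. \<alpha> v * x) (veronese n c) k j" for k j
    by (rule kexact_cong) (simp add: alpha)
  have cong2: "kexact ?V mono_op (veronese n c :: int \<Rightarrow> 'k mpoly set) k j \<longleftrightarrow>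
      kexact ?V (\<lambda>v x. \<alpha> v * x) (veronese n c) k j" for k j
    by (rule kexact_cong) (simp add: \<alpha>_def mono_op_def)
  have "finite var_index"
    by (simp add: var_index_def)
  have 1: "(\<forall>k\<le>p. \<forall>j\<ge>2. kexact var_index (\<lambda>v x. \<alpha> v * x) (veronese n c) (int k) j) \<longleftrightarrow>
      (\<forall>k\<le>p. \<forall>j\<ge>2. kexact (var_index \<union> ?V) (\<lambda>v x. \<alpha> v * x) (veronese n c) (int k) j)"
    using var_index_disjoint ops span1 by (intro kexact_dependent_generators finite_mons) auto
  have 2: "(\<forall>k\<le>p. \<forall>j\<ge>2. kexact ?V (\<lambda>v x. \<alpha> v * x) (veronese n c) (int k) j) \<longleftrightarrow>
      (\<forall>k\<le>p. \<forall>j\<ge>2. kexact (?V \<union> var_index) (\<lambda>v x. \<alpha> v * x) (veronese n c) (int k) j)"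
    using var_index_disjoint ops span2 \<open>finite var_index\<close>
    by (intro kexact_dependent_generators) (auto simp: Un_commute)
  show ?thesis
    unfolding cong1 cong2 1 2 by (simp add: Un_commute)
qed

end

section \<open>The index in terms of the monomials of degree c\<close>

lemma green_lazarsfeld_index_presentation:
  assumes "c > 0"
  shows "\<exists>m (\<phi> :: 'k mpoly \<Rightarrow> 'k mpoly). veronese_presentation n c m \<phi> \<and>
    green_lazarsfeld_index (Const :: 'k::field \<Rightarrow> 'k mpoly) (veronese n c) = index_over (veronese n c) m \<phi>"
proof -
  let ?P = "\<lambda>(m, \<phi>). graded_quotient Const (veronese n c :: int \<Rightarrow> 'k mpoly set) m \<phi>"
  obtain m \<phi> where some: "(SOME x. ?P x) = (m, \<phi>)"
    by (cases "SOME x. ?P x") auto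
  have "\<exists>x. ?P x"
    using ex_presentation[OF assms] by auto
  then have "?P (SOME x. ?P x)"
    by (rule someI_ex)
  then have "veronese_presentation n c m \<phi>"
    using assms unfolding some by unfold_locales auto
  then show ?thesis
    unfolding green_lazarsfeld_index_def some prod.case by blast
qed

lemma green_lazarsfeld_index_ge:
  assumes "c > 0"
    and "\<forall>k\<le>p. \<forall>j\<ge>2. kexact (mons n c) mono_op (veronese n c :: int \<Rightarrow> 'k::field mpoly set) (int k) j"
  shows "enat p \<le> green_lazarsfeld_index (Const :: 'k \<Rightarrow> 'k mpoly) (veronese n c)"
proof -
  obtain m and \<phi> :: "'k mpoly \<Rightarrow> 'k mpoly" where *: "veronese_presentation n c m \<phi>"
    "green_lazarsfeld_index (Const :: 'k \<Rightarrow> 'k mpoly) (veronese n c) = index_over (veronese n c) m \<phi>"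
    using green_lazarsfeld_index_presentation[OF assms(1)] by blast
  interpret veronese_presentation n c m \<phi>
    by (rule *(1))
  show ?thesis
    unfolding *(2) using assms(2) by (intro index_over_ge) (simp add: generators_change)
qed

lemma green_lazarsfeld_index_less:
  assumes "c > 0"
    and "\<not> kexact (mons n c) mono_op (veronese n c :: int \<Rightarrow> 'k::field mpoly set) (int p) 2"
  shows "green_lazarsfeld_index (Const :: 'k \<Rightarrow> 'k mpoly) (veronese n c) < enat p"
proof -
  obtain m and \<phi> :: "'k mpoly \<Rightarrow> 'k mpoly" where *: "veronese_presentation n c m \<phi>"
    "green_lazarsfeld_index (Const :: 'k \<Rightarrow> 'k mpoly) (veronese n c) = index_over (veronese n c) m \<phi>"
    using green_lazarsfeld_index_presentation[OF assms(1)] by blast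
  interpret veronese_presentation n c m \<phi>
    by (rule *(1))
  have "\<not> (\<forall>k\<le>p. \<forall>j\<ge>2. kexact (mons n c) mono_op (veronese n c :: int \<Rightarrow> 'k mpoly set) (int k) j)"
    using assms(2) by auto
  then show ?thesis
    unfolding *(2) generators_change[symmetric] by (rule index_over_less)
qed

section \<open>A vanishing theorem of Green\<close>

lemma sg_transpose:
  assumes "finite T" and "v \<notin> T" and "w \<notin> T" and "v \<noteq> w"
  shows "sg v T (sg w (insert v T) x) = - sg w T (sg v (insert w T) x)"
  using assms by (auto simp: sg_insert sg_uminus sg_commute[of v])

text \<open>
  The top element \<open>t\<close> of all supports occurs only once in the cycle condition in degree \<open>t + w\<close>,
  where \<open>w\<close> is the top element of \<open>W\<close>.  Hence contraction with \<open>t\<close> kills the component at \<open>w\<close>,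
  which allows induction on \<open>W\<close>.
\<close>

lemma green_vanishing:
  fixes z :: "'a::linordered_cancel_ab_semigroup_add \<Rightarrow> 'a set \<Rightarrow> 'k::ab_group_add"
  assumes "finite V" and "finite W" and "card W \<le> k"
    and "\<And>w T. w \<in> W \<Longrightarrow> z w T \<noteq> 0 \<Longrightarrow> T \<subseteq> V \<and> card T = k"
    and "\<And>T y. T \<subseteq> V \<Longrightarrow> (\<Sum>v\<in>V - T. \<Sum>w\<in>W. if v + w = y then sg v T (z w (insert v T)) else 0) = 0"
    and "w \<in> W"
  shows "z w T = 0"
  using assms(2-)
proof (induction W arbitrary: z k w T rule: finite_linorder_max_induct)
  case (insert w1 W)
  define S where "S = \<Union>{T. \<exists>w\<in>insert w1 W. z w T \<noteq> 0}"
  have S: "S \<subseteq> V"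
    using insert.prems(2) unfolding S_def by blast
  then have fin: "finite S"
    using assms(1) finite_subset by blast
  show ?case
  proof (rule ccontr)
    assume nz: "z w T \<noteq> 0"
    have "k > 0"
      using insert.prems(1) insert.hyps by auto
    then have "T \<noteq> {}"
      using insert.prems(2)[OF insert.prems(4) nz] by auto
    then have "S \<noteq> {}"
      using nz insert.prems(4) by (auto simp: S_def)
    define t where "t = Max S"
    have t: "t \<in> S"
      unfolding t_def by (rule Max_in[OF fin \<open>S \<noteq> {}\<close>])
    have top: "z u T = 0" if "u \<in> insert w1 W" "v \<in> T" "v > t" for u T v
    proof (rule ccontr)
      assume "z u T \<noteq> 0"
      then have "v \<in> S"
        using that by (auto simp: S_def)
      then show False
        using Max_ge[OF fin] that(3) unfolding t_def by fastforce
    qed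
    have w1: "z w1 (insert t T) = 0" if "t \<notin> T" for T
    proof (cases "T \<subseteq> V")
      case False
      then show ?thesis
        using insert.prems(2)[of w1 "insert t T"] by auto
    next
      case True
      \<comment> \<open>A pair with sum t + w1 and u < w1 has v > t, and no support contains such
        v.\<close>
      have "(if v + u = t + w1 then sg v T (z u (insert v T)) else 0) =
          (if v = t \<and> u = w1 then sg v T (z u (insert v T)) else 0)" if "u \<in> insert w1 W" for v u
      proof (cases "v + u = t + w1 \<and> \<not> (v = t \<and> u = w1)")
        case *: True
        then have "u \<noteq> w1"
          by auto
        then have "u < w1"
          using that insert.hyps by auto
        then have "v > t"
          using * add_le_less_mono[of v t u w1] by (metis less_irrefl not_le)
        then show ?thesis
          using top[OF that, of v "insert v T"] by auto
      qed auto
      then have "(\<Sum>v\<in>V - T. \<Sum>u\<in>insert w1 W. if v + u = t + w1 then sg v T (z u (insert v T)) else 0) =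
          (\<Sum>v\<in>V - T. \<Sum>u\<in>insert w1 W. if v = t \<and> u = w1 then sg v T (z u (insert v T)) else 0)"
        by (intro sum.cong) auto
      also have "\<dots> = (\<Sum>v\<in>V - T. if v = t then sg v T (z w1 (insert v T)) else 0)"
        using insert.hyps by (intro sum.cong refl) (auto simp: sum.delta)
      also have "\<dots> = sg t T (z w1 (insert t T))"
        using assms(1) that t S by (simp add: sum.delta subset_iff)
      finally show ?thesis
        using insert.prems(3)[OF True, of "t + w1"] by simp
    qed
    define y where "y u T = (if t \<in> T then 0 else sg t T (z u (insert t T)))" for u T
    \<comment> \<open>Contraction with \<open>t\<close> lowers \<open>k\<close> by one. As it
      vanishes at \<open>w1\<close>, the set of values shrinks by one too, so the inequality between
      cardinality and degree persists.\<close>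
    have "y u T = 0" if u: "u \<in> W" for u T
    proof (rule insert.IH[of "k - 1"])
      show "card W \<le> k - 1"
        using insert.prems(1) insert.hyps by auto
      show "T \<subseteq> V \<and> card T = k - 1" if "u \<in> W" "y u T \<noteq> 0" for u T
      proof -
        have *: "t \<notin> T" "z u (insert t T) \<noteq> 0"
          using that(2) by (auto simp: y_def split: if_splits)
        then have "insert t T \<subseteq> V" "card (insert t T) = k"
          using insert.prems(2)[of u "insert t T"] that(1) by auto
        moreover have "finite T"
          using \<open>insert t T \<subseteq> V\<close> assms(1) finite_subset by auto
        ultimately show ?thesis
          using *(1) by auto
      qed
      fix T r assume T: "T \<subseteq> V"
      show "(\<Sum>v\<in>V - T. \<Sum>u\<in>W. if v + u = r then sg v T (y u (insert v T)) else 0) = 0"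
      proof (cases "t \<in> T")
        case True
        then show ?thesis
          by (simp add: y_def cong: if_cong)
      next
        case False
        have finT: "finite T"
          using T assms(1) finite_subset by blast
        have "(\<Sum>v\<in>V - T. \<Sum>u\<in>W. if v + u = r then sg v T (y u (insert v T)) else 0) =
            (\<Sum>v\<in>V - insert t T. \<Sum>u\<in>W. if v + u = r then sg v T (y u (insert v T)) else 0)"
        proof (intro sum.mono_neutral_right ballI)
          fix v assume "v \<in> V - T - (V - insert t T)"
          then have "v = t"
            by auto
          then have "y u (insert v T) = 0" for u
            by (simp add: y_def)
          then show "(\<Sum>u\<in>W. if v + u = r then sg v T (y u (insert v T)) else 0) = 0"
            by (simp cong: if_cong)
        qed (use assms(1) in auto)
        also have "\<dots> = (\<Sum>v\<in>V - insert t T. \<Sum>u\<in>insert w1 W.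
            - sg t T (if v + u = r then sg v (insert t T) (z u (insert v (insert t T))) else 0))"
        proof (rule sum.cong[OF refl])
          fix v assume v: "v \<in> V - insert t T"
          \<comment> \<open>The vanishing at \<open>w1\<close> allows that value back into the sum,
            which becomes the cycle condition for \<open>z\<close> at
            \<open>insert t T\<close>.\<close>
          have "z w1 (insert v (insert t T)) = 0"
            using w1[of "insert v T"] v False by (auto simp: insert_commute)
          moreover have "w1 \<notin> W"
            using insert.hyps by auto
          moreover have "sg v T (y u (insert v T)) =
              - sg t T (sg v (insert t T) (z u (insert v (insert t T))))" for u
            using v False finT sg_transpose[of T v t "z u (insert t (insert v T))"]
            by (auto simp: y_def insert_commute)
          ultimately show "(\<Sum>u\<in>W. if v + u = r then sg v T (y u (insert v T)) else 0) =
            (\<Sum>u\<in>insert w1 W. - sg t T (if v + u = r then sg v (insert t T) (z u (insert v (insert t T))) else 0))"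
            using insert.hyps(1) by (simp cong: if_cong) (auto intro!: sum.cong)
        qed
        also have "\<dots> = - sg t T (\<Sum>v\<in>V - insert t T. \<Sum>u\<in>insert w1 W.
            if v + u = r then sg v (insert t T) (z u (insert v (insert t T))) else 0)"
          by (simp add: sg_sum sum_negf)
        also have "\<dots> = 0"
        proof -
          have "insert t T \<subseteq> V"
            using T S t by auto
          then show ?thesis
            unfolding insert.prems(3)[OF \<open>insert t T \<subseteq> V\<close>] by simp
        qed
        finally show ?thesis .
      qed
    qed (rule u)
    \<comment> \<open>So no support contains \<open>t\<close>, although \<open>t\<close> was taken
      from their union.\<close>
    then have "z u (insert t T) = 0" if "u \<in> insert w1 W" "t \<notin> T" for u T
      using that w1[of T] by (auto simp: y_def) (metis sg_eq_0_iff)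
    moreover obtain u T where "u \<in> insert w1 W" "z u T \<noteq> 0" "t \<in> T"
      using t by (auto simp: S_def)
    ultimately show False
      by (metis Diff_iff insert_Diff singletonI)
  qed
qed simp

section \<open>Truncated Veronese modules\<close>

lemma lookup_mono_op_add: "lookup (mono_op v p) (v + s) = lookup p s"
  by (simp add: mono_op_def)

lemma lookup_mono_op_outside: "(\<And>s. t \<noteq> v + s) \<Longrightarrow> lookup (mono_op v p) t = 0"
  by (simp add: mono_op_def lookup_single_mult_outside)

lemma lookup_mono_op:
  assumes "finite W" and "keys p \<subseteq> W"
  shows "lookup (mono_op v p) t = (\<Sum>w\<in>W. if v + w = t then lookup p w else 0)"
proof (cases "\<exists>s. t = v + s")
  case True
  then obtain s where s: "t = v + s"
    by blast
  have "(\<Sum>w\<in>W. if v + w = t then lookup p w else 0) = (\<Sum>w\<in>W. if w = s then lookup p w else 0)"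
    by (intro sum.cong) (auto simp: s)
  also have "\<dots> = lookup p s"
    using assms by (auto simp: sum.delta in_keys_iff)
  finally show ?thesis
    by (simp add: s lookup_mono_op_add)
next
  case False
  then have "(\<Sum>w\<in>W. if v + w = t then lookup p w else 0) = 0"
    by (intro sum.neutral) auto
  then show ?thesis
    using False by (simp add: lookup_mono_op_outside)
qed

lemma mono_op_commute: "mono_op v (mono_op w x) = mono_op w (mono_op v x)"
  by (simp add: mono_op_def mult.left_commute)

lemma mono_op_add: "mono_op v (x + y) = mono_op v x + mono_op v y"
  by (simp add: mono_op_def algebra_simps)

lemma mono_op_homog:
  assumes "v \<in> mons n c" and "x \<in> homog n d"
  shows "mono_op v x \<in> homog n (int c + d)"
  unfolding mono_op_def using assms by (intro homog_mult homog_single) (auto simp: mons_def)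

definition trunc :: "nat \<Rightarrow> nat \<Rightarrow> (nat \<Rightarrow>\<^sub>0 nat) \<Rightarrow> bool"
  where "trunc c r t \<longleftrightarrow> (\<forall>l<r. lookup t l < c)"

text \<open>The module \<Oplus>_j S_{jc+e} in three variables modulo X_l^c for l < r, realised by
  its truncated monomials. The twist e = 0 gives the Veronese ring and e = -3 its canonical module,
  whose component of degree 1 is W.\<close>

definition vmod :: "nat \<Rightarrow> int \<Rightarrow> nat \<Rightarrow> int \<Rightarrow> 'k::field mpoly set"
  where "vmod c e r j = {p \<in> homog 3 (j * int c + e). \<forall>t. lookup p t \<noteq> 0 \<longrightarrow> trunc c r t}"

definition vop :: "nat \<Rightarrow> nat \<Rightarrow> (nat \<Rightarrow>\<^sub>0 nat) \<Rightarrow> 'k::field mpoly \<Rightarrow> 'k mpoly"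
  where "vop c r v x = pfilt (trunc c r) (mono_op v x)"

definition vgens :: "nat \<Rightarrow> nat \<Rightarrow> (nat \<Rightarrow>\<^sub>0 nat) set"
  where "vgens c r = mons 3 c - (\<lambda>l. Poly_Mapping.single l c) ` {..<r}"

lemma trunc_add: "trunc c r (s + t) \<Longrightarrow> trunc c r t"
  by (auto simp: trunc_def lookup_add)

lemma trunc_Suc: "trunc c (Suc r) t \<longleftrightarrow> trunc c r t \<and> lookup t r < c"
  by (auto simp: trunc_def less_Suc_eq)

lemma pfilt_add: "pfilt P (x + y) = pfilt P x + pfilt P (y :: 'a \<Rightarrow>\<^sub>0 'b::monoid_add)"
  by (rule poly_mapping_eqI) (simp add: lookup_pfilt lookup_add)

text \<open>The monomials that violate \<open>trunc\<close> span an ideal, so what is dropped before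
  the multiplication would be dropped after it.\<close>

lemma pfilt_trunc_mono_op: "pfilt (trunc c r) (mono_op v (pfilt (trunc c r) x)) = pfilt (trunc c r) (mono_op v x)"
proof (rule poly_mapping_eqI)
  fix t
  show "lookup (pfilt (trunc c r) (mono_op v (pfilt (trunc c r) x))) t =
    lookup (pfilt (trunc c r) (mono_op v x)) t"
  proof (cases "\<exists>s. t = v + s")
    case True
    then obtain s where "t = v + s"
      by blast
    then show ?thesis
      using trunc_add[of c r v s] by (auto simp: lookup_pfilt lookup_mono_op_add)
  next
    case False
    then show ?thesis
      by (simp add: lookup_pfilt lookup_mono_op_outside)
  qed
qed

lemma vmod_ops: "graded_ops (vgens c r) (vop c r) (vmod c e r :: int \<Rightarrow> 'k::field mpoly set)"
proof
  show "finite (vgens c r)"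
    by (simp add: vgens_def finite_mons)
  fix v w x y j
  show "vop c r v (x + y) = vop c r v x + vop c r v y"
    by (simp add: vop_def mono_op_add pfilt_add)
  show "vop c r v (vop c r w x) = vop c r w (vop c r v x)"
    unfolding vop_def pfilt_trunc_mono_op mono_op_commute[of v w] ..
  show "0 \<in> vmod c e r j"
    by (simp add: vmod_def)
next
  fix x y :: "'k mpoly" and j
  assume xy: "x \<in> vmod c e r j" "y \<in> vmod c e r j"
  then have "x - y \<in> homog 3 (j * int c + e)"
    by (auto simp: vmod_def intro: homog_diff)
  moreover have "trunc c r t" if "lookup (x - y) t \<noteq> 0" for t
  proof -
    have "lookup x t \<noteq> 0 \<or> lookup y t \<noteq> 0"
      using that by (auto simp: lookup_minus)
    then show ?thesis
      using xy unfolding vmod_def by blast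
  qed
  ultimately show "x - y \<in> vmod c e r j"
    unfolding vmod_def by blast
next
  fix v and x :: "'k mpoly" and j
  assume v: "v \<in> vgens c r" and x: "x \<in> vmod c e r j"
  have "mono_op v x \<in> homog 3 (int c + (j * int c + e))"
    using v x by (intro mono_op_homog) (auto simp: vgens_def vmod_def)
  then show "vop c r v x \<in> vmod c e r (j + 1)"
    by (auto simp: vmod_def vop_def homog_iff lookup_pfilt algebra_simps)
qed

text \<open>Multiplication by X_r^c leaves the exponents at l < r alone. So it stays injective
  modulo the earlier powers, and its image consists of the terms whose exponent at \<open>r\<close>
  is at least \<open>c\<close>.\<close>

lemma vmod_regular:
  assumes "r < 3" and "c > 0"
  shows "regular_op (Poly_Mapping.single r c) (vgens c (Suc r)) (vop c r)
    (vmod c e r :: int \<Rightarrow> 'k::field mpoly set) (vop c (Suc r)) (vmod c e (Suc r)) (pfilt (trunc c (Suc r)))"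
    and "insert (Poly_Mapping.single r c) (vgens c (Suc r)) = vgens c r"
proof -
  let ?w = "Poly_Mapping.single r c" and ?\<pi> = "pfilt (trunc c (Suc r)) :: 'k mpoly \<Rightarrow> 'k mpoly"
  have "?w \<in> mons 3 c"
    using assms by (auto simp: mons_def)
  moreover have "?w \<notin> (\<lambda>l. Poly_Mapping.single l c) ` {..<r}"
  proof
    assume "?w \<in> (\<lambda>l. Poly_Mapping.single l c) ` {..<r}"
    then obtain l where l: "l < r" "?w = Poly_Mapping.single l c"
      by auto
    then have "keys ?w = keys (Poly_Mapping.single l c)"
      by simp
    then show False
      using l(1) assms(2) by simp
  qed
  ultimately show ins: "insert ?w (vgens c (Suc r)) = vgens c r"
    by (auto simp: vgens_def lessThan_Suc)
  show "regular_op ?w (vgens c (Suc r)) (vop c r) (vmod c e r :: int \<Rightarrow> 'k mpoly set)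
    (vop c (Suc r)) (vmod c e (Suc r)) ?\<pi>"
    unfolding regular_op_def
  proof (intro conjI)
    show "graded_ops_insert ?w (vgens c (Suc r)) (vop c r) (vmod c e r :: int \<Rightarrow> 'k mpoly set)"
    proof (rule graded_ops_insert.intro)
      show "graded_ops (insert ?w (vgens c (Suc r))) (vop c r) (vmod c e r :: int \<Rightarrow> 'k mpoly set)"
        unfolding ins by (rule vmod_ops)
      show "graded_ops_insert_axioms ?w (vgens c (Suc r))"
        by (rule graded_ops_insert_axioms.intro) (auto simp: vgens_def)
    qed
    show "graded_ops (vgens c (Suc r)) (vop c (Suc r)) (vmod c e (Suc r) :: int \<Rightarrow> 'k mpoly set)"
      by (rule vmod_ops)
    show "regular_op_axioms ?w (vgens c (Suc r)) (vop c r) (vmod c e r) (vop c (Suc r))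
      (vmod c e (Suc r)) ?\<pi>"
    proof
      fix x y :: "'k mpoly" and v j
      show "?\<pi> (x + y) = ?\<pi> x + ?\<pi> y"
        by (rule pfilt_add)
      show "?\<pi> (vop c r v x) = vop c (Suc r) v (?\<pi> x)"
        unfolding vop_def pfilt_trunc_mono_op
        by (rule poly_mapping_eqI) (simp add: lookup_pfilt trunc_Suc)
      show "?\<pi> ` vmod c e r j = vmod c e (Suc r) j"
      proof (intro equalityI subsetI)
        fix p :: "'k mpoly" assume p: "p \<in> vmod c e (Suc r) j"
        then have "?\<pi> p = p"
          by (intro poly_mapping_eqI) (auto simp: lookup_pfilt vmod_def)
        moreover have "p \<in> vmod c e r j"
          using p by (auto simp: vmod_def trunc_Suc)
        ultimately show "p \<in> ?\<pi> ` vmod c e r j"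
          by (metis imageI)
      qed (auto simp: vmod_def homog_iff lookup_pfilt split: if_splits)
      show "?\<pi> (vop c r ?w x) = 0"
      proof (rule poly_mapping_eqI)
        fix t
        show "lookup (?\<pi> (vop c r ?w x)) t = lookup 0 t"
        proof (cases "\<exists>s. t = ?w + s")
          case True
          then have "\<not> trunc c (Suc r) t"
            by (auto simp: trunc_Suc lookup_add)
          then show ?thesis
            by (simp add: lookup_pfilt)
        next
          case False
          then show ?thesis
            by (simp add: vop_def lookup_pfilt lookup_mono_op_outside)
        qed
      qed
      have tr: "trunc c r (?w + s) \<longleftrightarrow> trunc c r s" for s
        by (auto simp: trunc_def lookup_add lookup_single when_def)
      show "x = 0" if x: "x \<in> vmod c e r j" and "vop c r ?w x = 0"
      proof (rule poly_mapping_eqI)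
        fix s
        have "lookup (vop c r ?w x) (?w + s) = 0"
          using that(2) by simp
        then show "lookup x s = lookup 0 s"
          using x tr by (auto simp: vop_def lookup_pfilt lookup_mono_op_add vmod_def split: if_splits)
      qed
      show "\<exists>y\<in>vmod c e r (j - 1). x = vop c r ?w y" if x: "x \<in> vmod c e r j" and "?\<pi> x = 0"
      proof
        let ?y = "Poly_Mapping.map_key ((+) ?w) x"
        have inj: "inj ((+) ?w)"
          by (auto intro: injI)
        have y: "lookup ?y s = lookup x (?w + s)" for s
          by (simp add: map_key.rep_eq[OF inj])
        have high: "c \<le> lookup t r" if "lookup x t \<noteq> 0" for t
        proof (rule ccontr)
          assume "\<not> c \<le> lookup t r"
          then have "trunc c (Suc r) t"
            using x that by (auto simp: trunc_Suc vmod_def)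
          then have "lookup (?\<pi> x) t = lookup x t"
            by (simp add: lookup_pfilt)
          then show False
            using \<open>?\<pi> x = 0\<close> that by simp
        qed
        have split: "t = ?w + (t - ?w)" if "c \<le> lookup t r" for t
          by (rule poly_mapping_eqI) (use that in \<open>auto simp: lookup_add lookup_minus lookup_single when_def\<close>)
        show "x = vop c r ?w ?y"
        proof (rule poly_mapping_eqI)
          fix t
          show "lookup x t = lookup (vop c r ?w ?y) t"
          proof (cases "\<exists>s. t = ?w + s")
            case True
            then obtain s where s: "t = ?w + s"
              by blast
            have "lookup x t = 0" if "\<not> trunc c r t"
              using x that by (auto simp: vmod_def)
            then show ?thesis
              unfolding s by (auto simp: vop_def lookup_pfilt lookup_mono_op_add y)
          next
            case False
            then have "lookup x t = 0"
              using high[of t] split[of t] by blast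
            then show ?thesis
              using False by (simp add: vop_def lookup_pfilt lookup_mono_op_outside)
          qed
        qed
        have "keys s \<subseteq> {..<3} \<and> int (mon_degree s) = (j - 1) * int c + e \<and> trunc c r s"
          if "lookup x (?w + s) \<noteq> 0" for s
        proof -
          have "keys (?w + s) \<subseteq> {..<3}" "int (mon_degree (?w + s)) = j * int c + e" "trunc c r (?w + s)"
            using x that by (auto simp: vmod_def homog_iff)
          then show ?thesis
            using tr by (auto simp: keys_add_nat mon_degree_add algebra_simps)
        qed
        then show "?y \<in> vmod c e r (j - 1)"
          unfolding vmod_def homog_iff mem_Collect_eq y by blast
      qed
    qed
  qed
qed

lemma kexact_untruncate:
  assumes "c > 0" and "kexact (vgens c 3) (vop c 3) (vmod c e 3 :: int \<Rightarrow> 'k::field mpoly set) k j"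
  shows "kexact (vgens c 0) (vop c 0) (vmod c e 0 :: int \<Rightarrow> 'k mpoly set) k j"
proof -
  have step: "kexact (vgens c r) (vop c r) (vmod c e r :: int \<Rightarrow> 'k mpoly set) k j"
    if "r < 3" "kexact (vgens c (Suc r)) (vop c (Suc r)) (vmod c e (Suc r) :: int \<Rightarrow> 'k mpoly set) k j" for r
    using regular_op.kexact_quotientD[OF vmod_regular(1)[OF that(1) assms(1)] that(2)]
    unfolding vmod_regular(2)[OF that(1) assms(1)] .
  show ?thesis
    using step[of 0] step[of 1] step[of 2] assms(2) by (simp add: numeral_2_eq_2 numeral_3_eq_3)
qed

text \<open>The lift is prescribed only on sets of truncated generators; each of the three steps
  adds values on sets that contain X_r^c.\<close>

lemma lift_truncated_cycle:
  assumes "c > 0" and "f \<in> chain (vgens c 3) k (vmod c e 3 j :: 'k::field mpoly set)"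
    and "kd (vgens c 3) (vop c 3) f = (\<lambda>_. 0)"
  obtains g where "g \<in> chain (vgens c 0) k (vmod c e 0 j)" and "kd (vgens c 0) (vop c 0) g = (\<lambda>_. 0)"
    and "\<And>T. T \<subseteq> vgens c 3 \<Longrightarrow> pfilt (trunc c 3) (g T) = f T"
proof -
  have sub: "vgens c (Suc r) \<subseteq> vgens c r" for r
    by (auto simp: vgens_def)
  have step: "\<exists>g. g \<in> chain (vgens c r) k (vmod c e r j) \<and> kd (vgens c r) (vop c r) g = (\<lambda>_. 0) \<and>
      (\<forall>T\<subseteq>vgens c 3. pfilt (trunc c 3) (g T) = f T)"
    if r: "r < 3" and g: "\<exists>g. g \<in> chain (vgens c (Suc r)) k (vmod c e (Suc r) j) \<and>
      kd (vgens c (Suc r)) (vop c (Suc r)) g = (\<lambda>_. 0) \<and>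
      (\<forall>T\<subseteq>vgens c 3. pfilt (trunc c 3) (g T) = f T)" for r
  proof -
    interpret regular_op "Poly_Mapping.single r c" "vgens c (Suc r)" "vop c r"
      "vmod c e r :: int \<Rightarrow> 'k mpoly set" "vop c (Suc r)" "vmod c e (Suc r)" "pfilt (trunc c (Suc r))"
      by (rule vmod_regular(1)[OF r assms(1)])
    obtain g where g: "g \<in> chain (vgens c (Suc r)) k (vmod c e (Suc r) j)"
      "kd (vgens c (Suc r)) (vop c (Suc r)) g = (\<lambda>_. 0)"
      "\<forall>T\<subseteq>vgens c 3. pfilt (trunc c 3) (g T) = f T"
      using g by blast
    obtain h where h: "h \<in> chain (vgens c r) k (vmod c e r j)" "kd (vgens c r) (vop c r) h = (\<lambda>_. 0)"
      "\<And>T. T \<subseteq> vgens c (Suc r) \<Longrightarrow> pfilt (trunc c (Suc r)) (h T) = g T"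
      using lift_cycle[OF g(1,2)] unfolding vmod_regular(2)[OF r assms(1)] by blast
    have "pfilt (trunc c 3) (h T) = f T" if T: "T \<subseteq> vgens c 3" for T
    proof -
      have "vgens c 3 \<subseteq> vgens c (Suc r)"
        using r by (auto simp: vgens_def)
      then have "pfilt (trunc c 3) (pfilt (trunc c (Suc r)) (h T)) = f T"
        using h(3)[of T] g(3) T by auto
      moreover have "pfilt (trunc c 3) (pfilt (trunc c (Suc r)) (h T)) = pfilt (trunc c 3) (h T)"
        by (rule poly_mapping_eqI) (use r in \<open>auto simp: lookup_pfilt trunc_def\<close>)
      ultimately show ?thesis
        by simp
    qed
    then show ?thesis
      using h(1,2) by blast
  qed
  have "pfilt (trunc c 3) (f T) = f T" for T
  proof (rule poly_mapping_eqI)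
    fix t
    have "f T \<in> vmod c e 3 j"
      using chain_mem[OF assms(2)] by (simp add: vmod_def)
    then show "lookup (pfilt (trunc c 3) (f T)) t = lookup (f T) t"
      by (auto simp: lookup_pfilt vmod_def)
  qed
  then have "\<exists>g. g \<in> chain (vgens c 3) k (vmod c e 3 j) \<and> kd (vgens c 3) (vop c 3) g = (\<lambda>_. 0) \<and>
      (\<forall>T\<subseteq>vgens c 3. pfilt (trunc c 3) (g T) = f T)"
    using assms(2,3) by blast
  then have "\<exists>g. g \<in> chain (vgens c 0) k (vmod c e 0 j) \<and> kd (vgens c 0) (vop c 0) g = (\<lambda>_. 0) \<and>
      (\<forall>T\<subseteq>vgens c 3. pfilt (trunc c 3) (g T) = f T)"
    using step[of 2] step[of 1] step[of 0] by (simp add: numeral_2_eq_2 numeral_3_eq_3)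
  then show ?thesis
    using that by blast
qed

lemma vgens_0: "vgens c 0 = mons 3 c"
  by (simp add: vgens_def)

lemma vop_0: "vop c 0 = mono_op"
  by (auto simp: fun_eq_iff vop_def lookup_pfilt trunc_def intro!: poly_mapping_eqI)

lemma vmod_0: "vmod c e 0 j = homog 3 (j * int c + e)"
  by (auto simp: vmod_def trunc_def)

lemma vmod_0_veronese: "vmod c 0 0 = veronese 3 c"
  by (auto simp: fun_eq_iff vmod_0 veronese_def)

section \<open>Monomials in three variables\<close>

definition tri :: "nat \<Rightarrow> nat \<Rightarrow> nat \<Rightarrow> (nat \<Rightarrow>\<^sub>0 nat)"
  where "tri a b e = Poly_Mapping.single 0 a + Poly_Mapping.single 1 b + Poly_Mapping.single 2 e"

lemma lookup_tri: "lookup (tri a b e) l = (if l = 0 then a else if l = 1 then b else if l = 2 then e else 0)"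
  by (auto simp: tri_def lookup_add lookup_single when_def)

lemma tri_eq_iff: "tri a b e = tri a' b' e' \<longleftrightarrow> a = a' \<and> b = b' \<and> e = e'"
proof
  assume eq: "tri a b e = tri a' b' e'"
  have "lookup (tri a b e) l = lookup (tri a' b' e') l" for l
    by (simp add: eq)
  from this[of 0] this[of 1] this[of 2] show "a = a' \<and> b = b' \<and> e = e'"
    by (simp add: lookup_tri)
qed simp

lemma tri_add: "tri a b e + tri a' b' e' = tri (a + a') (b + b') (e + e')"
  by (rule poly_mapping_eqI) (simp add: lookup_add lookup_tri)

lemma mon_degree_tri: "mon_degree (tri a b e) = a + b + e"
  by (simp add: tri_def mon_degree_add)

lemma tri_mons: "tri a b e \<in> mons 3 d \<longleftrightarrow> a + b + e = d"
  by (auto simp: mons_def mon_degree_tri in_keys_iff lookup_tri split: if_splits)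

lemma mons_3_cases:
  assumes "t \<in> mons 3 d"
  obtains a b e where "t = tri a b e" and "a + b + e = d"
proof -
  have "lookup t l = 0" if "l \<noteq> 0" "l \<noteq> 1" "l \<noteq> 2" for l
  proof (rule ccontr)
    assume "lookup t l \<noteq> 0"
    then have "l < 3"
      using assms by (auto simp: mons_def in_keys_iff subset_iff)
    then show False
      using that by linarith
  qed
  then have "t = tri (lookup t 0) (lookup t 1) (lookup t 2)"
    by (intro poly_mapping_eqI) (simp add: lookup_tri)
  then show ?thesis
    using that assms tri_mons by metis
qed

lemma trunc_tri: "trunc c 3 (tri a b e) \<longleftrightarrow> a < c \<and> b < c \<and> e < c"
proof
  assume "trunc c 3 (tri a b e)"
  then have "lookup (tri a b e) 0 < c" "lookup (tri a b e) 1 < c" "lookup (tri a b e) 2 < c"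
    by (auto simp: trunc_def)
  then show "a < c \<and> b < c \<and> e < c"
    by (simp add: lookup_tri)
qed (auto simp: trunc_def lookup_tri)

lemma vgens_3:
  assumes "c > 0"
  shows "vgens c 3 = {t \<in> mons 3 c. trunc c 3 t}"
proof -
  have singles: "Poly_Mapping.single 0 c = tri c 0 0" "Poly_Mapping.single 1 c = tri 0 c 0"
    "Poly_Mapping.single 2 c = tri 0 0 c"
    by (auto simp: lookup_tri lookup_single when_def intro!: poly_mapping_eqI)
  have set: "{..<3} = {0, 1, 2 :: nat}"
    by auto
  show ?thesis
  proof (intro equalityI subsetI)
    fix t assume t: "t \<in> vgens c 3"
    then have "t \<in> mons 3 c"
      by (simp add: vgens_def)
    then obtain a b e where "t = tri a b e" "a + b + e = c"
      by (rule mons_3_cases)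
    then show "t \<in> {t \<in> mons 3 c. trunc c 3 t}"
      using t unfolding vgens_def set by (auto simp: singles[unfolded One_nat_def] singles trunc_tri tri_eq_iff)
  next
    fix t assume t: "t \<in> {t \<in> mons 3 c. trunc c 3 t}"
    then obtain a b e where "t = tri a b e" "a + b + e = c"
      using mons_3_cases[of t c] by auto
    then show "t \<in> vgens c 3"
      using t unfolding vgens_def set by (auto simp: singles[unfolded One_nat_def] singles trunc_tri tri_eq_iff)
  qed
qed

text \<open>The socle monomial of \<open>K[X\<^sub>0, X\<^sub>1, X\<^sub>2] / (X\<^sub>0\<^sup>c, X\<^sub>1\<^sup>c, X\<^sub>2\<^sup>c)\<close>.\<close>

definition socle :: "nat \<Rightarrow> (nat \<Rightarrow>\<^sub>0 nat)"
  where "socle c = tri (c - 1) (c - 1) (c - 1)"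

text \<open>Complementary exponents: the coefficient of the socle monomial pairs truncated monomials
  of degrees d and 3c - 3 - d. It serves for degree 2c against c - 3, and for c against 2c -
  3.\<close>

lemma socle_complement:
  assumes "t \<in> mons 3 d" and "trunc c 3 t"
  obtains s where "s \<in> mons 3 (3 * c - 3 - d)" and "trunc c 3 s" and "socle c = t + s"
proof -
  obtain a b e where t: "t = tri a b e" "a + b + e = d"
    using assms(1) by (rule mons_3_cases)
  let ?s = "tri (c - 1 - a) (c - 1 - b) (c - 1 - e)"
  have "a < c" "b < c" "e < c"
    using assms(2) by (auto simp: t(1) trunc_tri)
  then have "?s \<in> mons 3 (3 * c - 3 - d)" "trunc c 3 ?s" "socle c = t + ?s"
    using t(2) by (auto simp: tri_mons t(1) socle_def tri_add tri_eq_iff trunc_tri)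
  then show ?thesis
    using that by blast
qed

lemma trunc_of_socle:
  assumes "c > 0" and "socle c = t + s"
  shows "trunc c 3 t"
  unfolding trunc_def
proof (intro allI impI)
  fix l :: nat assume "l < 3"
  then have "l = 0 \<or> l = 1 \<or> l = 2"
    by linarith
  then have "lookup (socle c) l = c - 1"
    by (auto simp: socle_def lookup_tri)
  then show "lookup t l < c"
    using assms by (auto simp: lookup_add)
qed

lemma inner_mons_subset: "c \<ge> 3 \<Longrightarrow> (+) (tri 1 1 1) ` mons 3 (c - 3) \<subseteq> vgens c 3"
proof
  fix t assume c: "c \<ge> 3" and "t \<in> (+) (tri 1 1 1) ` mons 3 (c - 3)"
  then obtain w where w: "w \<in> mons 3 (c - 3)" "t = tri 1 1 1 + w"
    by blast
  obtain a b e where "w = tri a b e" "a + b + e = c - 3"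
    using w(1) by (rule mons_3_cases)
  then show "t \<in> vgens c 3"
    using w(2) c by (auto simp: vgens_3 tri_add tri_mons trunc_tri)
qed

text \<open>The monomials of degree \<open>c\<close> in exactly two variables: the sides of the
  triangle of exponents without its corners.\<close>

definition outer_mons :: "nat \<Rightarrow> (nat \<Rightarrow>\<^sub>0 nat) set"
  where "outer_mons c = vgens c 3 - (+) (tri 1 1 1) ` mons 3 (c - 3)"

lemma card_outer_mons:
  assumes "c \<ge> 3"
  shows "card (outer_mons c) = 3 * c - 3"
proof -
  let ?A = "(\<lambda>a. tri a (c - a) 0) ` {1..<c}"
  let ?B = "(\<lambda>a. tri 0 a (c - a)) ` {1..<c}"
  let ?C = "(\<lambda>a. tri (c - a) 0 a) ` {1..<c}"
  have "outer_mons c = ?A \<union> (?B \<union> ?C)"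
  proof (intro equalityI subsetI)
    fix t assume "t \<in> outer_mons c"
    then have t: "t \<in> mons 3 c" "trunc c 3 t" "t \<notin> (+) (tri 1 1 1) ` mons 3 (c - 3)"
      using assms by (auto simp: outer_mons_def vgens_3)
    obtain a b e where abe: "t = tri a b e" "a + b + e = c"
      using t(1) by (rule mons_3_cases)
    have less: "a < c" "b < c" "e < c"
      using t(2) by (auto simp: abe(1) trunc_tri)
    have "a = 0 \<or> b = 0 \<or> e = 0"
    proof (rule ccontr)
      assume "\<not> (a = 0 \<or> b = 0 \<or> e = 0)"
      then have "t = tri 1 1 1 + tri (a - 1) (b - 1) (e - 1)" "tri (a - 1) (b - 1) (e - 1) \<in> mons 3 (c - 3)"
        using abe by (auto simp: tri_add tri_eq_iff tri_mons)
      then show False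
        using t(3) by blast
    qed
    then consider "a = 0" | "b = 0" | "e = 0"
      by blast
    then show "t \<in> ?A \<union> (?B \<union> ?C)"
    proof cases
      case 1
      then have "t = tri 0 b (c - b)" "b \<in> {1..<c}"
        using abe less by (auto simp: tri_eq_iff)
      then show ?thesis
        by blast
    next
      case 2
      then have "t = tri (c - e) 0 e" "e \<in> {1..<c}"
        using abe less by (auto simp: tri_eq_iff)
      then show ?thesis
        by blast
    next
      case 3
      then have "t = tri a (c - a) 0" "a \<in> {1..<c}"
        using abe less by (auto simp: tri_eq_iff)
      then show ?thesis
        by blast
    qed
  next
    fix t assume t: "t \<in> ?A \<union> (?B \<union> ?C)"
    then obtain a b e where abe: "t = tri a b e" "a + b + e = c" "a < c" "b < c" "e < c"
      "a = 0 \<or> b = 0 \<or> e = 0"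
      by auto
    have "t \<notin> (+) (tri 1 1 1) ` mons 3 (c - 3)"
    proof
      assume "t \<in> (+) (tri 1 1 1) ` mons 3 (c - 3)"
      then obtain w where w: "w \<in> mons 3 (c - 3)" "t = tri 1 1 1 + w"
        by blast
      obtain a' b' e' where "w = tri a' b' e'"
        using w(1) by (rule mons_3_cases)
      then show False
        using w(2) abe(1,6) by (auto simp: tri_add tri_eq_iff)
    qed
    then show "t \<in> outer_mons c"
      using abe assms by (auto simp: outer_mons_def vgens_3 tri_mons trunc_tri)
  qed
  moreover have "card ?A = c - 1" "card ?B = c - 1" "card ?C = c - 1"
    by (auto simp: card_image inj_on_def tri_eq_iff)
  moreover have "?A \<inter> (?B \<union> ?C) = {}" "?B \<inter> ?C = {}"
    by (auto simp: tri_eq_iff)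
  ultimately show ?thesis
    using assms by (simp add: card_Un_disjoint)
qed

lemma finite_vgens: "finite (vgens c r)"
  by (simp add: vgens_def finite_mons)

lemma inj_add: "inj_on ((+) (t :: nat \<Rightarrow>\<^sub>0 nat)) A"
  by (auto intro: inj_onI)

lemma card_vgens:
  assumes "c \<ge> 3"
  shows "card (vgens c 3) = card (mons 3 (c - 3)) + (3 * c - 3)"
proof -
  have "card (vgens c 3) = card (outer_mons c) + card ((+) (tri 1 1 1) ` mons 3 (c - 3))"
    unfolding outer_mons_def
    using card_Diff_subset[OF finite_imageI[OF finite_mons] inner_mons_subset[OF assms]]
      card_mono[OF finite_vgens inner_mons_subset[OF assms]] by simp
  then show ?thesis
    by (simp add: card_outer_mons[OF assms] card_image[OF inj_add])
qed

section \<open>Linear functionals\<close>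

text \<open>A basis of S stays independent when f is added, so f can be sent to 1 and the basis to
  0. This turns a chain that is not a boundary into a cycle of the dual complex.\<close>

lemma separating_functional:
  fixes S :: "('e \<Rightarrow> 'k::field) set"
  assumes "(\<lambda>_. 0) \<in> S" and "\<And>x y. x \<in> S \<Longrightarrow> y \<in> S \<Longrightarrow> (\<lambda>e. x e + y e) \<in> S"
    and "\<And>a x. x \<in> S \<Longrightarrow> (\<lambda>e. a * x e) \<in> S" and "f \<notin> S"
  obtains L :: "('e \<Rightarrow> 'k) \<Rightarrow> 'k"
  where "\<And>x y. L (\<lambda>e. x e + y e) = L x + L y" and "\<And>a x. L (\<lambda>e. a * x e) = a * L x"
    and "\<And>x. x \<in> S \<Longrightarrow> L x = 0" and "L f = 1"
proof -
  interpret vector_space_pair "\<lambda>(a :: 'k) (x :: 'e \<Rightarrow> 'k) e. a * x e" "(*) :: 'k \<Rightarrow> 'k \<Rightarrow> 'k"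
    by unfold_locales (auto simp: algebra_simps fun_eq_iff)
  have sub: "vs1.subspace S"
    using assms(1-3) unfolding vs1.subspace_def by (auto simp: zero_fun_def plus_fun_def)
  obtain B where B: "B \<subseteq> S" "vs1.independent B" "S \<subseteq> vs1.span B"
    using vs1.maximal_independent_subset[of S] by blast
  have "vs1.span B \<subseteq> S"
    using B(1) sub by (rule vs1.span_minimal)
  then have "f \<notin> vs1.span B"
    using assms(4) by blast
  then have ind: "vs1.independent (insert f B)"
    using B(2) by (rule vs1.independent_insertI)
  obtain L where L: "Vector_Spaces.linear (\<lambda>(a :: 'k) (x :: 'e \<Rightarrow> 'k) e. a * x e) ((*) :: 'k \<Rightarrow> 'k \<Rightarrow> 'k) L"
    "\<forall>x\<in>insert f B. L x = (if x = f then 1 else 0)"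
    using linear_independent_extend[OF ind, of "\<lambda>x. if x = f then 1 else 0"] by blast
  have add: "L (\<lambda>e. x e + y e) = L x + L y" for x y
    using linear_add[OF L(1), of x y] by (simp add: plus_fun_def)
  have scale: "L (\<lambda>e. a * x e) = a * L x" for a x
    using linear_scale[OF L(1), of a x] .
  have "f \<notin> B"
    using B(1) assms(4) by blast
  then have "L x = 0" if "x \<in> B" for x
    using L(2) that by auto
  then have "L x = 0" if "x \<in> S" for x
    using linear_eq_0_on_span[OF L(1), of B x] B(3) that by blast
  moreover have "L f = 1"
    using L(2) by simp
  ultimately show ?thesis
    using that add scale by blast
qed

lemma lookup_sg: "lookup (sg v T x) t = sg v T (lookup x t)"
  by (simp add: sg_def)

lemma sg_scale: "sg v T (a * x) = a * sg v T (x :: 'a::ring)"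
  by (simp add: sg_def)

lemma lookup_Const_mult: "lookup (Const a * p) t = a * lookup p t"
  using lookup_single_mult_add[of 0 a p t] by (simp add: Const_def)

lemma vop_Const: "vop c r v (Const a * x) = Const a * vop c r v x"
  by (rule poly_mapping_eqI)
    (simp add: vop_def lookup_pfilt lookup_Const_mult mono_op_def mult.left_commute[of _ "Const a"])

lemma vop_single: "vop c r v (Poly_Mapping.single y 1) = (if trunc c r (v + y) then Poly_Mapping.single (v + y) 1 else 0)"
  by (rule poly_mapping_eqI) (auto simp: vop_def lookup_pfilt mono_op_def mult_single lookup_single when_def)

section \<open>Three variables: vanishing\<close>

text \<open>A chain that is not a boundary is separated from the boundaries by a functional L. The
  values of L on the elementary chains at (T, t), indexed by the complement of T and the partner of
  t in the socle pairing, form a cycle with values in W. Its lift vanishes, so L is zero on all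
  chains in question.\<close>

lemma kexact_truncated_2:
  assumes c: "c \<ge> 3" and k: "k \<le> 3 * c - 3"
  shows "kexact (vgens c 3) (vop c 3) (vmod c 0 3 :: int \<Rightarrow> 'k::field mpoly set) (int k) 2"
  unfolding kexact_def
proof (intro ballI impI)
  let ?U = "vgens c 3" and ?W = "mons 3 (c - 3)" and ?a = "vop c 3 :: _ \<Rightarrow> 'k mpoly \<Rightarrow> 'k mpoly"
  let ?X = "vmod c 0 3 :: int \<Rightarrow> 'k mpoly set"
  let ?\<kappa> = "socle c"
  interpret graded_ops ?U ?a ?X
    by (rule vmod_ops)
  fix f assume f: "f \<in> chain ?U (int k) (?X 2)"
  \<comment> \<open>Chains become scalar functions on pairs (T, t), as
    \<open>separating_functional\<close> expects.\<close>
  define F :: "((nat \<Rightarrow>\<^sub>0 nat) set \<Rightarrow> 'k mpoly) \<Rightarrow> (nat \<Rightarrow>\<^sub>0 nat) set \<times> (nat \<Rightarrow>\<^sub>0 nat) \<Rightarrow> 'k"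
    where "F h = (\<lambda>(T, t). lookup (h T) t)" for h
  define S where "S = {F (kd ?U ?a g) | g. g \<in> chain ?U (int k + 1) (?X 1)}"
  show "\<exists>g\<in>chain ?U (int k + 1) (?X (2 - 1)). kd ?U ?a g = f"
  proof (rule ccontr)
    assume no: "\<not> (\<exists>g\<in>chain ?U (int k + 1) (?X (2 - 1)). kd ?U ?a g = f)"
    have notin: "F f \<notin> S"
    proof
      assume "F f \<in> S"
      then obtain g where g: "g \<in> chain ?U (int k + 1) (?X 1)" "F f = F (kd ?U ?a g)"
        by (auto simp: S_def)
      have "kd ?U ?a g = f"
      proof (intro ext poly_mapping_eqI)
        fix T t
        show "lookup (kd ?U ?a g T) t = lookup (f T) t"
          using fun_cong[OF g(2), of "(T, t)"] by (simp add: F_def)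
      qed
      then show False
        using no g(1) by auto
    qed
    have S_zero: "(\<lambda>_. 0) \<in> S"
    proof -
      have "F (kd ?U ?a (\<lambda>_. 0)) \<in> S"
        unfolding S_def using chain_zero by blast
      then show ?thesis
        by (simp add: F_def split_def)
    qed
    have S_add: "(\<lambda>e. x e + y e) \<in> S" if xy: "x \<in> S" "y \<in> S" for x y
    proof -
      obtain g h where gh: "g \<in> chain ?U (int k + 1) (?X 1)" "x = F (kd ?U ?a g)"
        "h \<in> chain ?U (int k + 1) (?X 1)" "y = F (kd ?U ?a h)"
        using xy by (auto simp: S_def)
      have "(\<lambda>e. x e + y e) = F (kd ?U ?a (\<lambda>T. g T + h T))"
        by (auto simp: gh F_def kd_add lookup_add fun_eq_iff)
      moreover have "(\<lambda>T. g T + h T) \<in> chain ?U (int k + 1) (?X 1)"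
        using gh add_mem by (intro chain_add)
      ultimately show ?thesis
        unfolding S_def by blast
    qed
    have S_scale: "(\<lambda>e. r * x e) \<in> S" if x: "x \<in> S" for r x
    proof -
      obtain g where g: "g \<in> chain ?U (int k + 1) (?X 1)" "x = F (kd ?U ?a g)"
        using x by (auto simp: S_def)
      have "kd ?U ?a (\<lambda>T. Const r * g T) T = Const r * kd ?U ?a g T" for T
        by (simp add: kd_def vop_Const sg_scale sum_distrib_left)
      then have "(\<lambda>e. r * x e) = F (kd ?U ?a (\<lambda>T. Const r * g T))"
        by (auto simp: g F_def lookup_Const_mult fun_eq_iff)
      moreover have "Const r * y \<in> ?X 1" if "y \<in> ?X 1" for y
        using that Const_homog[of y 3 _ r] by (auto simp: vmod_def lookup_Const_mult)
      then have "(\<lambda>T. Const r * g T) \<in> chain ?U (int k + 1) (?X 1)"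
        using chain_map[OF g(1), of "(*) (Const r)" "?X 1"] by simp
      ultimately show ?thesis
        unfolding S_def by blast
    qed
    obtain L :: "(_ \<Rightarrow> 'k) \<Rightarrow> 'k" where
      L_add: "\<And>x y. L (\<lambda>e. x e + y e) = L x + L y" and L_scale: "\<And>a x. L (\<lambda>e. a * x e) = a * L x"
      and L_S: "\<And>x. x \<in> S \<Longrightarrow> L x = 0" and L_f: "L (F f) = 1"
      by (rule separating_functional[OF S_zero S_add S_scale notin]) (assumption | rule that)+
    have L_0: "L (\<lambda>_. 0) = 0"
      using L_scale[of 0 "\<lambda>_. 0"] by simp
    have L_sum: "L (\<lambda>e. \<Sum>v\<in>R. h v e) = (\<Sum>v\<in>R. L (h v))" if "finite R" for R :: "'b set" and h
      using that by induction (auto simp: L_0 L_add)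
    have L_sg: "L (\<lambda>e. sg v T (x e)) = sg v T (L x)" for v :: "nat \<Rightarrow>\<^sub>0 nat" and T x
      using L_scale[of "- 1" x] by (simp add: sg_def)
    define ind :: "(nat \<Rightarrow>\<^sub>0 nat) set \<times> (nat \<Rightarrow>\<^sub>0 nat) \<Rightarrow> _ \<Rightarrow> 'k"
      where "ind p = (\<lambda>e. if e = p then 1 else 0)" for p
    \<comment> \<open>L vanishes on the boundary of the elementary chain with value X^y at
      \<open>R\<close>. These equations will become the cycle condition in the dual complex.\<close>
    have star: "(\<Sum>v\<in>R. if trunc c 3 (v + y) then sg v (R - {v}) (L (ind (R - {v}, v + y))) else 0) = 0"
      if R: "R \<subseteq> ?U" "card R = k + 1" and y: "y \<in> mons 3 c" "trunc c 3 y" for R y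
    proof -
      define g where "g T = (if T = R then Poly_Mapping.single y 1 else 0 :: 'k mpoly)" for T
      have finR: "finite R"
        using R(1) finite_vgens finite_subset by blast
      have "Poly_Mapping.single y 1 \<in> ?X 1"
        using y by (auto simp: vmod_def mons_def lookup_single when_def intro!: homog_single)
      then have g: "g \<in> chain ?U (int k + 1) (?X 1)"
        using R by (auto simp: chain_def g_def zero_mem)
      have "F (kd ?U ?a g) e =
          (\<Sum>v\<in>R. if trunc c 3 (v + y) then sg v (R - {v}) (ind (R - {v}, v + y) e) else 0)" for e
      proof -
        obtain T t where e: "e = (T, t)"
          by (cases e)
        show ?thesis
        proof (cases "T \<subseteq> ?U")
          case False
          then have "ind (R - {v}, v + y) e = 0" for v
            using R(1) by (auto simp: ind_def e)
          then show ?thesis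
            using False by (simp add: e F_def kd_outside cong: if_cong)
        next
          case True
          have "F (kd ?U ?a g) e = (\<Sum>v\<in>?U - T. sg v T (lookup (?a v (g (insert v T))) t))"
            using True by (simp add: e F_def kd_def lookup_sum lookup_sg)
          also have "\<dots> = (\<Sum>v\<in>R. if trunc c 3 (v + y) then sg v (R - {v}) (ind (R - {v}, v + y) e) else 0)"
          proof (rule sum.mono_neutral_cong)
            show "finite R" "finite (?U - T)"
              using finR finite_vgens by auto
            fix v
            show "sg v T (lookup (?a v (g (insert v T))) t) = 0" if "v \<in> ?U - T - R"
            proof -
              have "insert v T \<noteq> R"
                using that by auto
              then show ?thesis
                using that by (simp add: g_def op_zero)
            qed
            show "(if trunc c 3 (v + y) then sg v (R - {v}) (ind (R - {v}, v + y) e) else 0) = 0"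
              if "v \<in> R - (?U - T)"
              using that R(1) by (auto simp: ind_def e)
            show "sg v T (lookup (?a v (g (insert v T))) t) =
                (if trunc c 3 (v + y) then sg v (R - {v}) (ind (R - {v}, v + y) e) else 0)"
              if v: "v \<in> (?U - T) \<inter> R"
            proof (cases "insert v T = R")
              case True
              then have "T = R - {v}"
                using v by auto
              then show ?thesis
                using True by (auto simp: g_def vop_single ind_def e lookup_single when_def)
            next
              case False
              then have "T \<noteq> R - {v}"
                using v by auto
              then show ?thesis
                using False v by (simp add: g_def op_zero ind_def e cong: if_cong)
            qed
          qed
          finally show ?thesis .
        qed
      qed
      then have "F (kd ?U ?a g) =
          (\<lambda>e. \<Sum>v\<in>R. if trunc c 3 (v + y) then sg v (R - {v}) (ind (R - {v}, v + y) e) else 0)"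
        by (rule ext)
      moreover have "F (kd ?U ?a g) \<in> S"
        using g unfolding S_def by blast
      ultimately have "L (\<lambda>e. \<Sum>v\<in>R. if trunc c 3 (v + y) then sg v (R - {v}) (ind (R - {v}, v + y) e) else 0) = 0"
        using L_S by simp
      moreover have "L (\<lambda>e. if trunc c 3 (v + y) then sg v (R - {v}) (ind (R - {v}, v + y) e) else 0) =
          (if trunc c 3 (v + y) then sg v (R - {v}) (L (ind (R - {v}, v + y))) else 0)" for v
        by (simp add: L_sg L_0)
      ultimately show ?thesis
        by (simp add: L_sum[OF finR])
    qed

    \<comment> \<open>The elements of \<open>?U\<close> below v are divided between
      \<open>R - {v}\<close> and the complement of \<open>R\<close>. Hence the product
      \<open>\<epsilon>\<close> of position parities converts the signs taken in
      \<open>R - {v}\<close> into those taken in the complement.\<close>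
    define \<chi> :: "(nat \<Rightarrow>\<^sub>0 nat) \<Rightarrow> 'k" where "\<chi> v = (if even (card {u \<in> ?U. u < v}) then 1 else - 1)" for v
    define \<epsilon> where "\<epsilon> T = (\<Prod>t\<in>T. \<chi> t)" for T
    have eps_nz: "\<epsilon> T \<noteq> 0" if "T \<subseteq> ?U" for T
    proof -
      have "finite T"
        using that finite_vgens finite_subset by blast
      then show ?thesis
        by (simp add: \<epsilon>_def \<chi>_def)
    qed
    have eps: "sg v (?U - R) (\<epsilon> (R - {v}) * x) = \<epsilon> R * sg v (R - {v}) x" if R: "R \<subseteq> ?U" "v \<in> R" for R v x
    proof -
      have finR: "finite R"
        using R(1) finite_vgens finite_subset by blast
      have "{u \<in> ?U. u < v} = {u \<in> ?U - R. u < v} \<union> {u \<in> R - {v}. u < v}"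
        using R by auto
      moreover have "card ({u \<in> ?U - R. u < v} \<union> {u \<in> R - {v}. u < v}) =
          card {u \<in> ?U - R. u < v} + card {u \<in> R - {v}. u < v}"
        using finR finite_vgens by (intro card_Un_disjoint) auto
      ultimately have "card {u \<in> ?U. u < v} = card {u \<in> ?U - R. u < v} + card {u \<in> R - {v}. u < v}"
        by simp
      moreover have "\<epsilon> R = \<chi> v * \<epsilon> (R - {v})"
        unfolding \<epsilon>_def using finR R(2) by (rule prod.remove)
      ultimately show ?thesis
        by (auto simp: sg_def \<chi>_def)
    qed

    \<comment> \<open>The bound on \<open>k\<close> enters here: \<open>?U\<close> has 3c - 3 more
      elements than \<open>?W\<close>, so at least \<open>card ?W\<close> of them remain in a
      complement.\<close>
    define K where "K = card ?U - k"
    have kU: "k \<le> card ?U" and WK: "card ?W \<le> K"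
      using k card_vgens[OF c] by (auto simp: K_def)
    \<comment> \<open>The value at w is read off at its socle partner, and the set is replaced by
      its complement; \<open>zc\<close> collects the scalars into a chain over the twist -3 in
      degree 1.\<close>
    define z where "z w T = (if T \<subseteq> ?U \<and> card T = K then \<epsilon> (?U - T) * L (ind (?U - T, ?\<kappa> - w)) else 0)" for w T
    define zc where "zc T = (\<Sum>w\<in>?W. Poly_Mapping.single w (z w T))" for T
    have lookup_zc: "lookup (zc T) w = (if w \<in> ?W then z w T else 0)" for T w
    proof -
      have "lookup (zc T) w = (\<Sum>u\<in>?W. if u = w then z u T else 0)"
        unfolding zc_def lookup_sum by (intro sum.cong) (auto simp: lookup_single when_def)
      then show ?thesis
        by (simp add: sum.delta finite_mons)
    qed
    have trunc_W: "trunc c 3 w" if "w \<in> ?W" for w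
      using that c by (elim mons_3_cases) (auto simp: trunc_tri)
    have "zc T \<in> vmod c (- 3) 3 1" for T
    proof -
      have "keys (zc T) \<subseteq> ?W"
        by (auto simp: in_keys_iff lookup_zc split: if_splits)
      then have "zc T \<in> homog 3 (int (c - 3))"
        by (simp add: homog_nat_iff)
      moreover have "int (c - 3) = 1 * int c + (- 3)"
        using c by simp
      ultimately show ?thesis
        using trunc_W by (auto simp: vmod_def lookup_zc split: if_splits)
    qed
    moreover have "zc T = 0" if "\<not> (T \<subseteq> ?U \<and> int (card T) = int K)" for T
      using that by (intro poly_mapping_eqI) (auto simp: lookup_zc z_def)
    ultimately have zc_chain: "zc \<in> chain ?U (int K) (vmod c (- 3) 3 1)"
      by (auto simp: chain_def)

    \<comment> \<open>At a position (R', y') where some term is nonzero, the boundary is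
      \<open>\<epsilon> R\<close> times the equation \<open>star\<close> for the complement R of R'
      and the socle partner y of y'.\<close>
    have zc_cycle: "kd ?U ?a zc = (\<lambda>_. 0)"
    proof (intro ext poly_mapping_eqI)
      fix R' y'
      show "lookup (kd ?U ?a zc R') y' = lookup 0 y'"
      proof (cases "R' \<subseteq> ?U \<and> trunc c 3 y' \<and> (\<exists>v\<in>?U - R'. \<exists>w\<in>?W. v + w = y' \<and> z w (insert v R') \<noteq> 0)")
        case False
        have "lookup (?a v (zc (insert v R'))) y' = 0" if "v \<in> ?U - R'" "R' \<subseteq> ?U" for v
        proof (cases "trunc c 3 y'")
          case True
          have "keys (zc (insert v R')) \<subseteq> ?W"
            by (auto simp: in_keys_iff lookup_zc split: if_splits)
          then have "lookup (?a v (zc (insert v R'))) y' =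
              (\<Sum>w\<in>?W. if v + w = y' then lookup (zc (insert v R')) w else 0)"
            using True by (simp add: vop_def lookup_pfilt lookup_mono_op[OF finite_mons])
          also have "\<dots> = 0"
            using False True that by (intro sum.neutral) (auto simp: lookup_zc)
          finally show ?thesis .
        qed (simp add: vop_def lookup_pfilt)
        then show ?thesis
          by (simp add: kd_def lookup_sum lookup_sg)
      next
        case True
        then obtain v0 w0 where v0: "R' \<subseteq> ?U" "trunc c 3 y'" "v0 \<in> ?U - R'" "w0 \<in> ?W" "v0 + w0 = y'"
          "z w0 (insert v0 R') \<noteq> 0"
          by blast
        define R where "R = ?U - R'"
        have R': "R' = ?U - R"
          using v0(1) by (auto simp: R_def)
        have finR': "finite R'"
          using v0(1) finite_vgens finite_subset by blast
        have "card (insert v0 R') = K"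
          using v0(6) by (auto simp: z_def split: if_splits)
        then have cardR': "card R' + 1 = K"
          using v0(3) finR' by simp
        have cardR: "card R = k + 1"
          using card_Diff_subset[OF finR' v0(1)] cardR' kU by (simp add: R_def K_def)
        \<comment> \<open>The degree is 2c - 3, so the socle partner has degree c, as
          \<open>star\<close> demands.\<close>
        have "y' \<in> mons 3 (c + (c - 3))"
          using v0(3,4,5) mons_add[of v0 3 c w0 "c - 3"] by (auto simp: vgens_def)
        then obtain y where y: "y \<in> mons 3 (3 * c - 3 - (c + (c - 3)))" "trunc c 3 y" "?\<kappa> = y' + y"
          using v0(2) by (rule socle_complement)
        have yc: "y \<in> mons 3 c"
          using y(1) c by (simp add: algebra_simps)
        have inner: "lookup (?a v (zc (insert v R'))) y' =
            (if trunc c 3 (v + y) then \<epsilon> (R - {v}) * L (ind (R - {v}, v + y)) else 0)"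
          if v: "v \<in> R" for v
        proof -
          have Uv: "?U - insert v R' = R - {v}"
            by (auto simp: R_def)
          have "keys (zc (insert v R')) \<subseteq> ?W"
            by (auto simp: in_keys_iff lookup_zc split: if_splits)
          then have eq: "lookup (?a v (zc (insert v R'))) y' =
              (\<Sum>w\<in>?W. if v + w = y' then lookup (zc (insert v R')) w else 0)"
            using v0(2) by (simp add: vop_def lookup_pfilt lookup_mono_op[OF finite_mons])
          have vc: "v \<in> mons 3 c"
            using v by (auto simp: R_def vgens_def)
          show ?thesis
          proof (cases "trunc c 3 (v + y)")
            case False
            \<comment> \<open>Otherwise X^(v + y) would divide the socle monomial and so be
              truncated.\<close>
            have "v + w \<noteq> y'" for w
            proof
              assume "v + w = y'"
              with y(3) have "?\<kappa> = (v + w) + y"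
                by simp
              then have "?\<kappa> = (v + y) + w"
                by (simp add: ac_simps)
              then show False
                using False trunc_of_socle[of c "v + y" w] c by simp
            qed
            then show ?thesis
              using False unfolding eq by simp
          next
            case trunc: True
            obtain w where w: "w \<in> mons 3 (3 * c - 3 - (c + c))" "?\<kappa> = (v + y) + w"
              using mons_add[OF vc yc] trunc by (rule socle_complement)
            have wW: "w \<in> ?W"
              using w(1) c by (simp add: algebra_simps)
            have vw: "v + w' = y' \<longleftrightarrow> w' = w" for w'
            proof -
              have "y' + y = (v + w) + y"
                using w(2) y(3) by (simp add: ac_simps)
              then have "y' = v + w"
                by (simp only: add_right_cancel)
              then show ?thesis
                by auto
            qed
            have "(\<Sum>w'\<in>?W. if v + w' = y' then lookup (zc (insert v R')) w' else 0) = z w (insert v R')"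
              unfolding vw using wW by (simp add: sum.delta finite_mons lookup_zc)
            also have "\<dots> = \<epsilon> (R - {v}) * L (ind (R - {v}, v + y))"
            proof -
              have "insert v R' \<subseteq> ?U" "card (insert v R') = K"
                using v v0(1) finR' cardR' by (auto simp: R_def)
              moreover have "?\<kappa> - w = v + y"
                by (simp add: w(2))
              ultimately show ?thesis
                by (simp add: z_def Uv)
            qed
            finally show ?thesis
              using trunc unfolding eq by simp
          qed
        qed
        have "lookup (kd ?U ?a zc R') y' = (\<Sum>v\<in>R. sg v R' (lookup (?a v (zc (insert v R'))) y'))"
          using v0(1) by (simp add: kd_def lookup_sum lookup_sg R_def)
        also have "\<dots> = (\<Sum>v\<in>R. \<epsilon> R * (if trunc c 3 (v + y) then sg v (R - {v}) (L (ind (R - {v}, v + y))) else 0))"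
        proof (rule sum.cong[OF refl])
          fix v assume v: "v \<in> R"
          have "R \<subseteq> ?U"
            by (auto simp: R_def)
          then show "sg v R' (lookup (?a v (zc (insert v R'))) y') =
              \<epsilon> R * (if trunc c 3 (v + y) then sg v (R - {v}) (L (ind (R - {v}, v + y))) else 0)"
            unfolding inner[OF v] using eps[OF _ v, of "L (ind (R - {v}, v + y))"] by (simp add: R')
        qed
        also have "\<dots> = \<epsilon> R * (\<Sum>v\<in>R. if trunc c 3 (v + y) then sg v (R - {v}) (L (ind (R - {v}, v + y))) else 0)"
          by (simp add: sum_distrib_left)
        also have "\<dots> = 0"
          using star[of R y] cardR yc y(2) by (simp add: R_def)
        finally show ?thesis
          by simp
      qed
    qed

    \<comment> \<open>Green's argument uses the leading term of a product, which truncation may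
      delete; hence the passage to the full module.\<close>
    obtain g where g: "g \<in> chain (vgens c 0) (int K) (vmod c (- 3) 0 1)"
      "kd (vgens c 0) (vop c 0) g = (\<lambda>_. 0)" "\<And>T. T \<subseteq> ?U \<Longrightarrow> pfilt (trunc c 3) (g T) = zc T"
      using lift_truncated_cycle[OF _ zc_chain zc_cycle] c by auto
    let ?V = "mons 3 c"
    have gW: "keys (g T) \<subseteq> ?W" for T
    proof -
      have "g T \<in> homog 3 (1 * int c + (- 3))"
        using chain_mem[OF g(1), of T] by (simp add: vmod_0)
      also have "1 * int c + (- 3) = int (c - 3)"
        using c by simp
      finally show ?thesis
        unfolding homog_nat_iff .
    qed
    have g_zero: "lookup (g T) w = 0" if "w \<in> ?W" for w T
    proof (rule green_vanishing[where V = ?V and W = ?W and k = K and z = "\<lambda>w T. lookup (g T) w"])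
      show "finite ?V" "finite ?W"
        by (rule finite_mons)+
      show "card ?W \<le> K"
        by (rule WK)
      show "T \<subseteq> ?V \<and> card T = K" if "lookup (g T) w \<noteq> 0" for w T
      proof (rule ccontr)
        assume "\<not> (T \<subseteq> ?V \<and> card T = K)"
        then have "g T = 0"
          using g(1) unfolding chain_def vgens_0 by auto
        then show False
          using that by simp
      qed
      show "(\<Sum>v\<in>?V - T. \<Sum>w\<in>?W. if v + w = y then sg v T (lookup (g (insert v T)) w) else 0) = 0"
        if T: "T \<subseteq> ?V" for T y
      proof -
        have "(\<Sum>w\<in>?W. if v + w = y then sg v T (lookup (g (insert v T)) w) else 0) =
            sg v T (lookup (mono_op v (g (insert v T))) y)" for v
          unfolding lookup_mono_op[OF finite_mons gW] sg_sum by (intro sum.cong) auto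
        then have "(\<Sum>v\<in>?V - T. \<Sum>w\<in>?W. if v + w = y then sg v T (lookup (g (insert v T)) w) else 0) =
            lookup (kd ?V mono_op g T) y"
          using T by (simp add: kd_def lookup_sum lookup_sg)
        then show ?thesis
          using g(2) by (simp add: vgens_0 vop_0)
      qed
    qed (rule that)
    have L_ind: "L (ind (T, u)) = 0" if T: "T \<subseteq> ?U" "card T = k" and u: "w \<in> ?W" "?\<kappa> - w = u" for T u w
    proof -
      have finT: "finite T"
        using T(1) finite_vgens finite_subset by blast
      have UT: "?U - (?U - T) = T"
        using T(1) by auto
      have "card (?U - T) = K"
        using card_Diff_subset[OF finT T(1)] T(2) by (simp add: K_def)
      then have "z w (?U - T) = \<epsilon> T * L (ind (T, u))"
        using u UT by (simp add: z_def)
      moreover have "z w (?U - T) = lookup (pfilt (trunc c 3) (g (?U - T))) w"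
        using g(3)[of "?U - T"] u(1) by (simp add: lookup_zc)
      ultimately have "\<epsilon> T * L (ind (T, u)) = 0"
        using g_zero[OF u(1)] by (simp add: lookup_pfilt split: if_splits)
      then show ?thesis
        using eps_nz[OF T(1)] by simp
    qed
    \<comment> \<open>A finite set containing the support of \<open>F f\<close>, so that
      \<open>L (F f)\<close> expands into values of \<open>L\<close> on coordinates.\<close>
    let ?P = "Pow ?U \<times> mons 3 (2 * c)"
    have finP: "finite ?P"
      by (simp add: finite_vgens finite_mons)
    have supp: "T \<subseteq> ?U \<and> card T = k \<and> t \<in> mons 3 (2 * c) \<and> trunc c 3 t" if "lookup (f T) t \<noteq> 0" for T t
    proof -
      have T: "T \<subseteq> ?U" "card T = k" "f T \<in> ?X 2"
        using f that unfolding chain_def by (force split: if_splits)+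
      have "2 * int c + 0 = int (2 * c)"
        by simp
      then have "f T \<in> homog 3 (int (2 * c))" "trunc c 3 t"
        using T(3) that by (auto simp: vmod_def)
      then show ?thesis
        using T that unfolding homog_nat_iff by (auto simp: in_keys_iff subset_iff)
    qed
    have "F f = (\<lambda>e. \<Sum>p\<in>?P. F f p * ind p e)"
    proof
      fix e
      have "(\<Sum>p\<in>?P. F f p * ind p e) = (\<Sum>p\<in>?P. if e = p then F f p else 0)"
        by (intro sum.cong) (auto simp: ind_def)
      also have "\<dots> = (if e \<in> ?P then F f e else 0)"
        using finP by (simp add: sum.delta')
      also have "\<dots> = F f e"
      proof (cases "e \<in> ?P")
        case False
        then have "F f e = 0"
          using supp[of "fst e" "snd e"] by (cases e) (auto simp: F_def)
        then show ?thesis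
          using False by simp
      qed simp
      finally show "F f e = (\<Sum>p\<in>?P. F f p * ind p e)" ..
    qed
    then have "L (F f) = L (\<lambda>e. \<Sum>p\<in>?P. F f p * ind p e)"
      by (rule arg_cong)
    also have "\<dots> = (\<Sum>p\<in>?P. F f p * L (ind p))"
      unfolding L_sum[OF finP] L_scale ..
    also have "\<dots> = 0"
    proof (intro sum.neutral ballI)
      fix p :: "(nat \<Rightarrow>\<^sub>0 nat) set \<times> (nat \<Rightarrow>\<^sub>0 nat)"
      obtain T t where p: "p = (T, t)"
        by (cases p)
      show "F f p * L (ind p) = 0"
      proof (cases "lookup (f T) t = 0")
        case False
        then have T: "T \<subseteq> ?U" "card T = k" "t \<in> mons 3 (2 * c)" "trunc c 3 t"
          using supp by auto
        obtain w where w: "w \<in> mons 3 (3 * c - 3 - 2 * c)" "?\<kappa> = t + w"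
          using T(3,4) by (rule socle_complement)
        have "w \<in> ?W"
          using w(1) c by (simp add: algebra_simps)
        moreover have "?\<kappa> - w = t"
          by (simp add: w(2))
        ultimately have "L (ind (T, t)) = 0"
          using T by (intro L_ind)
        then show ?thesis
          by (simp add: p)
      qed (simp add: p F_def)
    qed
    finally show False
      using L_f by simp
  qed
qed

text \<open>Truncated monomials have degree at most 3c - 3, which is less than jc.\<close>

lemma vmod_trivial:
  assumes "c > 0" and "j \<ge> 3"
  shows "vmod c 0 3 j = ({0} :: 'k::field mpoly set)"
proof -
  have "p = 0" if p: "p \<in> vmod c 0 3 j" for p :: "'k mpoly"
  proof (rule poly_mapping_eqI, rule ccontr)
    fix t assume "lookup p t \<noteq> lookup 0 t"
    then have t: "keys t \<subseteq> {..<3}" "int (mon_degree t) = j * int c" "trunc c 3 t"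
      using p by (auto simp: vmod_def homog_iff)
    have "t \<in> mons 3 (mon_degree t)"
      using t(1) by (simp add: mons_def)
    then obtain a b e where abe: "t = tri a b e" "a + b + e = mon_degree t"
      by (rule mons_3_cases)
    have "a < c" "b < c" "e < c"
      using t(3) by (auto simp: abe(1) trunc_tri)
    then have "int (mon_degree t) < 3 * int c"
      using abe(2) by linarith
    also have "\<dots> \<le> j * int c"
      using assms by (intro mult_right_mono) auto
    finally show False
      using t(2) by simp
  qed
  then show ?thesis
    by (auto simp: vmod_def)
qed

lemma kexact_veronese_3:
  assumes "c \<ge> 3" and "k \<le> 3 * c - 3" and "j \<ge> 2"
  shows "kexact (mons 3 c) mono_op (veronese 3 c :: int \<Rightarrow> 'k::field mpoly set) (int k) j"
proof -
  have "kexact (vgens c 3) (vop c 3) (vmod c 0 3 :: int \<Rightarrow> 'k mpoly set) (int k) j"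
  proof (cases "j = 2")
    case True
    then show ?thesis
      using kexact_truncated_2[OF assms(1,2)] by simp
  next
    case False
    interpret graded_ops "vgens c 3" "vop c 3" "vmod c 0 3 :: int \<Rightarrow> 'k mpoly set"
      by (rule vmod_ops)
    have X: "vmod c 0 3 j = ({0} :: 'k mpoly set)"
      using assms False by (intro vmod_trivial) auto
    show ?thesis
      unfolding kexact_def
    proof (intro ballI impI bexI)
      fix f :: "_ \<Rightarrow> 'k mpoly" assume "f \<in> chain (vgens c 3) (int k) (vmod c 0 3 j)"
      then have "f T = 0" for T
        using chain_mem[of f "vgens c 3" "int k" "{0}" T] unfolding X by simp
      then have "f = (\<lambda>_. 0)"
        by (rule ext)
      then show "kd (vgens c 3) (vop c 3) (\<lambda>_. 0) = f"
        by simp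
    qed (rule chain_zero)
  qed
  then show ?thesis
    using kexact_untruncate[of c 0 "int k" j] assms(1) by (simp add: vgens_0 vop_0 vmod_0_veronese)
qed

section \<open>Nonvanishing\<close>

lemma homog_mono:
  assumes "n \<le> n'"
  shows "homog n d \<subseteq> homog n' d"
proof
  fix p :: "'k::field mpoly" assume "p \<in> homog n d"
  moreover have "{..<n} \<subseteq> {..<n'}"
    using assms by simp
  ultimately show "p \<in> homog n' d"
    unfolding homog_iff by (meson order_trans)
qed

text \<open>The form in which the retraction to three variables is used: a coefficient at a
  truncated monomial in them receives contributions only from generators of the same kind.\<close>

lemma mono_op_truncated_support:
  assumes "n \<ge> 3" and "v \<in> mons n c" and "c > 0" and "lookup (mono_op v p) u \<noteq> 0"
    and "keys u \<subseteq> {..<3}" and "trunc c 3 u"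
  shows "v \<in> vgens c 3"
proof -
  obtain s where s: "u = v + s"
    using assms(4) lookup_mono_op_outside by blast
  have "keys v \<subseteq> {..<3}"
    using assms(5) by (auto simp: s keys_add_nat)
  moreover have "trunc c 3 v"
    using assms(6) trunc_add[of c 3 s v] by (simp add: s add.commute)
  ultimately show ?thesis
    using assms(2,3) by (auto simp: vgens_3 mons_def)
qed

text \<open>The dual Koszul cycle acts as a functional: the signed sum over w of the coefficient at
  \<open>T w\<close> and \<open>?\<kappa> - w\<close>. It kills boundaries for every
  \<open>n\<close>, as it inspects only truncated monomials in three variables, yet it is 1 or -1 on
  the lift of a chain concentrated at one set.\<close>

lemma not_kexact_veronese:
  assumes n: "n \<ge> 3" and c: "c \<ge> 3"
  shows "\<not> kexact (mons n c) mono_op (veronese n c :: int \<Rightarrow> 'k::field mpoly set) (int (3 * c - 2)) 2"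
proof
  assume ex: "kexact (mons n c) mono_op (veronese n c :: int \<Rightarrow> 'k mpoly set) (int (3 * c - 2)) 2"
  let ?U = "vgens c 3" and ?W = "mons 3 (c - 3)" and ?B = "outer_mons c" and ?q = "tri 1 1 1"
  let ?k = "int (3 * c - 2)" and ?\<kappa> = "socle c"
  interpret tr: graded_ops ?U "vop c 3" "vmod c 0 3 :: int \<Rightarrow> 'k mpoly set"
    by (rule vmod_ops)
  have finB: "finite ?B"
    by (simp add: outer_mons_def finite_vgens)
  have qW: "?q + w \<in> ?U" "?q + w \<notin> ?B" if "w \<in> ?W" for w
    using inner_mons_subset[OF c] that by (auto simp: outer_mons_def)
  have BU: "?B \<subseteq> ?U"
    by (auto simp: outer_mons_def)
  have U_cases: "v \<in> ?B \<or> (\<exists>w\<in>?W. v = ?q + w)" if "v \<in> ?U" for v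
    using that by (auto simp: outer_mons_def)
  have comp: "\<exists>u\<in>mons 3 (2 * c). trunc c 3 u \<and> ?\<kappa> = w + u" if w: "w \<in> ?W" for w
  proof -
    have "trunc c 3 w"
      using w c by (elim mons_3_cases) (auto simp: trunc_tri)
    with w obtain u where "u \<in> mons 3 (3 * c - 3 - (c - 3))" "trunc c 3 u" "?\<kappa> = w + u"
      by (rule socle_complement)
    moreover have "3 * c - 3 - (c - 3) = 2 * c"
      using c by simp
    ultimately show ?thesis
      by auto
  qed
  define w0 where "w0 = tri (c - 3) 0 0"
  have w0: "w0 \<in> ?W"
    by (simp add: w0_def tri_mons)
  \<comment> \<open>The complement in \<open>?U\<close> of the elements q + w' with w' \<noteq> w,
    hence of cardinality (3c - 3) + 1.\<close>
  define T where "T w = insert (?q + w) ?B" for w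
  have TU: "T w \<subseteq> ?U" "card (T w) = 3 * c - 2" if "w \<in> ?W" for w
    using qW[OF that] BU finB card_outer_mons[OF c] c by (auto simp: T_def)
  have T_inj: "T w = T w' \<longleftrightarrow> w = w'" if "w \<in> ?W" "w' \<in> ?W" for w w'
    using qW[OF that(1)] qW[OF that(2)] unfolding T_def
    by (metis add_left_cancel insert_iff)
  define f where "f S = (if S = T w0 then Poly_Mapping.single (?\<kappa> - w0) 1 else 0 :: 'k mpoly)" for S
  have kw0: "?\<kappa> - w0 \<in> mons 3 (2 * c)" "trunc c 3 (?\<kappa> - w0)"
    using comp[OF w0] by auto
  have "Poly_Mapping.single (?\<kappa> - w0) 1 \<in> (vmod c 0 3 2 :: 'k mpoly set)"
    using kw0 by (auto simp: vmod_def mons_def lookup_single when_def intro!: homog_single)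
  then have f: "f \<in> chain ?U ?k (vmod c 0 3 2)"
    using TU[OF w0] by (auto simp: chain_def f_def tr.zero_mem)
  \<comment> \<open>The boundary has internal degree 3, where the truncated ring is zero.\<close>
  have "kd ?U (vop c 3) f S = 0" for S
    using chain_mem[OF tr.kd_chain[OF f] tr.zero_mem, of S] vmod_trivial[of c 3, where 'k = 'k] c by simp
  then have cyc: "kd ?U (vop c 3) f = (\<lambda>_. 0)"
    by (rule ext)
  obtain g where g: "g \<in> chain (vgens c 0) ?k (vmod c 0 0 2)" "kd (vgens c 0) (vop c 0) g = (\<lambda>_. 0)"
    "\<And>S. S \<subseteq> ?U \<Longrightarrow> pfilt (trunc c 3) (g S) = f S"
    using lift_truncated_cycle[OF _ f cyc] c by auto
  have sub: "mons 3 c \<subseteq> mons n c"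
    using n by (auto simp: mons_def)
  have g_out: "g S = 0" if "\<not> S \<subseteq> mons 3 c" for S
    using chain_outside[OF g(1)] that by (simp add: vgens_0)
  have gn: "g \<in> chain (mons n c) ?k (veronese n c 2)"
    unfolding chain_def mem_Collect_eq
  proof
    fix S
    show "if S \<subseteq> mons n c \<and> int (card S) = ?k then g S \<in> veronese n c 2 else g S = 0"
    proof (cases "S \<subseteq> mons 3 c \<and> int (card S) = ?k")
      case True
      then have "g S \<in> vmod c 0 0 2"
        using g(1) unfolding chain_def vgens_0 by auto
      then have "g S \<in> veronese n c 2"
        using homog_mono[OF n] by (auto simp: vmod_0 veronese_def)
      then show ?thesis
        using True sub by auto
    next
      case False
      then have "g S = 0"
        using g(1) unfolding chain_def vgens_0 by auto
      then show ?thesis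
        by (simp add: veronese_def)
    qed
  qed
  have "kd (mons n c) mono_op g = (\<lambda>_. 0)"
  proof
    fix S
    show "kd (mons n c) mono_op g S = 0"
    proof (cases "S \<subseteq> mons 3 c")
      case True
      have zero: "mono_op v 0 = (0 :: 'k mpoly)" for v
        by (simp add: mono_op_def)
      have "kd (mons n c) mono_op g S = kd (mons 3 c) mono_op g S"
      proof -
        have "(\<Sum>v\<in>mons n c - S. sg v S (mono_op v (g (insert v S)))) =
            (\<Sum>v\<in>mons 3 c - S. sg v S (mono_op v (g (insert v S))))"
        proof (rule sum.mono_neutral_right)
          show "\<forall>v\<in>mons n c - S - (mons 3 c - S). sg v S (mono_op v (g (insert v S))) = 0"
          proof
            fix v assume "v \<in> mons n c - S - (mons 3 c - S)"
            then have "\<not> insert v S \<subseteq> mons 3 c"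
              by auto
            then show "sg v S (mono_op v (g (insert v S))) = 0"
              by (simp add: g_out zero)
          qed
        qed (use sub finite_mons in auto)
        then show ?thesis
          using True sub by (simp add: kd_def)
      qed
      then show ?thesis
        using g(2) by (simp add: vgens_0 vop_0)
    next
      case False
      then have "g (insert v S) = 0" for v
        by (intro g_out) auto
      then show ?thesis
        by (simp add: kd_def mono_op_def)
    qed
  qed
  then obtain h where h: "h \<in> chain (mons n c) (?k + 1) (veronese n c (2 - 1))" "kd (mons n c) mono_op h = g"
    using ex gn unfolding kexact_def by blast

  \<comment> \<open>This is the coefficient of h at B \<union> {q + w, q + w'} and the monomial
    \<kappa> - w - w' - q, hence symmetric in w and w'. Subtraction of exponents is cut off at zero,
    so divisibility is treated separately.\<close>
  define H where "H w w' = lookup (mono_op (?q + w') (h (insert (?q + w') (T w)))) (?\<kappa> - w)" for w w'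
  have H_sym: "H w w' = H w' w" if w: "w \<in> ?W" "w' \<in> ?W" for w w'
  proof -
    have ins: "insert (?q + w') (T w) = insert (?q + w) (T w')"
      by (auto simp: T_def)
    have *: "H w w' = (if \<exists>s. ?\<kappa> = w + w' + ?q + s then lookup (h (insert (?q + w') (T w))) (?\<kappa> - (w + w' + ?q)) else 0)"
      if w: "w \<in> ?W" "w' \<in> ?W" for w w'
    proof -
      obtain u where u: "?\<kappa> = w + u"
        using comp[OF w(1)] by auto
      then have ku: "?\<kappa> - w = u"
        by simp
      have iff: "?\<kappa> = w + w' + ?q + s \<longleftrightarrow> u = (?q + w') + s" for s
      proof -
        have "?\<kappa> = w + w' + ?q + s \<longleftrightarrow> w + u = w + ((?q + w') + s)"
          unfolding u by (simp add: ac_simps)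
        then show ?thesis
          by (simp only: add_left_cancel)
      qed
      show ?thesis
      proof (cases "\<exists>s. u = (?q + w') + s")
        case True
        then obtain s where s: "u = (?q + w') + s"
          by blast
        then have "?\<kappa> = w + w' + ?q + s"
          using iff by blast
        then have "?\<kappa> - (w + w' + ?q) = s"
          by simp
        moreover have "H w w' = lookup (h (insert (?q + w') (T w))) s"
          unfolding H_def ku s by (rule lookup_mono_op_add)
        ultimately show ?thesis
          using \<open>?\<kappa> = w + w' + ?q + s\<close> by auto
      next
        case False
        then have "H w w' = 0"
          unfolding H_def ku by (intro lookup_mono_op_outside) blast
        then show ?thesis
          using False iff by auto
      qed
    qed
    have "w' + w + ?q = w + w' + ?q"
      by (simp add: add.commute)
    then show ?thesis
      unfolding *[OF w] *[OF w(2,1)] ins by simp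
  qed
  \<comment> \<open>A generator outside \<open>?U\<close> cannot divide the truncated monomial
    \<kappa> - w, and the elements of \<open>?U\<close> outside \<open>T w\<close> are the q + w'
    with w' \<noteq> w.\<close>
  have g_eq: "lookup (g (T w)) (?\<kappa> - w) = (\<Sum>w'\<in>?W - {w}. sg (?q + w') (T w) (H w w'))" if w: "w \<in> ?W" for w
  proof -
    obtain u where u: "u \<in> mons 3 (2 * c)" "trunc c 3 u" "?\<kappa> = w + u"
      using comp[OF w] by auto
    then have ku: "?\<kappa> - w = u"
      by simp
    let ?t = "\<lambda>v. sg v (T w) (lookup (mono_op v (h (insert v (T w)))) u)"
    have Tn: "T w \<subseteq> mons n c"
      using TU[OF w] sub by (auto simp: vgens_def)
    have "lookup (g (T w)) u = lookup (kd (mons n c) mono_op h (T w)) u"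
      by (simp add: h(2))
    also have "\<dots> = (\<Sum>v\<in>mons n c - T w. ?t v)"
      using Tn by (simp add: kd_def lookup_sum lookup_sg)
    also have "\<dots> = (\<Sum>v\<in>(+) ?q ` (?W - {w}). ?t v)"
    proof (rule sum.mono_neutral_right)
      show "(+) ?q ` (?W - {w}) \<subseteq> mons n c - T w"
        using qW sub by (auto simp: T_def vgens_def)
      show "\<forall>v\<in>mons n c - T w - (+) ?q ` (?W - {w}). ?t v = 0"
      proof
        fix v assume v: "v \<in> mons n c - T w - (+) ?q ` (?W - {w})"
        show "?t v = 0"
        proof (rule ccontr)
          assume "?t v \<noteq> 0"
          then have "v \<in> ?U"
            using v n c u(1,2) by (intro mono_op_truncated_support[of n v c "h (insert v (T w))" u])
              (auto simp: mons_def)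
          then show False
            using U_cases[of v] v by (auto simp: T_def)
        qed
      qed
    qed (simp add: finite_mons)
    also have "\<dots> = (\<Sum>w'\<in>?W - {w}. ?t (?q + w'))"
      by (simp add: sum.reindex[OF inj_add])
    finally show ?thesis
      by (simp add: H_def ku)
  qed
  have zero: "(\<Sum>w\<in>?W. sg (?q + w) ?B (lookup (g (T w)) (?\<kappa> - w))) = 0"
  proof -
    have "(\<Sum>w\<in>?W. sg (?q + w) ?B (lookup (g (T w)) (?\<kappa> - w))) =
        (\<Sum>w\<in>?W. \<Sum>w'\<in>?W - {w}. sg (?q + w) ?B (sg (?q + w') (T w) (H w w')))"
      using g_eq by (intro sum.cong refl) (simp add: sg_sum)
    also have "\<dots> = 0"
    \<comment> \<open>The coefficients are symmetric in w and w', while exchanging the two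
      insertions into B reverses the sign.\<close>
    proof (rule sum_antisym_eq_0[OF finite_mons])
      fix w w' assume w: "w \<in> ?W" "w' \<in> ?W" "w \<noteq> w'"
      then show "sg (?q + w) ?B (sg (?q + w') (T w) (H w w')) =
          - sg (?q + w') ?B (sg (?q + w) (T w') (H w' w))"
        using sg_transpose[OF finB qW(2)[OF w(1)] qW(2)[OF w(2)], of "H w w'"] H_sym[OF w(1,2)]
        by (simp add: T_def)
    qed
    finally show ?thesis .
  qed
  have "lookup (g (T w)) (?\<kappa> - w) = (if w = w0 then 1 else 0)" if w: "w \<in> ?W" for w
  proof -
    have "trunc c 3 (?\<kappa> - w)"
      using comp[OF w] by auto
    then have "lookup (g (T w)) (?\<kappa> - w) = lookup (f (T w)) (?\<kappa> - w)"
      using g(3)[OF TU(1)[OF w]] by (metis lookup_pfilt)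
    then show ?thesis
      using T_inj[OF w w0] by (auto simp: f_def)
  qed
  then have "(\<Sum>w\<in>?W. sg (?q + w) ?B (lookup (g (T w)) (?\<kappa> - w))) =
      (\<Sum>w\<in>?W. if w = w0 then sg (?q + w) ?B 1 else 0 :: 'k)"
    by (intro sum.cong) auto
  also have "\<dots> = sg (?q + w0) ?B 1"
    using w0 finite_mons by (simp add: sum.delta)
  finally show False
    using zero by simp
qed

theorem theorem4p7:
  fixes n c :: nat
  assumes "n \<ge> 3" and "c \<ge> 3"
  shows "green_lazarsfeld_index (Const :: 'k::field \<Rightarrow> 'k mpoly) (veronese n c) \<le> enat (3 * c - 3) \<and>
         (n = 3 \<longrightarrow>
          green_lazarsfeld_index (Const :: 'k \<Rightarrow> 'k mpoly) (veronese n c) = enat (3 * c - 3))"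
proof -
  have "green_lazarsfeld_index (Const :: 'k \<Rightarrow> 'k mpoly) (veronese n c) < enat (3 * c - 2)"
    using assms by (intro green_lazarsfeld_index_less not_kexact_veronese) auto
  then have "green_lazarsfeld_index (Const :: 'k \<Rightarrow> 'k mpoly) (veronese n c) \<le> enat (3 * c - 3)"
    by (cases "green_lazarsfeld_index (Const :: 'k \<Rightarrow> 'k mpoly) (veronese n c)") auto
  moreover have "enat (3 * c - 3) \<le> green_lazarsfeld_index (Const :: 'k \<Rightarrow> 'k mpoly) (veronese n c)" if "n = 3"
    unfolding that using assms(2) kexact_veronese_3 by (intro green_lazarsfeld_index_ge) auto
  ultimately show ?thesis
    by (auto intro: antisym)
qed

end
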